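(* Let $k>2$ and let $(M,g)=F_1\times_{u_2}F_2\times\ldots\times_{u_k}F_k$ be a closed multiply warped product, with $n_i=\dim F_i$ and $n=\sum_{j=1}^k n_j$, and suppose that $\langle H_i,H_j\rangle=0$ for $i\ne j$. Let $\tilde M$ be an arbitrary Riemannian manifold. Then there are no isometric immersions $f:F_1\times_{u_2}F_2\times\ldots\times_{u_k}F_k\to\tilde M$ satisfying (at the points of $M$) the inequality $$\frac{n^2(k-1)}{2k}\,H^2<-n_1(n-n_1)\max\tilde K.$$ In particular, there are no minimal isometric immersions $f$ when the sectional curvature of $\tilde M$ satisfies $\tilde K<0$.
   Context: Multiply warped product: given Riemannian manifolds $(F_i,g_{F_i})$, $1\le i\le k$, and smooth functions $u_i:F_1\to(0,\infty)$, $2\le i\le k$, $F_1\times_{u_2}F_2\times\ldots\times_{u_k}F_k$ is the manifold $M=F_1\times\ldots\times F_k$ with the metric $g=g_{F_1}\oplus u_2^2\,g_{F_2}\oplus\ldots\oplus u_k^2\,g_{F_k}$. Closed means compact without boundary. Let $\mathcal D_i$ be the distribution on $M$ of vectors tangent to the factor $F_i$; $H_i$ denotes the mean curvature vector field (trace of the second fundamental form) of $\mathcal D_i$ in $(M,g)$; thus $H_1=0$ and $H_i=-n_i\nabla(\log u_i)$ for $i\ge2$. For an isometric immersion $f:M\to\tilde M$, $H^2=\langle H,H\rangle$ is the squared mean curvature of $f$, where $H=\frac1n\operatorname{Tr}_g(\text{second fundamental form of }f)$. For $x\in M$, $\max\tilde K(x)$ is the maximum of the sectional curvature $\tilde K$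 of $\tilde M$ over the 2-planes contained in the tangent space $T_xM$ (identified with $df(T_xM)$). The immersion is minimal if $H=0$. *)

theory Defs
  imports "HOL-Analysis.Analysis"
begin

section \<open>Smooth functions on open subsets of coordinate space\<close>

text \<open>
  The model space \<open>\<real>\<^sup>I\<close>, for a finite index set \<open>I\<close>, is the library's \<^term>\<open>powertop_real I\<close>; its
  points are the functions in \<^term>\<open>extensional I\<close>. Using index sets instead of types for the
  dimension lets the factors of a product have different dimensions, and makes the coordinates of
  the product the disjoint union of those of the factors.

  Components of vectors and tensors are functions of which only the values at indices in \<open>I\<close>
  are ever used.
\<close>

definition pderivative :: "'i \<Rightarrow> (('i \<Rightarrow> real) \<Rightarrow> real) \<Rightarrow> ('i \<Rightarrow> real) \<Rightarrow> real"
  where "pderivative i f x = deriv (\<lambda>t. f (x(i := t))) (x i)"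

fun iterated_pderivative :: "'i list \<Rightarrow> (('i \<Rightarrow> real) \<Rightarrow> real) \<Rightarrow> ('i \<Rightarrow> real) \<Rightarrow> real"
  where
    "iterated_pderivative [] f = f"
  | "iterated_pderivative (i # is) f = pderivative i (iterated_pderivative is f)"

text \<open>Class \<open>C\<^sup>\<infinity>\<close>: all iterated partial derivatives exist and are continuous on the open set \<open>U\<close>.\<close>

definition smooth_on :: "'i set \<Rightarrow> ('i \<Rightarrow> real) set \<Rightarrow> (('i \<Rightarrow> real) \<Rightarrow> real) \<Rightarrow> bool"
  where "smooth_on I U f \<longleftrightarrow>
    (\<forall>is \<in> lists I.
       continuous_map (subtopology (powertop_real I) U) euclideanreal (iterated_pderivative is f) \<and>
       (\<forall>i\<in>I. \<forall>x\<in>U. (\<lambda>t. iterated_pderivative is f (x(i := t))) field_differentiable at (x i)))"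


section \<open>Linear algebra in coordinates\<close>

definition inner_of :: "'i set \<Rightarrow> ('i \<Rightarrow> 'i \<Rightarrow> real) \<Rightarrow> ('i \<Rightarrow> real) \<Rightarrow> ('i \<Rightarrow> real) \<Rightarrow> real"
  where "inner_of I G v w = (\<Sum>i\<in>I. \<Sum>j\<in>I. G i j * v i * w j)"

text \<open>The inverse of the matrix \<open>(G i j)\<close>, \<open>i, j \<in> I\<close>; its entries outside \<open>I \<times> I\<close> are irrelevant.\<close>

definition inverse_matrix :: "'i set \<Rightarrow> ('i \<Rightarrow> 'i \<Rightarrow> real) \<Rightarrow> 'i \<Rightarrow> 'i \<Rightarrow> real"
  where "inverse_matrix I G =
    (SOME B. \<forall>i\<in>I. \<forall>j\<in>I. (\<Sum>k\<in>I. G i k * B k j) = (if i = j then 1 else 0))"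

definition independent_pair :: "'i set \<Rightarrow> ('i \<Rightarrow> real) \<Rightarrow> ('i \<Rightarrow> real) \<Rightarrow> bool"
  where "independent_pair I v w \<longleftrightarrow>
    (\<forall>a b. (\<forall>i\<in>I. a * v i + b * w i = 0) \<longrightarrow> a = 0 \<and> b = 0)"

text \<open>
  The component of \<open>w\<close> orthogonal to the linear subspace \<open>T\<close>, with respect to the inner product with
  Gram matrix \<open>G\<close>: the vector \<open>z \<in> T\<^sup>\<bottom>\<close> with \<open>w - z \<in> T\<close>, whose components in \<open>I\<close> are unique.
\<close>

definition normal_part ::
    "'i set \<Rightarrow> ('i \<Rightarrow> 'i \<Rightarrow> real) \<Rightarrow> ('i \<Rightarrow> real) set \<Rightarrow> ('i \<Rightarrow> real) \<Rightarrow> 'i \<Rightarrow> real"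
  where "normal_part I G T w =
    (SOME z. (\<forall>t\<in>T. inner_of I G z t = 0) \<and> (\<exists>t\<in>T. \<forall>i\<in>I. w i = z i + t i))"


section \<open>Riemannian manifolds\<close>

text \<open>
  A manifold is given by an indexed smooth atlas \<open>(cdom c, cmap c)\<close>, \<open>c \<in> charts\<close>, with values in
  \<open>\<real>\<^sup>I\<close>, where \<open>I = cindex\<close>; \<open>gram c p\<close> is the Gram matrix at \<open>p\<close> of the Riemannian metric in the
  coordinate basis of the chart \<open>c\<close>. The atlas need not be a maximal one.
\<close>

record ('a, 'c, 'i) riem_manifold =
  mtop :: "'a topology"
  cindex :: "'i set"
  charts :: "'c set"
  cdom :: "'c \<Rightarrow> 'a set"
  cmap :: "'c \<Rightarrow> 'a \<Rightarrow> 'i \<Rightarrow> real"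
  gram :: "'c \<Rightarrow> 'a \<Rightarrow> 'i \<Rightarrow> 'i \<Rightarrow> real"

abbreviation points :: "('a, 'c, 'i) riem_manifold \<Rightarrow> 'a set"
  where "points M \<equiv> topspace (mtop M)"

definition mdim :: "('a, 'c, 'i) riem_manifold \<Rightarrow> nat"
  where "mdim M = card (cindex M)"

definition cinv :: "('a, 'c, 'i) riem_manifold \<Rightarrow> 'c \<Rightarrow> ('i \<Rightarrow> real) \<Rightarrow> 'a"
  where "cinv M c = inv_into (cdom M c) (cmap M c)"

definition topological_manifold :: "('a, 'c, 'i) riem_manifold \<Rightarrow> bool"
  where "topological_manifold M \<longleftrightarrow>
    Hausdorff_space (mtop M) \<and> second_countable (mtop M) \<and> finite (cindex M) \<and>
    (\<Union>c\<in>charts M. cdom M c) = points M \<and>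
    (\<forall>c\<in>charts M.
       openin (mtop M) (cdom M c) \<and>
       openin (powertop_real (cindex M)) (cmap M c ` cdom M c) \<and>
       homeomorphic_map (subtopology (mtop M) (cdom M c))
         (subtopology (powertop_real (cindex M)) (cmap M c ` cdom M c)) (cmap M c))"

definition transition ::
    "('a, 'c, 'i) riem_manifold \<Rightarrow> 'c \<Rightarrow> 'c \<Rightarrow> 'i \<Rightarrow> ('i \<Rightarrow> real) \<Rightarrow> real"
  where "transition M c d k x = cmap M d (cinv M c x) k"

definition smooth_atlas :: "('a, 'c, 'i) riem_manifold \<Rightarrow> bool"
  where "smooth_atlas M \<longleftrightarrow>
    (\<forall>c\<in>charts M. \<forall>d\<in>charts M. \<forall>k\<in>cindex M.
       smooth_on (cindex M) (cmap M c ` (cdom M c \<inter> cdom M d)) (transition M c d k))"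

text \<open>The Gram matrix in the chart \<open>c\<close> as a function of the coordinates.\<close>

definition lgram :: "('a, 'c, 'i) riem_manifold \<Rightarrow> 'c \<Rightarrow> ('i \<Rightarrow> real) \<Rightarrow> 'i \<Rightarrow> 'i \<Rightarrow> real"
  where "lgram M c x i j = gram M c (cinv M c x) i j"

text \<open>The last clause is the transformation law of a covariant 2-tensor.\<close>

definition riemannian_metric :: "('a, 'c, 'i) riem_manifold \<Rightarrow> bool"
  where "riemannian_metric M \<longleftrightarrow>
    (\<forall>c\<in>charts M. \<forall>i\<in>cindex M. \<forall>j\<in>cindex M.
       smooth_on (cindex M) (cmap M c ` cdom M c) (\<lambda>x. lgram M c x i j)) \<and>
    (\<forall>c\<in>charts M. \<forall>p\<in>cdom M c.
       (\<forall>i\<in>cindex M. \<forall>j\<in>cindex M. gram M c p i j = gram M c p j i) \<and>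
       (\<forall>v. (\<exists>i\<in>cindex M. v i \<noteq> 0) \<longrightarrow> inner_of (cindex M) (gram M c p) v v > 0)) \<and>
    (\<forall>c\<in>charts M. \<forall>d\<in>charts M. \<forall>p\<in>cdom M c \<inter> cdom M d. \<forall>i\<in>cindex M. \<forall>j\<in>cindex M.
       gram M c p i j =
         inner_of (cindex M) (gram M d p)
           (\<lambda>k. pderivative i (transition M c d k) (cmap M c p))
           (\<lambda>k. pderivative j (transition M c d k) (cmap M c p)))"

definition riemannian_manifold :: "('a, 'c, 'i) riem_manifold \<Rightarrow> bool"
  where "riemannian_manifold M \<longleftrightarrow>
    topological_manifold M \<and> smooth_atlas M \<and> riemannian_metric M"

text \<open>
  Since charts take values in open subsets of \<open>\<real>\<^sup>I\<close>, there is no boundary, and a closed manifold is a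
  compact one. The empty space is excluded.
\<close>

definition closed_manifold :: "('a, 'c, 'i) riem_manifold \<Rightarrow> bool"
  where "closed_manifold M \<longleftrightarrow> compact_space (mtop M) \<and> points M \<noteq> {}"

definition smooth_function :: "('a, 'c, 'i) riem_manifold \<Rightarrow> ('a \<Rightarrow> real) \<Rightarrow> bool"
  where "smooth_function M u \<longleftrightarrow>
    (\<forall>c\<in>charts M. smooth_on (cindex M) (cmap M c ` cdom M c) (\<lambda>x. u (cinv M c x)))"

text \<open>
  Pointwise quantities at \<open>p\<close> are evaluated in a chosen chart around \<open>p\<close>; being tensorial, the scalar
  quantities do not depend on the choice. Tangent vectors at \<open>p\<close> are represented by their components
  in the coordinate basis of this chart.
\<close>

definition chart_at :: "('a, 'c, 'i) riem_manifold \<Rightarrow> 'a \<Rightarrow> 'c"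
  where "chart_at M p = (SOME c. c \<in> charts M \<and> p \<in> cdom M c)"

definition coords_at :: "('a, 'c, 'i) riem_manifold \<Rightarrow> 'a \<Rightarrow> 'i \<Rightarrow> real"
  where "coords_at M p = cmap M (chart_at M p) p"

definition gram_at :: "('a, 'c, 'i) riem_manifold \<Rightarrow> 'a \<Rightarrow> 'i \<Rightarrow> 'i \<Rightarrow> real"
  where "gram_at M p = gram M (chart_at M p) p"

definition inner_at :: "('a, 'c, 'i) riem_manifold \<Rightarrow> 'a \<Rightarrow> ('i \<Rightarrow> real) \<Rightarrow> ('i \<Rightarrow> real) \<Rightarrow> real"
  where "inner_at M p = inner_of (cindex M) (gram_at M p)"


section \<open>Levi-Civita connection and sectional curvature\<close>

text \<open>\<open>christoffel M c x l i j\<close> is \<open>\<Gamma>\<^sup>l\<^sub>i\<^sub>j\<close>, the \<open>l\<close>-component of \<open>\<nabla>\<close> of \<open>\<partial>\<^sub>j\<close> along \<open>\<partial>\<^sub>i\<close>.\<close>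

definition christoffel ::
    "('a, 'c, 'i) riem_manifold \<Rightarrow> 'c \<Rightarrow> ('i \<Rightarrow> real) \<Rightarrow> 'i \<Rightarrow> 'i \<Rightarrow> 'i \<Rightarrow> real"
  where "christoffel M c x l i j =
    (\<Sum>m\<in>cindex M. inverse_matrix (cindex M) (lgram M c x) l m *
       (pderivative i (\<lambda>y. lgram M c y j m) x + pderivative j (\<lambda>y. lgram M c y i m) x
        - pderivative m (\<lambda>y. lgram M c y i j) x)) / 2"

text \<open>
  \<open>curvature_tensor M c x l i j k\<close> is the \<open>l\<close>-component of \<open>R(\<partial>\<^sub>i, \<partial>\<^sub>j) \<partial>\<^sub>k\<close>, where
  \<open>R(X, Y) Z = \<nabla>\<^sub>X \<nabla>\<^sub>Y Z - \<nabla>\<^sub>Y \<nabla>\<^sub>X Z - \<nabla>\<^bsub>[X, Y]\<^esub> Z\<close>. With this sign the sectional curvature of the plane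
  spanned by \<open>v, w\<close> is \<open>\<langle>R(v, w) w, v\<rangle> / (|v|\<^sup>2 |w|\<^sup>2 - \<langle>v, w\<rangle>\<^sup>2)\<close>, positive on round spheres.
\<close>

definition curvature_tensor ::
    "('a, 'c, 'i) riem_manifold \<Rightarrow> 'c \<Rightarrow> ('i \<Rightarrow> real) \<Rightarrow> 'i \<Rightarrow> 'i \<Rightarrow> 'i \<Rightarrow> 'i \<Rightarrow> real"
  where "curvature_tensor M c x l i j k =
    pderivative i (\<lambda>y. christoffel M c y l j k) x - pderivative j (\<lambda>y. christoffel M c y l i k) x
    + (\<Sum>m\<in>cindex M. christoffel M c x l i m * christoffel M c x m j k
                     - christoffel M c x l j m * christoffel M c x m i k)"

definition curvature_op ::
    "('a, 'c, 'i) riem_manifold \<Rightarrow> 'a \<Rightarrow> ('i \<Rightarrow> real) \<Rightarrow> ('i \<Rightarrow> real) \<Rightarrow> ('i \<Rightarrow> real) \<Rightarrow> 'i \<Rightarrow> real"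
  where "curvature_op M p v w z l =
    (\<Sum>i\<in>cindex M. \<Sum>j\<in>cindex M. \<Sum>k\<in>cindex M.
       curvature_tensor M (chart_at M p) (coords_at M p) l i j k * v i * w j * z k)"

definition sectional_curvature ::
    "('a, 'c, 'i) riem_manifold \<Rightarrow> 'a \<Rightarrow> ('i \<Rightarrow> real) \<Rightarrow> ('i \<Rightarrow> real) \<Rightarrow> real"
  where "sectional_curvature M p v w =
    inner_at M p (curvature_op M p v w w) v /
    (inner_at M p v v * inner_at M p w w - (inner_at M p v w)\<^sup>2)"

definition negative_sectional_curvature :: "('a, 'c, 'i) riem_manifold \<Rightarrow> bool"
  where "negative_sectional_curvature M \<longleftrightarrow>
    (\<forall>p\<in>points M. \<forall>v w. independent_pair (cindex M) v w \<longrightarrow> sectional_curvature M p v w < 0)"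


section \<open>Isometric immersions\<close>

definition local_rep ::
    "('a, 'c, 'i) riem_manifold \<Rightarrow> ('b, 'd, 'j) riem_manifold \<Rightarrow> ('a \<Rightarrow> 'b) \<Rightarrow>
     'c \<Rightarrow> 'd \<Rightarrow> 'j \<Rightarrow> ('i \<Rightarrow> real) \<Rightarrow> real"
  where "local_rep M N f c d \<alpha> x = cmap N d (f (cinv M c x)) \<alpha>"

definition smooth_map ::
    "('a, 'c, 'i) riem_manifold \<Rightarrow> ('b, 'd, 'j) riem_manifold \<Rightarrow> ('a \<Rightarrow> 'b) \<Rightarrow> bool"
  where "smooth_map M N f \<longleftrightarrow>
    continuous_map (mtop M) (mtop N) f \<and>
    (\<forall>c\<in>charts M. \<forall>d\<in>charts N. \<forall>\<alpha>\<in>cindex N.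
       smooth_on (cindex M) (cmap M c ` (cdom M c \<inter> f -` cdom N d)) (local_rep M N f c d \<alpha>))"

definition differential ::
    "('a, 'c, 'i) riem_manifold \<Rightarrow> ('b, 'd, 'j) riem_manifold \<Rightarrow> ('a \<Rightarrow> 'b) \<Rightarrow> 'a \<Rightarrow>
     ('i \<Rightarrow> real) \<Rightarrow> 'j \<Rightarrow> real"
  where "differential M N f p v \<alpha> =
    (\<Sum>i\<in>cindex M.
       pderivative i (local_rep M N f (chart_at M p) (chart_at N (f p)) \<alpha>) (coords_at M p) * v i)"

definition isometric_immersion ::
    "('a, 'c, 'i) riem_manifold \<Rightarrow> ('b, 'd, 'j) riem_manifold \<Rightarrow> ('a \<Rightarrow> 'b) \<Rightarrow> bool"
  where "isometric_immersion M N f \<longleftrightarrow>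
    smooth_map M N f \<and>
    (\<forall>p\<in>points M.
       (\<forall>v. (\<forall>\<alpha>\<in>cindex N. differential M N f p v \<alpha> = 0) \<longrightarrow> (\<forall>i\<in>cindex M. v i = 0)) \<and>
       (\<forall>v w. inner_at N (f p) (differential M N f p v) (differential M N f p w)
                = inner_at M p v w))"

text \<open>
  \<open>covariant_hessian M N f p i j\<close> is the covariant derivative in \<open>N\<close> of the vector field \<open>df(\<partial>\<^sub>j)\<close> along
  \<open>df(\<partial>\<^sub>i)\<close>; its part normal to \<open>df(T\<^sub>pM)\<close> is the value of the second fundamental form at
  \<open>(\<partial>\<^sub>i, \<partial>\<^sub>j)\<close>.
\<close>

definition covariant_hessian ::
    "('a, 'c, 'i) riem_manifold \<Rightarrow> ('b, 'd, 'j) riem_manifold \<Rightarrow> ('a \<Rightarrow> 'b) \<Rightarrow> 'a \<Rightarrow>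
     'i \<Rightarrow> 'i \<Rightarrow> 'j \<Rightarrow> real"
  where "covariant_hessian M N f p i j \<alpha> =
    (let c = chart_at M p; d = chart_at N (f p); F = local_rep M N f c d;
         x = coords_at M p; y = coords_at N (f p)
     in pderivative i (pderivative j (F \<alpha>)) x
        + (\<Sum>\<beta>\<in>cindex N. \<Sum>\<gamma>\<in>cindex N.
             christoffel N d y \<alpha> \<beta> \<gamma> * pderivative i (F \<beta>) x * pderivative j (F \<gamma>) x))"

definition second_fundamental_form ::
    "('a, 'c, 'i) riem_manifold \<Rightarrow> ('b, 'd, 'j) riem_manifold \<Rightarrow> ('a \<Rightarrow> 'b) \<Rightarrow> 'a \<Rightarrow>
     'i \<Rightarrow> 'i \<Rightarrow> 'j \<Rightarrow> real"
  where "second_fundamental_form M N f p i j =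
    normal_part (cindex N) (gram_at N (f p)) (range (differential M N f p))
      (covariant_hessian M N f p i j)"

definition mean_curvature_vector ::
    "('a, 'c, 'i) riem_manifold \<Rightarrow> ('b, 'd, 'j) riem_manifold \<Rightarrow> ('a \<Rightarrow> 'b) \<Rightarrow> 'a \<Rightarrow> 'j \<Rightarrow> real"
  where "mean_curvature_vector M N f p \<alpha> =
    (\<Sum>i\<in>cindex M. \<Sum>j\<in>cindex M.
       inverse_matrix (cindex M) (gram_at M p) i j * second_fundamental_form M N f p i j \<alpha>)
    / real (mdim M)"

definition squared_mean_curvature ::
    "('a, 'c, 'i) riem_manifold \<Rightarrow> ('b, 'd, 'j) riem_manifold \<Rightarrow> ('a \<Rightarrow> 'b) \<Rightarrow> 'a \<Rightarrow> real"
  where "squared_mean_curvature M N f p =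
    inner_at N (f p) (mean_curvature_vector M N f p) (mean_curvature_vector M N f p)"

definition minimal_immersion ::
    "('a, 'c, 'i) riem_manifold \<Rightarrow> ('b, 'd, 'j) riem_manifold \<Rightarrow> ('a \<Rightarrow> 'b) \<Rightarrow> bool"
  where "minimal_immersion M N f \<longleftrightarrow>
    (\<forall>p\<in>points M. \<forall>\<alpha>\<in>cindex N. mean_curvature_vector M N f p \<alpha> = 0)"

text \<open>
  The maximum of the sectional curvature of \<open>N\<close> over the planes in \<open>df(T\<^sub>pM)\<close>. For \<open>dim M \<ge> 2\<close> it is
  attained, the planes forming a compact Grassmannian.
\<close>

definition max_sectional_curvature ::
    "('a, 'c, 'i) riem_manifold \<Rightarrow> ('b, 'd, 'j) riem_manifold \<Rightarrow> ('a \<Rightarrow> 'b) \<Rightarrow> 'a \<Rightarrow> real"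
  where "max_sectional_curvature M N f p =
    (GREATEST K. \<exists>X \<in> range (differential M N f p). \<exists>Y \<in> range (differential M N f p).
       independent_pair (cindex N) X Y \<and> K = sectional_curvature N (f p) X Y)"


section \<open>Multiply warped products\<close>

text \<open>
  The product \<open>F 1 \<times> \<dots> \<times> F k\<close> with the atlas of product charts, a chart being a family of charts of
  the factors, and with the metric \<open>g\<^bsub>F 1\<^esub> \<oplus> u\<^sub>2\<^sup>2 g\<^bsub>F 2\<^esub> \<oplus> \<dots> \<oplus> u\<^sub>k\<^sup>2 g\<^bsub>F k\<^esub>\<close>. The coordinate \<open>(i, a)\<close> is
  the coordinate \<open>a\<close> of the \<open>i\<close>-th factor.
\<close>

definition multiply_warped_product ::
    "nat \<Rightarrow> (nat \<Rightarrow> ('a, 'c, 'i) riem_manifold) \<Rightarrow> (nat \<Rightarrow> 'a \<Rightarrow> real) \<Rightarrow>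
     (nat \<Rightarrow> 'a, nat \<Rightarrow> 'c, nat \<times> 'i) riem_manifold"
  where "multiply_warped_product k F u =
    \<lparr> mtop = product_topology (\<lambda>i. mtop (F i)) {1..k},
      cindex = Sigma {1..k} (\<lambda>i. cindex (F i)),
      charts = PiE {1..k} (\<lambda>i. charts (F i)),
      cdom = (\<lambda>c. PiE {1..k} (\<lambda>i. cdom (F i) (c i))),
      cmap = (\<lambda>c p. restrict (\<lambda>(i, a). cmap (F i) (c i) (p i) a)
                       (Sigma {1..k} (\<lambda>i. cindex (F i)))),
      gram = (\<lambda>c p (i, a) (j, b).
                if i = j then (if i = 1 then 1 else (u i (p 1))\<^sup>2) * gram (F i) (c i) (p i) a b
                else 0) \<rparr>"

text \<open>
  For a set \<open>B\<close> of coordinate indices, the distribution spanned by the \<open>\<partial>\<^sub>b\<close>, \<open>b \<in> B\<close>, and its mean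
  curvature vector: the trace over the distribution of its second fundamental form, the latter
  being \<open>(\<nabla>\<^sub>X Y)\<^sup>\<bottom>\<close> for sections \<open>X, Y\<close> of the distribution, evaluated on the sections \<open>\<partial>\<^sub>a, \<partial>\<^sub>b\<close>. The
  trace is not divided by the rank.
\<close>

definition coordinate_distribution :: "'i set \<Rightarrow> 'i set \<Rightarrow> ('i \<Rightarrow> real) set"
  where "coordinate_distribution I B = {v. \<forall>i \<in> I - B. v i = 0}"

definition distribution_second_form ::
    "('a, 'c, 'i) riem_manifold \<Rightarrow> 'i set \<Rightarrow> 'a \<Rightarrow> 'i \<Rightarrow> 'i \<Rightarrow> 'i \<Rightarrow> real"
  where "distribution_second_form M B p a b =
    normal_part (cindex M) (gram_at M p) (coordinate_distribution (cindex M) B)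
      (\<lambda>l. christoffel M (chart_at M p) (coords_at M p) l a b)"

definition distribution_mean_curvature ::
    "('a, 'c, 'i) riem_manifold \<Rightarrow> 'i set \<Rightarrow> 'a \<Rightarrow> 'i \<Rightarrow> real"
  where "distribution_mean_curvature M B p l =
    (\<Sum>a\<in>B. \<Sum>b\<in>B. inverse_matrix B (gram_at M p) a b * distribution_second_form M B p a b l)"

text \<open>
  In product charts, the vectors tangent to the \<open>i\<close>-th factor are those whose components outside the
  \<open>i\<close>-th block of coordinates vanish.
\<close>

definition factor_mean_curvature ::
    "nat \<Rightarrow> (nat \<Rightarrow> ('a, 'c, 'i) riem_manifold) \<Rightarrow> (nat \<Rightarrow> 'a \<Rightarrow> real) \<Rightarrow> nat \<Rightarrow>
     (nat \<Rightarrow> 'a) \<Rightarrow> nat \<times> 'i \<Rightarrow> real"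
  where "factor_mean_curvature k F u i =
    distribution_mean_curvature (multiply_warped_product k F u) ({i} \<times> cindex (F i))"

end

theory Submission
  imports Defs
begin

text \<open>
  Let \<open>\<phi> = \<Sum>\<^sub>i n\<^sub>i log u\<^sub>i\<close>, and let \<open>p\<close> be a point where it is maximal. There
  \<open>\<Sum>\<^sub>i H\<^sub>i = - \<nabla>\<phi> = 0\<close> and, since the \<open>H\<^sub>i\<close> are mutually orthogonal, every \<open>H\<^sub>i\<close>, and so every
  \<open>du\<^sub>i\<close>, vanishes at \<open>p\<close>. Hence the sectional curvature of \<open>M\<close> on a plane spanned by unit vectors
  \<open>v\<close> of \<open>F\<^sub>1\<close> and \<open>w\<close> of \<open>F\<^sub>i\<close> is \<open>- Hess (log u\<^sub>i) (v, v)\<close>, and the sum of these over an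
  orthonormal frame is \<open>- \<Delta>\<phi> \<ge> 0\<close>. By the Gauss equation it is at most
  \<open>\<Sum> K(v, w) + \<langle>T, T'\<rangle>\<close>, where \<open>K\<close> is the curvature of the ambient manifold and \<open>T, T'\<close> are the traces
  of the second fundamental form of \<open>f\<close> over \<open>F\<^sub>1\<close> and over the other factors. As \<open>T + T' = n H\<close>, one
  has \<open>\<langle>T, T'\<rangle> \<le> n\<^sup>2 H\<^sup>2 / 4\<close>, and \<open>1/4 \<le> (k - 1) / (2 k)\<close>.
\<close>

section \<open>Calculus on open subsets of coordinate space\<close>

text \<open>The curvature of \<open>M\<close> is never computed. For vectors with constant
  coordinates, \<open>v\<close> in the first block and \<open>w\<close> in block \<open>i\<close>,
  |w|^2 is u_i^2 times a quantity constant along \<open>v\<close>; when |w| = 1, minus half its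
  second derivative along \<open>v\<close> takes the place of the intrinsic curvature in the Gauss
  equation, so the only curvature tensor that occurs is that of the target. Criticality acts twice.
  Where du_i = 0, the covariant Hessian of log u_i is the plain second coordinate derivative of u_i
  divided by u_i. There, too, the tangential parts of the covariant Hessians of f at (v, v) and (w,
  w) are orthogonal, so the inner product of these Hessians is that of their normal parts. Two
  obstacles come from the definitions. Isometry and mean curvature refer to charts chosen separately
  at each point, whereas an identity can be differentiated only in one fixed chart, hence the change
  of charts. And \<open>GREATEST\<close> says something only once the maximum is known to be
  attained, hence the compactness argument.\<close>

lemma powertop_real_open_box:
  assumes "finite I" "openin (powertop_real I) U" "x \<in> U"
  shows "\<exists>\<delta>>0. \<forall>y\<in>extensional I. (\<forall>i\<in>I. \<bar>y i - x i\<bar> < \<delta>) \<longrightarrow> y \<in> U"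
proof -
  obtain W where W: "finite {i \<in> I. W i \<noteq> UNIV}" "\<And>i. i \<in> I \<Longrightarrow> open (W i)"
      "x \<in> Pi\<^sub>E I W" "Pi\<^sub>E I W \<subseteq> U"
    using assms(2,3) unfolding openin_product_topology_alt by (auto simp: topspace_euclidean)
  have "\<exists>e>0. \<forall>s. \<bar>s - x i\<bar> < e \<longrightarrow> s \<in> W i" if "i \<in> I" for i
    using W(2)[OF that] W(3) that by (fastforce simp: open_dist dist_real_def dest!: PiE_mem)
  then obtain e where e: "\<And>i. i \<in> I \<Longrightarrow> e i > 0 \<and> (\<forall>s. \<bar>s - x i\<bar> < e i \<longrightarrow> s \<in> W i)"
    by metis
  define \<delta> where "\<delta> = Min (insert 1 (e ` I))"
  have "\<delta> > 0" using e assms(1) by (auto simp: \<delta>_def)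
  moreover have "\<delta> \<le> e i" if "i \<in> I" for i
    using that assms(1) by (auto simp: \<delta>_def)
  ultimately show ?thesis
    using e W(4) by (intro exI[of _ \<delta>]) (force simp: PiE_def)
qed

text \<open>Brings continuity for the product topology into epsilon-delta form on sup-norm boxes,
  the form that mean value estimates consume. Membership in \<open>U\<close> comes along because the
  intermediate points must lie where the function is smooth.\<close>

lemma powertop_real_continuous_box:
  assumes "finite I" "openin (powertop_real I) U" "x \<in> U"
    and "continuous_map (subtopology (powertop_real I) U) euclideanreal h" "\<epsilon> > 0"
  shows "\<exists>\<delta>>0. \<forall>y\<in>extensional I. (\<forall>i\<in>I. \<bar>y i - x i\<bar> < \<delta>) \<longrightarrow> y \<in> U \<and> \<bar>h y - h x\<bar> < \<epsilon>"
proof -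
  have "openin (powertop_real I) {y \<in> topspace (subtopology (powertop_real I) U). h y \<in> ball (h x) \<epsilon>}"
    using openin_continuous_map_preimage[OF assms(4), of "ball (h x) \<epsilon>"] assms(2)
    by (simp add: openin_open_subtopology)
  moreover have "x \<in> topspace (powertop_real I)"
    using assms(2,3) openin_subset by blast
  ultimately show ?thesis
    using powertop_real_open_box[OF assms(1), of "{y \<in> topspace (subtopology (powertop_real I) U). h y \<in> ball (h x) \<epsilon>}" x]
      assms(3,5) by (fastforce simp: dist_real_def abs_minus_commute)
qed

lemma openin_powertop_real_extensional:
  "openin (powertop_real I) U \<Longrightarrow> U \<subseteq> extensional I"
  by (drule openin_subset) (auto simp: PiE_def)

text \<open>The recursion adds outermost derivatives at the head, so a derivative taken first
  appears at the end of the list. This makes \<open>smooth_on\<close> closed under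
  \<open>pderivative\<close>.\<close>

lemma iterated_pderivative_snoc:
  "iterated_pderivative is (pderivative i f) = iterated_pderivative (is @ [i]) f"
  by (induction "is") auto

lemma smooth_on_pderivative:
  "smooth_on I U f \<Longrightarrow> i \<in> I \<Longrightarrow> smooth_on I U (pderivative i f)"
  unfolding smooth_on_def by (auto simp: iterated_pderivative_snoc)

lemma smooth_on_continuous:
  "smooth_on I U f \<Longrightarrow> continuous_map (subtopology (powertop_real I) U) euclideanreal f"
  unfolding smooth_on_def by (drule bspec[of _ _ "[]"]) auto

lemma smooth_on_field_differentiable:
  "smooth_on I U f \<Longrightarrow> i \<in> I \<Longrightarrow> x \<in> U \<Longrightarrow> (\<lambda>t. f (x(i := t))) field_differentiable at (x i)"
  unfolding smooth_on_def by (drule bspec[of _ _ "[]"]) auto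

lemma smooth_on_DERIV_line:
  assumes "smooth_on I U f" "i \<in> I" "y(i := s) \<in> U"
  shows "((\<lambda>t. f (y(i := t))) has_real_derivative pderivative i f (y(i := s))) (at s)"
  using smooth_on_field_differentiable[OF assms]
  by (simp add: pderivative_def DERIV_deriv_iff_field_differentiable)

lemma smooth_on_mvt:
  assumes f: "smooth_on I U f" and i: "i \<in> I" and U: "\<And>s. s \<in> closed_segment a b \<Longrightarrow> y(i := s) \<in> U"
  shows "\<exists>\<xi>\<in>closed_segment a b. f (y(i := b)) - f (y(i := a)) = (b - a) * pderivative i f (y(i := \<xi>))"
proof -
  note D = smooth_on_DERIV_line[OF f i]
  consider "a < b" | "b < a" | "a = b" by linarith
  then show ?thesis
  proof cases
    case 1
    then obtain z where "a < z" "z < b" "f (y(i := b)) - f (y(i := a)) = (b - a) * pderivative i f (y(i := z))"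
      using MVT2[of a b "\<lambda>t. f (y(i := t))" "\<lambda>t. pderivative i f (y(i := t))"] D U
      by (auto simp: closed_segment_eq_real_ivl)
    with 1 show ?thesis by (auto simp: closed_segment_eq_real_ivl)
  next
    case 2
    then obtain z where "b < z" "z < a" "f (y(i := a)) - f (y(i := b)) = (a - b) * pderivative i f (y(i := z))"
      using MVT2[of b a "\<lambda>t. f (y(i := t))" "\<lambda>t. pderivative i f (y(i := t))"] D U
      by (auto simp: closed_segment_eq_real_ivl)
    with 2 show ?thesis
      by (intro bexI[of _ z]) (auto simp: closed_segment_eq_real_ivl algebra_simps)
  qed auto
qed

text \<open>
  The model space is not a normed space, so the chain rule along curves serves as the definition of
  differentiability.
\<close>

definition has_gradient ::
    "'i set \<Rightarrow> (('i \<Rightarrow> real) \<Rightarrow> real) \<Rightarrow> ('i \<Rightarrow> real) \<Rightarrow> ('i \<Rightarrow> real) \<Rightarrow> bool"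
  where "has_gradient I h D x \<longleftrightarrow>
    (\<forall>\<gamma> v t. \<gamma> t = x \<longrightarrow> (\<forall>\<^sub>F s in nhds t. \<gamma> s \<in> extensional I) \<longrightarrow>
       (\<forall>i\<in>I. ((\<lambda>s. \<gamma> s i) has_real_derivative v i) (at t)) \<longrightarrow>
       ((\<lambda>s. h (\<gamma> s)) has_real_derivative (\<Sum>i\<in>I. D i * v i)) (at t))"

lemma has_gradientD:
  assumes "has_gradient I h D x" "\<gamma> t = x" "\<forall>\<^sub>F s in nhds t. \<gamma> s \<in> extensional I"
    "\<And>i. i \<in> I \<Longrightarrow> ((\<lambda>s. \<gamma> s i) has_real_derivative v i) (at t)"
  shows "((\<lambda>s. h (\<gamma> s)) has_real_derivative (\<Sum>i\<in>I. D i * v i)) (at t)"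
  using assms unfolding has_gradient_def by blast

text \<open>Continuous partial derivatives imply differentiability: the coordinates are moved along
  the curve one at a time, and each single move is controlled by the one-dimensional mean value
  theorem.\<close>

lemma smooth_on_has_gradient:
  assumes I: "finite I" and U: "openin (powertop_real I) U" and f: "smooth_on I U f" and x: "x \<in> U"
  shows "has_gradient I f (\<lambda>i. pderivative i f x) x"
  unfolding has_gradient_def
proof (intro allI impI)
  fix \<gamma> v t
  assume \<gamma>t: "\<gamma> t = x" and ext: "\<forall>\<^sub>F s in nhds t. \<gamma> s \<in> extensional I"
    and d: "\<forall>i\<in>I. ((\<lambda>s. \<gamma> s i) has_real_derivative v i) (at t)"
  have xext: "x \<in> extensional I" using openin_powertop_real_extensional[OF U] x by blast
  \<comment> \<open>A hybrid curve: the coordinates in \<open>K\<close> follow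
    \<open>\<gamma>\<close>, all others stay frozen at \<open>x\<close>. The induction enlarges
    \<open>K\<close> from the empty set to \<open>I\<close>.\<close>
  define g where "g K s = (\<lambda>i. if i \<in> K then \<gamma> s i else x i)" for K s
  have gt: "g K t = x" for K by (auto simp: g_def \<gamma>t)
  have near: "\<forall>\<^sub>F s in at t. \<forall>i\<in>I. \<bar>\<gamma> s i - x i\<bar> < \<delta>" if "\<delta> > 0" for \<delta>
  proof -
    have "\<forall>\<^sub>F s in at t. \<bar>\<gamma> s i - x i\<bar> < \<delta>" if "i \<in> I" for i
    proof -
      have "isCont (\<lambda>s. \<gamma> s i) t" using d that DERIV_isCont by blast
      then have "((\<lambda>s. \<gamma> s i) \<longlongrightarrow> x i) (at t)" using \<gamma>t by (simp add: isCont_def)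
      then show ?thesis using \<open>\<delta> > 0\<close> by (auto dest!: tendstoD[of _ _ _ \<delta>] simp: dist_real_def)
    qed
    then show ?thesis using I by (simp add: eventually_ball_finite)
  qed
  have "((\<lambda>s. f (g K s)) has_real_derivative (\<Sum>i\<in>K. pderivative i f x * v i)) (at t)"
    if "K \<subseteq> I" for K
    using finite_subset[OF that I] that
  proof (induction K rule: finite_induct)
    case empty
    have "(\<lambda>s. f (g {} s)) = (\<lambda>s. f x)" by (auto simp: g_def)
    then show ?case by simp
  next
    case (insert b K)
    have b: "b \<in> I" using insert by auto
    \<comment> \<open>The difference quotient in coordinate \<open>b\<close>. Its default value,
      where that coordinate has not moved, is the expected limit, so both the product formula
      \<open>m\<close> and the limit \<open>lim\<close> hold without exception.\<close>
    define m where "m s = (if \<gamma> s b = x b then pderivative b f x else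
      (f (g (insert b K) s) - f (g K s)) / (\<gamma> s b - x b))" for s
    have g_ins: "g (insert b K) s = (g K s)(b := \<gamma> s b)" "g K s = (g K s)(b := x b)" for s
      using insert(2) by (auto simp: g_def)
    have m: "f (g (insert b K) s) = f (g K s) + m s * (\<gamma> s b - x b)" for s
    proof (cases "\<gamma> s b = x b")
      case True
      then have "g (insert b K) s = g K s" using g_ins by metis
      then show ?thesis using True by simp
    qed (simp add: m_def)
    have lim: "(m \<longlongrightarrow> pderivative b f x) (at t)"
    proof (rule tendstoI)
      fix \<epsilon> :: real assume "\<epsilon> > 0"
      obtain \<delta> where "\<delta> > 0" and \<delta>: "\<And>y. y \<in> extensional I \<Longrightarrow> (\<forall>i\<in>I. \<bar>y i - x i\<bar> < \<delta>) \<Longrightarrow>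
          y \<in> U \<and> \<bar>pderivative b f y - pderivative b f x\<bar> < \<epsilon>"
        using powertop_real_continuous_box[OF I U x smooth_on_continuous[OF smooth_on_pderivative[OF f b]] \<open>\<epsilon> > 0\<close>]
        by blast
      show "\<forall>\<^sub>F s in at t. dist (m s) (pderivative b f x) < \<epsilon>"
        using near[OF \<open>\<delta> > 0\<close>]
      proof eventually_elim
        case (elim s)
        have box: "(g K s)(b := r) \<in> U \<and> \<bar>pderivative b f ((g K s)(b := r)) - pderivative b f x\<bar> < \<epsilon>"
          if "r \<in> closed_segment (x b) (\<gamma> s b)" for r
        proof (rule \<delta>)
          show "(g K s)(b := r) \<in> extensional I"
            using xext b insert(4) by (auto simp: g_def extensional_def)
          have "\<bar>\<gamma> s b - x b\<bar> < \<delta>" using elim b by auto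
          then have "\<bar>r - x b\<bar> < \<delta>" using that by (auto simp: closed_segment_eq_real_ivl split: if_splits)
          then show "\<forall>i\<in>I. \<bar>((g K s)(b := r)) i - x i\<bar> < \<delta>"
            using elim \<open>\<delta> > 0\<close> by (auto simp: g_def)
        qed
        obtain \<xi> where \<xi>: "\<xi> \<in> closed_segment (x b) (\<gamma> s b)"
          "f ((g K s)(b := \<gamma> s b)) - f ((g K s)(b := x b)) = (\<gamma> s b - x b) * pderivative b f ((g K s)(b := \<xi>))"
          using smooth_on_mvt[OF f b] box by metis
        then have "m s = pderivative b f ((g K s)(b := \<xi>)) \<or> m s = pderivative b f x"
          using g_ins[of s] by (auto simp: m_def)
        then show ?case using box[OF \<xi>(1)] \<open>\<epsilon> > 0\<close> by (auto simp: dist_real_def)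
      qed
    qed
    have "((\<lambda>s. m s * (\<gamma> s b - x b)) has_real_derivative pderivative b f x * v b) (at t)"
    proof -
      have "((\<lambda>s. (\<gamma> s b - \<gamma> t b) / (s - t)) \<longlongrightarrow> v b) (at t)"
        using d b unfolding has_field_derivative_iff by auto
      then have "((\<lambda>s. m s * ((\<gamma> s b - x b) / (s - t))) \<longlongrightarrow> pderivative b f x * v b) (at t)"
        using lim \<gamma>t by (intro tendsto_mult) auto
      then show ?thesis
        unfolding has_field_derivative_iff by (simp add: \<gamma>t)
    qed
    with insert have "((\<lambda>s. f (g K s) + m s * (\<gamma> s b - x b)) has_real_derivative
        (\<Sum>i\<in>K. pderivative i f x * v i) + pderivative b f x * v b) (at t)"
      by (intro DERIV_add) auto
    then show ?case
      using insert(1,2) unfolding m by (simp add: add.commute)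
  qed
  from this[of I] have "((\<lambda>s. f (g I s)) has_real_derivative (\<Sum>i\<in>I. pderivative i f x * v i)) (at t)"
    by simp
  moreover have "\<forall>\<^sub>F s in nhds t. f (g I s) = f (\<gamma> s)"
    using ext
  proof eventually_elim
    case (elim s)
    then have "g I s = \<gamma> s" using xext by (auto simp: g_def extensional_def fun_eq_iff)
    then show ?case by simp
  qed
  ultimately show "((\<lambda>s. f (\<gamma> s)) has_real_derivative (\<Sum>i\<in>I. pderivative i f x * v i)) (at t)"
    using DERIV_cong_ev[of t t "\<lambda>s. f (g I s)" "\<lambda>s. f (\<gamma> s)"] by auto
qed

lemma has_gradient_pderivative:
  assumes "has_gradient I h D x" "finite I" "x \<in> extensional I" "i \<in> I"
  shows "((\<lambda>t. h (x(i := t))) has_real_derivative D i) (at (x i))" "pderivative i h x = D i"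
proof -
  have "((\<lambda>t. h (x(i := t))) has_real_derivative (\<Sum>j\<in>I. D j * (if j = i then 1 else 0))) (at (x i))"
    using assms by (intro has_gradientD[OF assms(1)]) (auto simp: extensional_def)
  moreover have "(\<Sum>j\<in>I. D j * (if j = i then 1 else 0)) = D i"
    using assms by (simp add: if_distrib[of "\<lambda>z. _ * z"] cong: if_cong)
  ultimately show "((\<lambda>t. h (x(i := t))) has_real_derivative D i) (at (x i))" by simp
  then show "pderivative i h x = D i" unfolding pderivative_def by (rule DERIV_imp_deriv)
qed

lemma has_gradient_pderivatives:
  assumes "has_gradient I h D x" "finite I" "x \<in> extensional I"
  shows "has_gradient I h (\<lambda>i. pderivative i h x) x"
  using assms has_gradient_pderivative(2)[OF assms] unfolding has_gradient_def by (simp cong: sum.cong)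

text \<open>Both mixed derivatives are limits of the same, symmetric, second difference quotient.\<close>

lemma second_difference:
  assumes I: "finite I" and U: "openin (powertop_real I) U" and f: "smooth_on I U f" and x: "x \<in> U"
    and ij: "i \<in> I" "j \<in> I" "i \<noteq> j" and "\<epsilon> > 0"
  shows "\<exists>\<delta>>0. \<forall>h. 0 < h \<longrightarrow> h < \<delta> \<longrightarrow>
    \<bar>(f (x(i := x i + h, j := x j + h)) - f (x(i := x i + h)) - f (x(j := x j + h)) + f x) / h\<^sup>2
      - pderivative j (pderivative i f) x\<bar> < \<epsilon>"
proof -
  have fi: "smooth_on I U (pderivative i f)" using f ij by (simp add: smooth_on_pderivative)
  obtain \<delta> where "\<delta> > 0" and \<delta>: "\<And>y. y \<in> extensional I \<Longrightarrow> (\<forall>i\<in>I. \<bar>y i - x i\<bar> < \<delta>) \<Longrightarrow>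
      y \<in> U \<and> \<bar>pderivative j (pderivative i f) y - pderivative j (pderivative i f) x\<bar> < \<epsilon>"
    using powertop_real_continuous_box[OF I U x smooth_on_continuous[OF smooth_on_pderivative[OF fi ij(2)]] \<open>\<epsilon> > 0\<close>]
    by blast
  have xext: "x \<in> extensional I" using openin_powertop_real_extensional[OF U] x by blast
  show ?thesis
  proof (intro exI[of _ \<delta>] conjI allI impI \<open>\<delta> > 0\<close>)
    fix h :: real assume h: "0 < h" "h < \<delta>"
    have box: "x(i := s, j := r) \<in> U \<and>
        \<bar>pderivative j (pderivative i f) (x(i := s, j := r)) - pderivative j (pderivative i f) x\<bar> < \<epsilon>"
      if "x i \<le> s" "s \<le> x i + h" "x j \<le> r" "r \<le> x j + h" for s r
      using that h ij xext by (intro \<delta>) (auto simp: extensional_def)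
    have box1: "x(i := s) \<in> U" if "x i \<le> s" "s \<le> x i + h" for s
    proof -
      have "x(i := s, j := x j) = x(i := s)" using ij by (auto simp: fun_eq_iff)
      then show ?thesis using box[OF that, of "x j"] h by simp
    qed
    \<comment> \<open>The increment in the \<open>j\<close>-direction as a function of the
      \<open>i\<close>-coordinate. The mean value theorem for \<open>\<psi>\<close>, and then once
      more in direction \<open>j\<close>, evaluates the second difference at a single point of the
      box.\<close>
    define \<psi> where "\<psi> s = f (x(i := s, j := x j + h)) - f (x(i := s))" for s
    have D\<psi>: "(\<psi> has_real_derivative pderivative i f (x(i := s, j := x j + h)) - pderivative i f (x(i := s))) (at s)"
      if "x i \<le> s" "s \<le> x i + h" for s
    proof -
      have "((\<lambda>t. f ((x(j := x j + h))(i := t))) has_real_derivative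
          pderivative i f ((x(j := x j + h))(i := s))) (at s)"
        using box[OF that, of "x j + h"] h ij
        by (intro smooth_on_DERIV_line[OF f ij(1)]) (auto simp: fun_upd_twist)
      then show ?thesis
        unfolding \<psi>_def using smooth_on_DERIV_line[OF f ij(1) box1[OF that]] ij
        by (auto simp: fun_upd_twist[of j i] intro!: DERIV_diff)
    qed
    obtain s where s: "x i < s" "s < x i + h"
      "\<psi> (x i + h) - \<psi> (x i) = h * (pderivative i f (x(i := s, j := x j + h)) - pderivative i f (x(i := s)))"
      using MVT2[of "x i" "x i + h" \<psi> "\<lambda>s. pderivative i f (x(i := s, j := x j + h)) - pderivative i f (x(i := s))"]
        D\<psi> h by auto
    have "\<exists>r\<in>closed_segment (x j) (x j + h).
        pderivative i f ((x(i := s))(j := x j + h)) - pderivative i f ((x(i := s))(j := x j))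
        = (x j + h - x j) * pderivative j (pderivative i f) ((x(i := s))(j := r))"
      using box s h by (intro smooth_on_mvt[OF fi ij(2)]) (auto simp: closed_segment_eq_real_ivl)
    then obtain r where r: "x j \<le> r" "r \<le> x j + h"
        "pderivative i f (x(i := s, j := x j + h)) - pderivative i f (x(i := s))
        = h * pderivative j (pderivative i f) (x(i := s, j := r))"
      using ij h by (auto simp: closed_segment_eq_real_ivl fun_upd_idem)
    have "f (x(i := x i + h, j := x j + h)) - f (x(i := x i + h)) - f (x(j := x j + h)) + f x
      = h\<^sup>2 * pderivative j (pderivative i f) (x(i := s, j := r))"
      using s(3) r(3) by (simp add: \<psi>_def power2_eq_square)
    then show "\<bar>(f (x(i := x i + h, j := x j + h)) - f (x(i := x i + h)) - f (x(j := x j + h)) + f x) / h\<^sup>2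
      - pderivative j (pderivative i f) x\<bar> < \<epsilon>"
      using box[of s r] s r h by simp
  qed
qed

lemma pderivative_commute:
  assumes I: "finite I" and U: "openin (powertop_real I) U" and f: "smooth_on I U f" and x: "x \<in> U"
    and ij: "i \<in> I" "j \<in> I"
  shows "pderivative i (pderivative j f) x = pderivative j (pderivative i f) x"
proof (cases "i = j")
  case False
  show ?thesis
  proof (rule ccontr)
    assume ne: "pderivative i (pderivative j f) x \<noteq> pderivative j (pderivative i f) x"
    \<comment> \<open>Half the supposed gap: one quotient cannot be strictly closer than this to
      both values.\<close>
    define e where "e = \<bar>pderivative i (pderivative j f) x - pderivative j (pderivative i f) x\<bar> / 2"
    have "e > 0" using ne by (simp add: e_def)
    obtain d1 where d1: "d1 > 0" "\<And>h. 0 < h \<Longrightarrow> h < d1 \<Longrightarrow>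
      \<bar>(f (x(i := x i + h, j := x j + h)) - f (x(i := x i + h)) - f (x(j := x j + h)) + f x) / h\<^sup>2
        - pderivative j (pderivative i f) x\<bar> < e"
      using second_difference[OF I U f x ij False \<open>e > 0\<close>] by blast
    obtain d2 where d2: "d2 > 0" "\<And>h. 0 < h \<Longrightarrow> h < d2 \<Longrightarrow>
      \<bar>(f (x(j := x j + h, i := x i + h)) - f (x(j := x j + h)) - f (x(i := x i + h)) + f x) / h\<^sup>2
        - pderivative i (pderivative j f) x\<bar> < e"
      using second_difference[OF I U f x ij(2,1) not_sym[OF False] \<open>e > 0\<close>] by blast
    define h where "h = min d1 d2 / 2"
    have h: "0 < h" "h < d1" "h < d2" using d1(1) d2(1) by (auto simp: h_def)
    have "f (x(j := x j + h, i := x i + h)) - f (x(j := x j + h)) - f (x(i := x i + h)) + f x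
      = f (x(i := x i + h, j := x j + h)) - f (x(i := x i + h)) - f (x(j := x j + h)) + f x"
      using False by (simp add: fun_upd_twist)
    then obtain q where "\<bar>q - pderivative i (pderivative j f) x\<bar> < e" "\<bar>q - pderivative j (pderivative i f) x\<bar> < e"
      using d1(2)[OF h(1,2)] d2(2)[OF h(1,3)] by metis
    moreover have "e + e = \<bar>pderivative i (pderivative j f) x - pderivative j (pderivative i f) x\<bar>"
      unfolding e_def by (rule field_sum_of_halves)
    ultimately show False by linarith
  qed
qed simp

section \<open>Gram matrices and orthonormal frames\<close>

lemma inner_of_cong:
  "(\<And>i. i \<in> I \<Longrightarrow> v i = v' i) \<Longrightarrow> (\<And>i. i \<in> I \<Longrightarrow> w i = w' i) \<Longrightarrow> inner_of I G v w = inner_of I G v' w'"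
  by (simp add: inner_of_def)

lemma inner_of_add_left: "inner_of I G (\<lambda>i. v i + v' i) w = inner_of I G v w + inner_of I G v' w"
  by (simp add: inner_of_def algebra_simps sum.distrib)

lemma inner_of_add_right: "inner_of I G v (\<lambda>i. w i + w' i) = inner_of I G v w + inner_of I G v w'"
  by (simp add: inner_of_def algebra_simps sum.distrib)

lemma inner_of_diff_left: "inner_of I G (\<lambda>i. v i - v' i) w = inner_of I G v w - inner_of I G v' w"
  by (simp add: inner_of_def algebra_simps sum_subtractf)

lemma inner_of_diff_right: "inner_of I G v (\<lambda>i. w i - w' i) = inner_of I G v w - inner_of I G v w'"
  by (simp add: inner_of_def algebra_simps sum_subtractf)

lemma inner_of_scale_left: "inner_of I G (\<lambda>i. c * v i) w = c * inner_of I G v w"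
  by (simp add: inner_of_def sum_distrib_left algebra_simps)

lemma inner_of_scale_right: "inner_of I G v (\<lambda>i. c * w i) = c * inner_of I G v w"
  by (simp add: inner_of_def sum_distrib_left algebra_simps)

lemma inner_of_divide_left: "inner_of I G (\<lambda>i. v i / c) w = inner_of I G v w / c"
  by (simp add: inner_of_def sum_divide_distrib)

lemma inner_of_divide_right: "inner_of I G v (\<lambda>i. w i / c) = inner_of I G v w / c"
  by (simp add: inner_of_def sum_divide_distrib)

lemma inner_of_zero [simp]: "inner_of I G (\<lambda>i. 0) w = 0" "inner_of I G v (\<lambda>i. 0) = 0"
  by (simp_all add: inner_of_def)

lemma inner_of_sum_left: "inner_of I G (\<lambda>i. \<Sum>s\<in>S. f s i) w = (\<Sum>s\<in>S. inner_of I G (f s) w)"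
  by (induction S rule: infinite_finite_induct) (simp_all add: inner_of_add_left)

lemma inner_of_sum_right: "inner_of I G v (\<lambda>i. \<Sum>s\<in>S. f s i) = (\<Sum>s\<in>S. inner_of I G v (f s))"
  by (induction S rule: infinite_finite_induct) (simp_all add: inner_of_add_right)

lemmas inner_of_linear = inner_of_add_left inner_of_add_right inner_of_diff_left inner_of_diff_right
  inner_of_scale_left inner_of_scale_right inner_of_sum_left inner_of_sum_right

lemma inner_of_commute:
  assumes "\<And>i j. i \<in> I \<Longrightarrow> j \<in> I \<Longrightarrow> G i j = G j i"
  shows "inner_of I G v w = inner_of I G w v"
proof -
  have "inner_of I G v w = (\<Sum>i\<in>I. \<Sum>j\<in>I. G j i * w j * v i)"
    unfolding inner_of_def using assms by (intro sum.cong refl) auto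
  also have "\<dots> = inner_of I G w v"
    unfolding inner_of_def by (rule sum.swap)
  finally show ?thesis .
qed

lemma inner_of_delta_left:
  assumes "finite I" "a \<in> I"
  shows "inner_of I G (\<lambda>i. if i = a then 1 else 0) w = (\<Sum>j\<in>I. G a j * w j)"
proof -
  have "inner_of I G (\<lambda>i. if i = a then 1 else 0) w = (\<Sum>i\<in>I. if i = a then (\<Sum>j\<in>I. G a j * w j) else 0)"
    unfolding inner_of_def by (intro sum.cong) auto
  then show ?thesis using assms by simp
qed

section \<open>Positive definite Gram matrices and Gram--Schmidt\<close>

definition symmetric_matrix :: "'i set \<Rightarrow> ('i \<Rightarrow> 'i \<Rightarrow> real) \<Rightarrow> bool"
  where "symmetric_matrix I G \<longleftrightarrow> (\<forall>i\<in>I. \<forall>j\<in>I. G i j = G j i)"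

definition positive_matrix :: "'i set \<Rightarrow> ('i \<Rightarrow> 'i \<Rightarrow> real) \<Rightarrow> bool"
  where "positive_matrix I G \<longleftrightarrow> (\<forall>v. (\<exists>i\<in>I. v i \<noteq> 0) \<longrightarrow> inner_of I G v v > 0)"

lemma positive_matrix_nonneg: "positive_matrix I G \<Longrightarrow> inner_of I G v v \<ge> 0"
  unfolding positive_matrix_def
  by (cases "\<exists>i\<in>I. v i \<noteq> 0") (auto simp: less_imp_le inner_of_def)

lemma positive_matrix_zero: "positive_matrix I G \<Longrightarrow> inner_of I G v v = 0 \<Longrightarrow> i \<in> I \<Longrightarrow> v i = 0"
  unfolding positive_matrix_def by (metis less_irrefl)

definition orthonormal_frame :: "'i set \<Rightarrow> ('i \<Rightarrow> 'i \<Rightarrow> real) \<Rightarrow> ('i \<Rightarrow> 'i \<Rightarrow> real) \<Rightarrow> bool"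
  where "orthonormal_frame I G e \<longleftrightarrow>
    (\<forall>s\<in>I. \<forall>t\<in>I. inner_of I G (e s) (e t) = (if s = t then 1 else 0)) \<and>
    (\<forall>v. \<exists>c. \<forall>i\<in>I. v i = (\<Sum>s\<in>I. c s * e s i))"

lemma inner_of_insert_zero:
  assumes "finite I" "x \<notin> I" "v x = 0" "w x = 0"
  shows "inner_of (insert x I) G v w = inner_of I G v w"
  using assms by (simp add: inner_of_def)

text \<open>Gram--Schmidt never mixes blocks that are orthogonal to each other.\<close>

lemma orthonormal_frame_exists:
  assumes "finite I" "symmetric_matrix I G" "positive_matrix I G"
    and "\<And>i j. i \<in> I \<Longrightarrow> j \<in> I \<Longrightarrow> blk i \<noteq> blk j \<Longrightarrow> G i j = 0"
  shows "\<exists>e. orthonormal_frame I G e \<and> (\<forall>s\<in>I. \<forall>i. i \<notin> I \<or> blk s \<noteq> blk i \<longrightarrow> e s i = 0)"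
  using assms
proof (induction I rule: finite_induct)
  case empty
  then show ?case by (auto simp: orthonormal_frame_def)
next
  case (insert x I)
  let ?J = "insert x I"
  have sym: "symmetric_matrix I G" using insert.prems(1) by (auto simp: symmetric_matrix_def)
  have pos: "positive_matrix I G"
    unfolding positive_matrix_def
  proof (intro allI impI)
    fix v :: "'a \<Rightarrow> real" assume "\<exists>i\<in>I. v i \<noteq> 0"
    then have "\<exists>i\<in>?J. (v(x := 0)) i \<noteq> 0" using insert.hyps by auto
    then have "inner_of ?J G (v(x := 0)) (v(x := 0)) > 0"
      using insert.prems(2) unfolding positive_matrix_def by blast
    moreover have "inner_of I G (v(x := 0)) (v(x := 0)) = inner_of I G v v"
      using insert.hyps by (intro inner_of_cong) auto
    ultimately show "inner_of I G v v > 0"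
      using inner_of_insert_zero[of I x "v(x := 0)" "v(x := 0)" G] insert.hyps by simp
  qed
  have "\<exists>e. orthonormal_frame I G e \<and> (\<forall>s\<in>I. \<forall>i. i \<notin> I \<or> blk s \<noteq> blk i \<longrightarrow> e s i = 0)"
    by (rule insert.IH[OF sym pos]) (rule insert.prems(3), auto)
  then obtain e0 where e0: "orthonormal_frame I G e0"
    and supp: "\<And>s i. s \<in> I \<Longrightarrow> i \<notin> I \<or> blk s \<noteq> blk i \<Longrightarrow> e0 s i = 0"
    by blast
  have e0x: "e0 s x = 0" if "s \<in> I" for s using supp that insert.hyps by blast
  have on0: "inner_of ?J G (e0 s) (e0 t) = (if s = t then 1 else 0)" if "s \<in> I" "t \<in> I" for s t
    using e0 that inner_of_insert_zero[of I x "e0 s" "e0 t" G] e0x insert.hyps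
    unfolding orthonormal_frame_def by auto
  have comm: "inner_of ?J G v w = inner_of ?J G w v" for v w
    using insert.prems(1) by (intro inner_of_commute) (auto simp: symmetric_matrix_def)
  define d where "d i = (if i = x then 1 else 0 :: real)" for i
  define c where "c s = inner_of ?J G d (e0 s)" for s
  \<comment> \<open>The residual of the new coordinate vector after removing its components along
    the old frame. The old frame vectors vanish at \<open>x\<close>, so \<open>w x = 1\<close>, and
    \<open>w\<close> can be normalised.\<close>
  define w where "w i = d i - (\<Sum>s\<in>I. c s * e0 s i)" for i
  have wx: "w x = 1" using e0x by (simp add: w_def d_def)
  define N where "N = inner_of ?J G w w"
  have "N > 0" using insert.prems(2) wx unfolding N_def positive_matrix_def by (metis insertI1 zero_neq_one)
  have we0: "inner_of ?J G w (e0 t) = 0" if "t \<in> I" for t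
  proof -
    have "inner_of ?J G w (e0 t) = c t - (\<Sum>s\<in>I. c s * inner_of ?J G (e0 s) (e0 t))"
      unfolding w_def by (simp add: inner_of_linear c_def)
    also have "(\<Sum>s\<in>I. c s * inner_of ?J G (e0 s) (e0 t)) = (\<Sum>s\<in>I. if s = t then c t else 0)"
      using on0 that by (intro sum.cong) auto
    finally show ?thesis using that insert.hyps by simp
  qed
  define e where "e s = (if s = x then (\<lambda>i. w i / sqrt N) else e0 s)" for s
  have ex: "e x = (\<lambda>i. w i / sqrt N)" and es: "s \<in> I \<Longrightarrow> e s = e0 s" for s
    using insert.hyps by (auto simp: e_def)
  have "inner_of ?J G (e x) (e x) = 1"
    using \<open>N > 0\<close> by (simp add: ex inner_of_divide_left inner_of_divide_right N_def[symmetric])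
  moreover have "inner_of ?J G (e x) (e t) = 0" "inner_of ?J G (e t) (e x) = 0" if "t \<in> I" for t
    using we0[OF that] comm[of "e0 t" w] by (simp_all add: ex es that inner_of_divide_left inner_of_divide_right)
  ultimately have on: "inner_of ?J G (e s) (e t) = (if s = t then 1 else 0)" if "s \<in> ?J" "t \<in> ?J" for s t
    using that on0 es insert.hyps(2) by (cases "s = x"; cases "t = x") auto
  have span: "\<exists>c. \<forall>i\<in>?J. v i = (\<Sum>s\<in>?J. c s * e s i)" for v
  proof -
    have "\<forall>v. \<exists>c. \<forall>i\<in>I. v i = (\<Sum>s\<in>I. c s * e0 s i)"
      using e0 unfolding orthonormal_frame_def by blast
    \<comment> \<open>The coefficient along \<open>w\<close> is forced to be \<open>v x\<close>, as
      \<open>w\<close> is the only vector with a component at \<open>x\<close>; what remains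
      vanishes at \<open>x\<close> and is spanned by the old frame.\<close>
    from this[rule_format, of "\<lambda>i. v i - v x * w i"]
    obtain c' where c': "\<And>i. i \<in> I \<Longrightarrow> v i - v x * w i = (\<Sum>s\<in>I. c' s * e0 s i)"
      by blast
    define c'' where "c'' = c'(x := v x * sqrt N)"
    have "v i = (\<Sum>s\<in>?J. c'' s * e s i)" if "i \<in> ?J" for i
    proof -
      have "(\<Sum>s\<in>I. c'' s * e s i) = (\<Sum>s\<in>I. c' s * e0 s i)"
        using insert.hyps by (intro sum.cong) (auto simp: c''_def es)
      moreover have "(\<Sum>s\<in>I. c' s * e0 s i) = v i - v x * w i"
        using c' that e0x wx by (cases "i = x") auto
      ultimately show ?thesis
        using insert.hyps \<open>N > 0\<close> by (simp add: ex c''_def)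
    qed
    then show ?thesis by blast
  qed
  \<comment> \<open>For the new vector: a frame vector of another block than that of
    \<open>x\<close> is orthogonal to the coordinate vector at \<open>x\<close>, so its coefficient
    \<open>c r\<close> is zero and it contributes nothing.\<close>
  have "e s i = 0" if "s \<in> ?J" "i \<notin> ?J \<or> blk s \<noteq> blk i" for s i
  proof (cases "s = x")
    case True
    have "c r * e0 r i = 0" if r: "r \<in> I" for r
    proof (cases "i \<notin> I \<or> blk r \<noteq> blk i")
      case False
      with \<open>i \<notin> ?J \<or> blk s \<noteq> blk i\<close> True have ne: "blk r \<noteq> blk x" by auto
      have "c r = (\<Sum>j\<in>?J. G x j * e0 r j)"
        unfolding c_def d_def using insert.hyps by (intro inner_of_delta_left) auto
      also have "\<dots> = 0"
      proof (rule sum.neutral, rule ballI)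
        fix j assume j: "j \<in> ?J"
        show "G x j * e0 r j = 0"
        proof (cases "blk j = blk x")
          case True
          then show ?thesis using supp[OF r, of j] ne by auto
        next
          case False
          then show ?thesis using insert.prems(3)[of x j] j by auto
        qed
      qed
      finally show ?thesis by simp
    qed (use supp r in auto)
    then have "(\<Sum>r\<in>I. c r * e0 r i) = 0" by (intro sum.neutral) blast
    moreover have "d i = 0" using that True by (auto simp: d_def)
    ultimately show ?thesis using True by (simp add: ex w_def)
  next
    case False
    then show ?thesis using that supp[of s i] by (auto simp: es)
  qed
  then show ?case
    using on span unfolding orthonormal_frame_def by blast
qed

section \<open>Frames and inverse Gram matrices\<close>

lemma orthonormal_frame_expand:
  assumes e: "orthonormal_frame I G e" and I: "finite I" and "i \<in> I"
  shows "v i = (\<Sum>s\<in>I. inner_of I G v (e s) * e s i)"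
proof -
  obtain c where c: "\<And>i. i \<in> I \<Longrightarrow> v i = (\<Sum>s\<in>I. c s * e s i)"
    using e unfolding orthonormal_frame_def by blast
  have "inner_of I G v (e t) = c t" if "t \<in> I" for t
  proof -
    have "inner_of I G v (e t) = inner_of I G (\<lambda>i. \<Sum>s\<in>I. c s * e s i) (e t)"
      using c by (intro inner_of_cong) auto
    also have "\<dots> = (\<Sum>s\<in>I. if s = t then c t else 0)"
      unfolding inner_of_linear using e that by (intro sum.cong) (auto simp: orthonormal_frame_def)
    finally show ?thesis using I that by simp
  qed
  then show ?thesis using c[OF \<open>i \<in> I\<close>] by simp
qed

text \<open>This is the expansion of the \<open>j\<close>-th coordinate vector in the frame: its
  coefficient along \<open>e s\<close> is the \<open>j\<close>-th entry of \<open>G\<close> applied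
  to \<open>e s\<close>.\<close>

lemma frame_product_left_inverse:
  assumes e: "orthonormal_frame I G e" and I: "finite I" and G: "symmetric_matrix I G" and ij: "i \<in> I" "j \<in> I"
  shows "(\<Sum>k\<in>I. (\<Sum>s\<in>I. e s i * e s k) * G k j) = (if i = j then 1 else 0)"
proof -
  have "(if i = j then 1 else 0) = (\<Sum>s\<in>I. inner_of I G (\<lambda>k. if k = j then 1 else 0) (e s) * e s i)"
    using orthonormal_frame_expand[OF e I ij(1), of "\<lambda>k. if k = j then 1 else 0"] by simp
  also have "\<dots> = (\<Sum>s\<in>I. \<Sum>k\<in>I. e s i * e s k * G k j)"
    using G ij I by (auto simp: inner_of_delta_left sum_distrib_right symmetric_matrix_def intro!: sum.cong)
  also have "\<dots> = (\<Sum>k\<in>I. \<Sum>s\<in>I. e s i * e s k * G k j)"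
    by (rule sum.swap)
  finally show ?thesis by (simp add: sum_distrib_right)
qed

text \<open>The choice in \<open>inverse_matrix\<close> yields some right inverse, and the sum of
  the products of frame components is a left inverse; associativity makes the two agree. Traces
  taken with the inverse Gram matrix thereby become sums over a frame.\<close>

lemma inverse_matrix_frame:
  assumes e: "orthonormal_frame I G e" and I: "finite I" and G: "symmetric_matrix I G"
  shows "\<And>i j. i \<in> I \<Longrightarrow> j \<in> I \<Longrightarrow> inverse_matrix I G i j = (\<Sum>s\<in>I. e s i * e s j)"
proof -
  define B where "B i j = (\<Sum>s\<in>I. e s i * e s j)" for i j
  have left: "(\<Sum>k\<in>I. B i k * G k j) = (if i = j then 1 else 0)" if "i \<in> I" "j \<in> I" for i j
    using frame_product_left_inverse[OF e I G that] by (simp add: B_def)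
  have "(\<Sum>k\<in>I. G i k * B k j) = (if i = j then 1 else 0)" if "i \<in> I" "j \<in> I" for i j
  proof -
    have "(\<Sum>k\<in>I. G i k * B k j) = (\<Sum>k\<in>I. B j k * G k i)"
      using G that by (intro sum.cong) (auto simp: B_def symmetric_matrix_def mult.commute)
    then show ?thesis using left[OF that(2,1)] by auto
  qed
  then have "\<exists>B. \<forall>i\<in>I. \<forall>j\<in>I. (\<Sum>k\<in>I. G i k * B k j) = (if i = j then 1 else 0)" by blast
  from someI_ex[OF this]
  have right: "(\<Sum>k\<in>I. G i k * inverse_matrix I G k j) = (if i = j then 1 else 0)" if "i \<in> I" "j \<in> I" for i j
    using that unfolding inverse_matrix_def by blast
  fix i j assume ij: "i \<in> I" "j \<in> I"
  have "inverse_matrix I G i j = (\<Sum>l\<in>I. (if i = l then 1 else 0) * inverse_matrix I G l j)"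
    using I ij by (simp add: if_distrib[of "\<lambda>z. z * _"] cong: if_cong)
  also have "\<dots> = (\<Sum>l\<in>I. (\<Sum>k\<in>I. B i k * G k l) * inverse_matrix I G l j)"
    using left ij by simp
  also have "\<dots> = (\<Sum>l\<in>I. \<Sum>k\<in>I. B i k * (G k l * inverse_matrix I G l j))"
    by (simp add: sum_distrib_right mult.assoc)
  also have "\<dots> = (\<Sum>k\<in>I. B i k * (\<Sum>l\<in>I. G k l * inverse_matrix I G l j))"
    by (subst sum.swap) (simp add: sum_distrib_left)
  also have "\<dots> = (\<Sum>k\<in>I. B i k * (if k = j then 1 else 0))"
    using right ij by simp
  also have "\<dots> = B i j"
    using I ij by (simp add: if_distrib[of "\<lambda>z. _ * z"] cong: if_cong)
  finally show "inverse_matrix I G i j = (\<Sum>s\<in>I. e s i * e s j)" by (simp add: B_def)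
qed

lemma inverse_matrix:
  assumes I: "finite I" and G: "symmetric_matrix I G" "positive_matrix I G" and ij: "i \<in> I" "j \<in> I"
  shows "(\<Sum>k\<in>I. inverse_matrix I G i k * G k j) = (if i = j then 1 else 0)"
    and "(\<Sum>k\<in>I. G i k * inverse_matrix I G k j) = (if i = j then 1 else 0)"
    and "inverse_matrix I G i j = inverse_matrix I G j i"
proof -
  \<comment> \<open>A constant block map: all indices form one block, so the orthogonality condition
    between blocks is vacuous.\<close>
  obtain e where e: "orthonormal_frame I G e"
    using orthonormal_frame_exists[OF I G, of "\<lambda>_. ()"] by auto
  note inv = inverse_matrix_frame[OF e I G(1)]
  have left: "(\<Sum>k\<in>I. inverse_matrix I G i k * G k j) = (if i = j then 1 else 0)"
    if ij: "i \<in> I" "j \<in> I" for i j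
    using frame_product_left_inverse[OF e I G(1) ij] inv ij by simp
  then show "(\<Sum>k\<in>I. inverse_matrix I G i k * G k j) = (if i = j then 1 else 0)"
    using ij by blast
  show "inverse_matrix I G i j = inverse_matrix I G j i"
    using inv ij by (simp add: mult.commute)
  have "(\<Sum>k\<in>I. G i k * inverse_matrix I G k j) = (\<Sum>k\<in>I. inverse_matrix I G j k * G k i)"
    using inv ij G(1) by (intro sum.cong) (auto simp: symmetric_matrix_def mult.commute)
  then show "(\<Sum>k\<in>I. G i k * inverse_matrix I G k j) = (if i = j then 1 else 0)"
    using left[OF ij(2,1)] by auto
qed

text \<open>The origin of the factor n_i in H_i: the second fundamental form of a warped factor is a
  vector times the metric.\<close>

lemma inverse_matrix_trace:
  assumes I: "finite I" and G: "symmetric_matrix I G" "positive_matrix I G"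
  shows "(\<Sum>i\<in>I. \<Sum>j\<in>I. inverse_matrix I G i j * G i j) = real (card I)"
proof -
  have "(\<Sum>j\<in>I. inverse_matrix I G i j * G i j) = 1" if "i \<in> I" for i
  proof -
    have "(\<Sum>j\<in>I. inverse_matrix I G i j * G i j) = (\<Sum>j\<in>I. inverse_matrix I G i j * G j i)"
      using that G(1) by (intro sum.cong) (auto simp: symmetric_matrix_def)
    then show ?thesis using inverse_matrix(1)[OF I G that that] by simp
  qed
  then show ?thesis by simp
qed

text \<open>No continuity of \<open>B\<close> is assumed. From B(t) - B(t0) = - B(t) (A(t) - A(t0))
  B(t0), a bound on B(t) gives continuity, and then dividing by t - t0 gives the derivative. The
  bound itself follows from the same identity, since A(t) - A(t0) tends to 0.\<close>

lemma DERIV_matrix_inverse: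
  fixes A B :: "real \<Rightarrow> 'i \<Rightarrow> 'i \<Rightarrow> real"
  assumes I: "finite I"
    and A: "\<And>i j. i \<in> I \<Longrightarrow> j \<in> I \<Longrightarrow> ((\<lambda>t. A t i j) has_real_derivative A' i j) (at t0)"
    and left: "\<forall>\<^sub>F t in nhds t0. \<forall>i\<in>I. \<forall>j\<in>I. (\<Sum>k\<in>I. B t i k * A t k j) = (if i = j then 1 else 0)"
    and right: "\<And>i j. i \<in> I \<Longrightarrow> j \<in> I \<Longrightarrow> (\<Sum>k\<in>I. A t0 i k * B t0 k j) = (if i = j then 1 else 0)"
    and ij: "i \<in> I" "j \<in> I"
  shows "((\<lambda>t. B t i j) has_real_derivative - (\<Sum>k\<in>I. \<Sum>l\<in>I. B t0 i k * A' k l * B t0 l j)) (at t0)"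
proof -
  have left': "\<forall>\<^sub>F t in at t0. \<forall>i\<in>I. \<forall>j\<in>I. (\<Sum>k\<in>I. B t i k * A t k j) = (if i = j then 1 else 0)"
    using left by (simp add: eventually_nhds_conv_at)
  define E where "E t = (\<Sum>k\<in>I. \<Sum>l\<in>I. \<bar>A t k l - A t0 k l\<bar>)" for t
  define S where "S t = (\<Sum>k\<in>I. \<Sum>l\<in>I. \<bar>B t k l\<bar>)" for t
  have S0: "S t \<ge> 0" "E t \<ge> 0" for t by (auto simp: S_def E_def intro!: sum_nonneg)
  have BS: "\<bar>B t k l\<bar> \<le> S t" if "k \<in> I" "l \<in> I" for k l t
  proof -
    have "\<bar>B t k l\<bar> \<le> (\<Sum>l\<in>I. \<bar>B t k l\<bar>)" using that I by (intro member_le_sum) auto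
    also have "\<dots> \<le> S t" unfolding S_def
      using that I by (intro member_le_sum[where f = "\<lambda>k. \<Sum>l\<in>I. \<bar>B t k l\<bar>"]) (auto intro: sum_nonneg)
    finally show ?thesis .
  qed
  have diff: "\<forall>\<^sub>F t in at t0. \<forall>i\<in>I. \<forall>j\<in>I.
      B t i j - B t0 i j = - (\<Sum>k\<in>I. \<Sum>l\<in>I. B t i k * (A t k l - A t0 k l) * B t0 l j)"
    using left'
  proof eventually_elim
    case (elim t)
    show ?case
    proof (intro ballI)
      fix i j assume ij: "i \<in> I" "j \<in> I"
      have "(\<Sum>k\<in>I. \<Sum>l\<in>I. B t i k * A t k l * B t0 l j) = (\<Sum>l\<in>I. (\<Sum>k\<in>I. B t i k * A t k l) * B t0 l j)"
        by (subst sum.swap) (simp add: sum_distrib_right)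
      also have "\<dots> = (\<Sum>l\<in>I. (if i = l then 1 else 0) * B t0 l j)"
        using elim ij by simp
      also have "\<dots> = B t0 i j"
        using I ij by (simp add: if_distrib[of "\<lambda>z. z * _"] cong: if_cong)
      finally have 1: "(\<Sum>k\<in>I. \<Sum>l\<in>I. B t i k * A t k l * B t0 l j) = B t0 i j" .
      have "(\<Sum>k\<in>I. \<Sum>l\<in>I. B t i k * A t0 k l * B t0 l j) = (\<Sum>k\<in>I. B t i k * (\<Sum>l\<in>I. A t0 k l * B t0 l j))"
        by (simp add: sum_distrib_left mult.assoc)
      also have "\<dots> = (\<Sum>k\<in>I. B t i k * (if k = j then 1 else 0))"
        using right ij by simp
      also have "\<dots> = B t i j"
        using I ij by (simp add: if_distrib[of "\<lambda>z. _ * z"] cong: if_cong)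
      finally have 2: "(\<Sum>k\<in>I. \<Sum>l\<in>I. B t i k * A t0 k l * B t0 l j) = B t i j" .
      show "B t i j - B t0 i j = - (\<Sum>k\<in>I. \<Sum>l\<in>I. B t i k * (A t k l - A t0 k l) * B t0 l j)"
        using 1 2 by (simp add: algebra_simps sum_subtractf)
    qed
  qed
  have est: "\<forall>\<^sub>F t in at t0. \<forall>i\<in>I. \<forall>j\<in>I. \<bar>B t i j - B t0 i j\<bar> \<le> S t * E t * S t0"
    using diff
  proof eventually_elim
    case (elim t)
    show ?case
    proof (intro ballI)
      fix i j assume ij: "i \<in> I" "j \<in> I"
      have "\<bar>B t i j - B t0 i j\<bar> \<le> (\<Sum>k\<in>I. \<Sum>l\<in>I. \<bar>B t i k * (A t k l - A t0 k l) * B t0 l j\<bar>)"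
        using elim ij by (auto intro!: order.trans[OF sum_abs] sum_mono)
      also have "\<dots> \<le> (\<Sum>k\<in>I. \<Sum>l\<in>I. S t * \<bar>A t k l - A t0 k l\<bar> * S t0)"
        using BS ij S0 by (intro sum_mono) (auto simp: abs_mult intro!: mult_mono)
      also have "\<dots> = S t * E t * S t0"
        by (simp add: E_def sum_distrib_left sum_distrib_right)
      finally show "\<bar>B t i j - B t0 i j\<bar> \<le> S t * E t * S t0" .
    qed
  qed
  have Alim: "((\<lambda>t. A t k l) \<longlongrightarrow> A t0 k l) (at t0)" if "k \<in> I" "l \<in> I" for k l
    using DERIV_isCont[OF A[OF that]] by (simp add: isCont_def)
  have Elim: "(E \<longlongrightarrow> 0) (at t0)"
  proof -
    have "((\<lambda>t. \<Sum>k\<in>I. \<Sum>l\<in>I. \<bar>A t k l - A t0 k l\<bar>) \<longlongrightarrow> (\<Sum>k\<in>I. \<Sum>l\<in>I. \<bar>A t0 k l - A t0 k l\<bar>)) (at t0)"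
      using Alim by (intro tendsto_intros) auto
    then show ?thesis by (simp add: E_def[abs_def])
  qed
  define m where "m = (real (card I))\<^sup>2"
  have "((\<lambda>t. m * (E t * S t0)) \<longlongrightarrow> m * (0 * S t0)) (at t0)"
    by (intro tendsto_intros Elim)
  then have "\<forall>\<^sub>F t in at t0. m * (E t * S t0) < 1/2"
    by (rule order_tendstoD) simp
  \<comment> \<open>Summing the estimate over all \<open>m\<close> entries gives S(t) \<le> S(t0) +
    S(t)/2, and the last term is absorbed on the left.\<close>
  then have bound: "\<forall>\<^sub>F t in at t0. S t \<le> 2 * S t0"
    using est
  proof eventually_elim
    case (elim t)
    have "S t \<le> (\<Sum>i\<in>I. \<Sum>j\<in>I. \<bar>B t0 i j\<bar> + S t * E t * S t0)"
      unfolding S_def using elim(2) by (intro sum_mono) (fastforce simp: S_def)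
    also have "\<dots> = S t0 + S t * (m * (E t * S t0))"
      by (simp add: sum.distrib S_def[of t0] m_def power2_eq_square)
    also have "\<dots> \<le> S t0 + S t * (1/2)"
      using elim(1) S0 by (intro add_left_mono mult_left_mono) auto
    finally show ?case by simp
  qed
  have lim: "((\<lambda>t. B t i j) \<longlongrightarrow> B t0 i j) (at t0)" if "i \<in> I" "j \<in> I" for i j
  proof -
    have "\<forall>\<^sub>F t in at t0. \<bar>B t i j - B t0 i j\<bar> \<le> 2 * S t0 * E t * S t0"
      using est bound
    proof eventually_elim
      case (elim t)
      have "S t * E t * S t0 \<le> 2 * S t0 * E t * S t0"
        using elim(2) S0 by (intro mult_right_mono) auto
      then show ?case using elim(1) that by fastforce
    qed
    moreover have "((\<lambda>t. 2 * S t0 * E t * S t0) \<longlongrightarrow> 2 * S t0 * 0 * S t0) (at t0)"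
      by (intro tendsto_intros Elim)
    ultimately have "((\<lambda>t. B t i j - B t0 i j) \<longlongrightarrow> 0) (at t0)"
      by (intro Lim_null_comparison[of "\<lambda>t. B t i j - B t0 i j" "\<lambda>t. 2 * S t0 * E t * S t0"]) auto
    then show ?thesis using LIM_zero_iff by blast
  qed
  have "((\<lambda>t. - (\<Sum>k\<in>I. \<Sum>l\<in>I. B t i k * ((A t k l - A t0 k l) / (t - t0)) * B t0 l j))
      \<longlongrightarrow> - (\<Sum>k\<in>I. \<Sum>l\<in>I. B t0 i k * A' k l * B t0 l j)) (at t0)"
    using A lim ij unfolding has_field_derivative_iff by (intro tendsto_intros) auto
  then show ?thesis
    unfolding has_field_derivative_iff
  proof (rule Lim_transform_eventually)
    show "\<forall>\<^sub>F t in at t0. - (\<Sum>k\<in>I. \<Sum>l\<in>I. B t i k * ((A t k l - A t0 k l) / (t - t0)) * B t0 l j)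
        = (B t i j - B t0 i j) / (t - t0)"
      using diff by eventually_elim (use ij in \<open>simp add: sum_divide_distrib\<close>)
  qed
qed

text \<open>Two candidates for the normal part differ by a vector that lies in \<open>T\<close> and
  is orthogonal to \<open>T\<close>, and this vanishes by positivity. Any explicit orthogonal
  decomposition thus evaluates the choice in \<open>normal_part\<close>.\<close>

lemma normal_part_eq:
  assumes pos: "positive_matrix I G"
    and T: "\<And>s t. s \<in> T \<Longrightarrow> t \<in> T \<Longrightarrow> (\<lambda>i. s i - t i) \<in> T"
    and z: "\<And>t. t \<in> T \<Longrightarrow> inner_of I G z t = 0" and t: "t \<in> T" "\<And>i. i \<in> I \<Longrightarrow> w i = z i + t i"
    and i: "i \<in> I"
  shows "normal_part I G T w i = z i"
proof -
  define y where "y = normal_part I G T w"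
  have "\<exists>z. (\<forall>t\<in>T. inner_of I G z t = 0) \<and> (\<exists>t\<in>T. \<forall>i\<in>I. w i = z i + t i)"
    using z t by blast
  from someI_ex[OF this] obtain r where r: "\<And>t. t \<in> T \<Longrightarrow> inner_of I G y t = 0" "r \<in> T"
      "\<And>i. i \<in> I \<Longrightarrow> w i = y i + r i"
    unfolding y_def normal_part_def by blast
  have rt: "(\<lambda>i. t i - r i) \<in> T" using T t(1) r(2) by blast
  have "inner_of I G (\<lambda>i. y i - z i) (\<lambda>i. y i - z i) = inner_of I G (\<lambda>i. y i - z i) (\<lambda>i. t i - r i)"
    using t(2) r(3) by (intro inner_of_cong) (auto simp: algebra_simps)
  also have "\<dots> = 0" using r(1)[OF rt] z[OF rt] by (simp add: inner_of_diff_left)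
  finally have "y i - z i = 0" using positive_matrix_zero[OF pos _ i] by blast
  then show ?thesis by (simp add: y_def)
qed

section \<open>The Levi-Civita connection in a chart\<close>

lemma has_gradient_const: "has_gradient I (\<lambda>_. c) (\<lambda>_. 0) x"
  by (simp add: has_gradient_def)

lemma has_gradient_add:
  "has_gradient I f D x \<Longrightarrow> has_gradient I g E x \<Longrightarrow> has_gradient I (\<lambda>y. f y + g y) (\<lambda>i. D i + E i) x"
  unfolding has_gradient_def by (auto simp: ring_distribs sum.distrib intro!: DERIV_add)

lemma has_gradient_diff:
  "has_gradient I f D x \<Longrightarrow> has_gradient I g E x \<Longrightarrow> has_gradient I (\<lambda>y. f y - g y) (\<lambda>i. D i - E i) x"
  unfolding has_gradient_def by (auto simp: left_diff_distrib sum_subtractf intro!: DERIV_diff)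

lemma has_gradient_mult:
  assumes "has_gradient I f D x" "has_gradient I g E x"
  shows "has_gradient I (\<lambda>y. f y * g y) (\<lambda>i. D i * g x + E i * f x) x"
  unfolding has_gradient_def
proof (intro allI impI)
  fix \<gamma> v t
  assume *: "\<gamma> t = x" "\<forall>\<^sub>F s in nhds t. \<gamma> s \<in> extensional I"
    "\<forall>i\<in>I. ((\<lambda>s. \<gamma> s i) has_real_derivative v i) (at t)"
  have "((\<lambda>s. f (\<gamma> s) * g (\<gamma> s)) has_real_derivative (\<Sum>i\<in>I. D i * v i) * g (\<gamma> t) + (\<Sum>i\<in>I. E i * v i) * f (\<gamma> t)) (at t)"
    using * by (intro DERIV_mult has_gradientD[OF assms(1)] has_gradientD[OF assms(2)]) auto
  also have "(\<Sum>i\<in>I. D i * v i) * g (\<gamma> t) + (\<Sum>i\<in>I. E i * v i) * f (\<gamma> t) = (\<Sum>i\<in>I. (D i * g x + E i * f x) * v i)"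
    using * by (simp add: sum_distrib_left sum_distrib_right sum.distrib ring_distribs mult_ac)
  finally show "((\<lambda>s. f (\<gamma> s) * g (\<gamma> s)) has_real_derivative (\<Sum>i\<in>I. (D i * g x + E i * f x) * v i)) (at t)" .
qed

lemma has_gradient_sum:
  "(\<And>a. a \<in> A \<Longrightarrow> has_gradient I (f a) (D a) x) \<Longrightarrow>
    has_gradient I (\<lambda>y. \<Sum>a\<in>A. f a y) (\<lambda>i. \<Sum>a\<in>A. D a i) x"
  by (induction A rule: infinite_finite_induct) (auto intro: has_gradient_const has_gradient_add)

lemma curve_eventually_in_open:
  assumes I: "finite I" and U: "openin (powertop_real I) U" and "\<gamma> t \<in> U"
    and ext: "\<forall>\<^sub>F s in nhds t. \<gamma> s \<in> extensional I"
    and d: "\<And>i. i \<in> I \<Longrightarrow> ((\<lambda>s. \<gamma> s i) has_real_derivative v i) (at t)"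
  shows "\<forall>\<^sub>F s in nhds t. \<gamma> s \<in> U"
proof -
  obtain \<delta> where \<delta>: "\<delta> > 0" "\<And>y. y \<in> extensional I \<Longrightarrow> (\<forall>i\<in>I. \<bar>y i - \<gamma> t i\<bar> < \<delta>) \<Longrightarrow> y \<in> U"
    using powertop_real_open_box[OF I U assms(3)] by blast
  have "\<forall>\<^sub>F s in nhds t. \<forall>i\<in>I. \<bar>\<gamma> s i - \<gamma> t i\<bar> < \<delta>"
  proof -
    have "\<forall>\<^sub>F s in nhds t. \<bar>\<gamma> s i - \<gamma> t i\<bar> < \<delta>" if "i \<in> I" for i
    proof -
      have "isCont (\<lambda>s. \<gamma> s i) t" using d[OF that] by (rule DERIV_isCont)
      then have "((\<lambda>s. \<gamma> s i) \<longlongrightarrow> \<gamma> t i) (nhds t)" by (simp add: isCont_def tendsto_at_iff_tendsto_nhds[of "\<lambda>s. \<gamma> s i" t])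
      then show ?thesis using \<open>\<delta> > 0\<close> by (auto dest!: tendstoD[of _ _ _ \<delta>] simp: dist_real_def)
    qed
    then show ?thesis using I by (simp add: eventually_ball_finite)
  qed
  then show ?thesis using ext by eventually_elim (use \<delta> in blast)
qed

lemma line_eventually_in_open:
  assumes I: "finite I" and U: "openin (powertop_real I) U" and x: "x \<in> U" and "i \<in> I"
  shows "\<forall>\<^sub>F s in nhds (x i). x(i := s) \<in> U"
proof -
  have "x \<in> extensional I" using openin_powertop_real_extensional[OF U] x by blast
  then show ?thesis
    using assms by (intro curve_eventually_in_open[where v = "\<lambda>j. if j = i then 1 else 0"])
      (auto simp: extensional_def)
qed

lemma pderivative_cong:
  assumes I: "finite I" and U: "openin (powertop_real I) U" and x: "x \<in> U" and i: "i \<in> I"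
    and eq: "\<And>y. y \<in> U \<Longrightarrow> f y = g y"
  shows "pderivative i f x = pderivative i g x"
proof -
  have "\<forall>\<^sub>F s in nhds (x i). f (x(i := s)) = g (x(i := s))"
    using line_eventually_in_open[OF I U x i] by eventually_elim (rule eq)
  then show ?thesis unfolding pderivative_def by (intro deriv_cong_ev refl) auto
qed

text \<open>The straight line through \<open>y\<close> with velocity \<open>b\<close>;
  \<open>restrict\<close> keeps it among the extensional functions, as \<open>has_gradient\<close>
  demands of curves.\<close>

definition affine_line :: "'i set \<Rightarrow> ('i \<Rightarrow> real) \<Rightarrow> ('i \<Rightarrow> real) \<Rightarrow> real \<Rightarrow> 'i \<Rightarrow> real"
  where "affine_line I y b s = restrict (\<lambda>i. y i + s * b i) I"

lemma affine_line_facts: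
  assumes I: "finite I" and U: "openin (powertop_real I) U" and y: "y \<in> U"
  shows "affine_line I y b 0 = y" "affine_line I y b s \<in> extensional I"
    "i \<in> I \<Longrightarrow> ((\<lambda>s. affine_line I y b s i) has_real_derivative b i) (at s)"
    "\<forall>\<^sub>F s in nhds 0. affine_line I y b s \<in> U"
proof -
  show 0: "affine_line I y b 0 = y"
    using openin_powertop_real_extensional[OF U] y by (auto simp: affine_line_def fun_eq_iff extensional_def)
  show ext: "affine_line I y b s \<in> extensional I" for s by (simp add: affine_line_def)
  show D: "((\<lambda>s. affine_line I y b s i) has_real_derivative b i) (at s)" if "i \<in> I" for i s
    using that by (auto simp: affine_line_def intro!: derivative_eq_intros)
  show "\<forall>\<^sub>F s in nhds 0. affine_line I y b s \<in> U"
    using 0 y ext D by (intro curve_eventually_in_open[OF I U]) auto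
qed

text \<open>In components, \<open>\<nabla>\<^sub>a b = \<partial>\<^sub>a b + conn a b\<close>; \<open>conn_deriv v\<close> differentiates the coefficients of \<open>conn\<close> along \<open>v\<close>.\<close>

definition conn :: "('a, 'c, 'i) riem_manifold \<Rightarrow> 'c \<Rightarrow> ('i \<Rightarrow> real) \<Rightarrow> ('i \<Rightarrow> real) \<Rightarrow> ('i \<Rightarrow> real) \<Rightarrow> 'i \<Rightarrow> real"
  where "conn N d y a b l = (\<Sum>i\<in>cindex N. \<Sum>j\<in>cindex N. christoffel N d y l i j * a i * b j)"

definition conn_deriv :: "('a, 'c, 'i) riem_manifold \<Rightarrow> 'c \<Rightarrow> ('i \<Rightarrow> real) \<Rightarrow> ('i \<Rightarrow> real) \<Rightarrow>
    ('i \<Rightarrow> real) \<Rightarrow> ('i \<Rightarrow> real) \<Rightarrow> 'i \<Rightarrow> real"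
  where "conn_deriv N d y v a b l = (\<Sum>i\<in>cindex N. \<Sum>j\<in>cindex N. \<Sum>k\<in>cindex N.
    pderivative i (\<lambda>y. christoffel N d y l j k) y * v i * a j * b k)"

text \<open>The curvature operator of \<open>curvature_op\<close>, freed from the chart chosen at a
  point.\<close>

definition curv :: "('a, 'c, 'i) riem_manifold \<Rightarrow> 'c \<Rightarrow> ('i \<Rightarrow> real) \<Rightarrow> ('i \<Rightarrow> real) \<Rightarrow>
    ('i \<Rightarrow> real) \<Rightarrow> ('i \<Rightarrow> real) \<Rightarrow> 'i \<Rightarrow> real"
  where "curv N d y v w z l = (\<Sum>i\<in>cindex N. \<Sum>j\<in>cindex N. \<Sum>k\<in>cindex N.
    curvature_tensor N d y l i j k * v i * w j * z k)"

text \<open>Coordinate-constant fields have vanishing bracket, so R(v, w) z is the commutator of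
  covariant derivatives. The derivative of \<open>conn w z\<close> along \<open>v\<close> consists
  of \<open>conn_deriv v w z\<close> and \<open>conn v (conn w z)\<close>; the rest is relabelling
  of summation indices.\<close>

lemma curv_commutator:
  "curv N d y v w z l = conn_deriv N d y v w z l - conn_deriv N d y w v z l
    + conn N d y v (conn N d y w z) l - conn N d y w (conn N d y v z) l"
proof -
  let ?J = "cindex N" and ?C = "christoffel N d y"
  have 1: "conn_deriv N d y w v z l = (\<Sum>i\<in>?J. \<Sum>j\<in>?J. \<Sum>k\<in>?J.
      pderivative j (\<lambda>y. christoffel N d y l i k) y * v i * w j * z k)"
    unfolding conn_deriv_def by (subst sum.swap) (simp add: mult_ac)
  have 2: "conn N d y a (conn N d y b z) l = (\<Sum>i\<in>?J. \<Sum>j\<in>?J. \<Sum>k\<in>?J. (\<Sum>m\<in>?J. ?C l i m * ?C m j k) * a i * b j * z k)"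
    for a b
  proof -
    have "(\<Sum>m\<in>?J. ?C l i m * a i * conn N d y b z m) = (\<Sum>j\<in>?J. \<Sum>k\<in>?J. (\<Sum>m\<in>?J. ?C l i m * ?C m j k) * a i * b j * z k)" for i
    proof -
      have "(\<Sum>m\<in>?J. ?C l i m * a i * conn N d y b z m)
          = (\<Sum>m\<in>?J. \<Sum>j\<in>?J. \<Sum>k\<in>?J. ?C l i m * ?C m j k * a i * b j * z k)"
        by (simp add: conn_def sum_distrib_left mult_ac)
      also have "\<dots> = (\<Sum>j\<in>?J. \<Sum>m\<in>?J. \<Sum>k\<in>?J. ?C l i m * ?C m j k * a i * b j * z k)"
        by (rule sum.swap)
      also have "\<dots> = (\<Sum>j\<in>?J. \<Sum>k\<in>?J. \<Sum>m\<in>?J. ?C l i m * ?C m j k * a i * b j * z k)"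
        by (intro sum.cong refl sum.swap)
      finally show ?thesis by (simp add: sum_distrib_right)
    qed
    then show ?thesis by (simp add: conn_def[of N d y a])
  qed
  have 3: "conn N d y w (conn N d y v z) l = (\<Sum>i\<in>?J. \<Sum>j\<in>?J. \<Sum>k\<in>?J. (\<Sum>m\<in>?J. ?C l j m * ?C m i k) * v i * w j * z k)"
    unfolding 2 by (subst sum.swap) (simp add: mult_ac)
  show ?thesis
    unfolding 1 3 unfolding 2 curv_def conn_deriv_def curvature_tensor_def sum_subtractf
    by (simp only: distrib_right left_diff_distrib sum.distrib sum_subtractf)
qed

lemma conn_add_right: "conn N d y a (\<lambda>i. b i + c i) l = conn N d y a b l + conn N d y a c l"
  by (simp add: conn_def algebra_simps sum.distrib)

lemma curv_linear1: "curv N d y (\<lambda>i. p * v i + q * v' i) w z l = p * curv N d y v w z l + q * curv N d y v' w z l"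
  by (simp add: curv_def algebra_simps sum.distrib sum_distrib_left)

lemma curv_linear2: "curv N d y v (\<lambda>i. p * w i + q * w' i) z l = p * curv N d y v w z l + q * curv N d y v w' z l"
  by (simp add: curv_def algebra_simps sum.distrib sum_distrib_left)

lemma curv_linear3: "curv N d y v w (\<lambda>i. p * z i + q * z' i) l = p * curv N d y v w z l + q * curv N d y v w z' l"
  by (simp add: curv_def algebra_simps sum.distrib sum_distrib_left)

lemma curv_skew: "curv N d y v w z l = - curv N d y w v z l"
  by (simp add: curv_commutator)

text \<open>Contracting with the metric cancels the inverse matrix and leaves the Christoffel
  symbols of the first kind. Only the Gram matrix at the point has to be symmetric and positive, so
  this applies to a warped product directly.\<close>

lemma lower_christoffel:
  assumes fin: "finite (cindex N)" and sym: "symmetric_matrix (cindex N) (lgram N d y)"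
    and pos: "positive_matrix (cindex N) (lgram N d y)" and k: "k \<in> cindex N"
  shows "(\<Sum>l\<in>cindex N. lgram N d y k l * christoffel N d y l i j)
    = (pderivative i (\<lambda>y. lgram N d y j k) y + pderivative j (\<lambda>y. lgram N d y i k) y
       - pderivative k (\<lambda>y. lgram N d y i j) y) / 2"
proof -
  let ?J = "cindex N"
  let ?W = "\<lambda>m. pderivative i (\<lambda>y. lgram N d y j m) y + pderivative j (\<lambda>y. lgram N d y i m) y
    - pderivative m (\<lambda>y. lgram N d y i j) y"
  let ?B = "inverse_matrix ?J (lgram N d y)"
  have "(\<Sum>l\<in>?J. lgram N d y k l * christoffel N d y l i j)
      = (\<Sum>l\<in>?J. \<Sum>m\<in>?J. lgram N d y k l * ?B l m * ?W m) / 2"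
    unfolding christoffel_def by (simp add: sum_divide_distrib sum_distrib_left mult.assoc)
  also have "\<dots> = (\<Sum>m\<in>?J. (\<Sum>l\<in>?J. lgram N d y k l * ?B l m) * ?W m) / 2"
    by (subst sum.swap) (simp add: sum_distrib_right)
  also have "\<dots> = (\<Sum>m\<in>?J. (if k = m then 1 else 0) * ?W m) / 2"
    using inverse_matrix(2)[OF fin sym pos k] by simp
  also have "\<dots> = ?W k / 2"
    using fin k by (simp add: if_distrib[of "\<lambda>z. z * _"] cong: if_cong)
  finally show ?thesis .
qed

section \<open>Covariant differentiation in one chart\<close>

locale riemannian_chart =
  fixes N :: "('a, 'c, 'i) riem_manifold" and d :: 'c
  assumes N: "riemannian_manifold N" and d: "d \<in> charts N"
begin

abbreviation J where "J \<equiv> cindex N"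
abbreviation V where "V \<equiv> cmap N d ` cdom N d"

lemma finite_J: "finite J"
  using N by (auto simp: riemannian_manifold_def topological_manifold_def)

lemma open_V: "openin (powertop_real J) V"
  using N d by (auto simp: riemannian_manifold_def topological_manifold_def)

lemma V_ext: "y \<in> V \<Longrightarrow> y \<in> extensional J"
  using openin_powertop_real_extensional[OF open_V] by blast

lemma homeo: "homeomorphic_map (subtopology (mtop N) (cdom N d)) (subtopology (powertop_real J) V) (cmap N d)"
  using N d by (auto simp: riemannian_manifold_def topological_manifold_def)

lemma open_cdom: "openin (mtop N) (cdom N d)"
  using N d by (auto simp: riemannian_manifold_def topological_manifold_def)

lemma inj_cmap: "inj_on (cmap N d) (cdom N d)"
proof -
  have "topspace (subtopology (mtop N) (cdom N d)) = cdom N d"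
    using openin_subset[OF open_cdom] by auto
  then show ?thesis using homeomorphic_imp_injective_map[OF homeo] by simp
qed

lemma cinv_cmap: "p \<in> cdom N d \<Longrightarrow> cinv N d (cmap N d p) = p"
  unfolding cinv_def by (rule inv_into_f_f[OF inj_cmap])

lemma cmap_cinv: "y \<in> V \<Longrightarrow> cmap N d (cinv N d y) = y"
  unfolding cinv_def by (rule f_inv_into_f)

lemma cinv_cdom: "y \<in> V \<Longrightarrow> cinv N d y \<in> cdom N d"
  unfolding cinv_def by (rule inv_into_into)

lemma lgram_cmap: "p \<in> cdom N d \<Longrightarrow> lgram N d (cmap N d p) = gram N d p"
  by (simp add: lgram_def cinv_cmap fun_eq_iff)

lemma sym_lgram: "y \<in> V \<Longrightarrow> symmetric_matrix J (lgram N d y)"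
  using N d cinv_cdom[of y]
  unfolding riemannian_manifold_def riemannian_metric_def symmetric_matrix_def lgram_def by metis

lemma pos_lgram: "y \<in> V \<Longrightarrow> positive_matrix J (lgram N d y)"
  using N d cinv_cdom[of y]
  unfolding riemannian_manifold_def riemannian_metric_def positive_matrix_def lgram_def by metis

lemma smooth_lgram: "i \<in> J \<Longrightarrow> j \<in> J \<Longrightarrow> smooth_on J V (\<lambda>y. lgram N d y i j)"
  using N d unfolding riemannian_manifold_def riemannian_metric_def by blast

abbreviation dG where "dG k i j y \<equiv> pderivative k (\<lambda>y. lgram N d y i j) y"

abbreviation ip where "ip y \<equiv> inner_of J (lgram N d y)"

lemma dG_commute: "y \<in> V \<Longrightarrow> k \<in> J \<Longrightarrow> i \<in> J \<Longrightarrow> j \<in> J \<Longrightarrow> dG k i j y = dG k j i y"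
  using sym_lgram by (intro pderivative_cong[OF finite_J open_V]) (auto simp: symmetric_matrix_def)

lemma ip_commute: "y \<in> V \<Longrightarrow> ip y v w = ip y w v"
  using sym_lgram by (intro inner_of_commute) (auto simp: symmetric_matrix_def)

lemma christoffel_commute:
  assumes "y \<in> V" "i \<in> J" "j \<in> J"
  shows "christoffel N d y l i j = christoffel N d y l j i"
proof -
  have "dG i j m y + dG j i m y - dG m i j y = dG j i m y + dG i j m y - dG m j i y" if "m \<in> J" for m
    using dG_commute[OF assms(1) that assms(2,3)] by simp
  then show ?thesis
    unfolding christoffel_def by (intro arg_cong[where f = "\<lambda>x. x / 2"] sum.cong refl) (simp only:)
qed

lemma christoffel_lower:
  assumes y: "y \<in> V" and k: "k \<in> J"
  shows "(\<Sum>l\<in>J. lgram N d y k l * christoffel N d y l i j) = (dG i j k y + dG j i k y - dG k i j y) / 2"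
  by (rule lower_christoffel[OF finite_J sym_lgram[OF y] pos_lgram[OF y] k])

lemma ip_christoffel:
  assumes y: "y \<in> V" and "i \<in> J" "k \<in> J"
  shows "ip y (\<lambda>l. christoffel N d y l k i) X = (\<Sum>j\<in>J. X j * ((dG k i j y + dG i k j y - dG j k i y) / 2))"
proof -
  have "ip y (\<lambda>l. christoffel N d y l k i) X = ip y X (\<lambda>l. christoffel N d y l k i)"
    by (rule ip_commute[OF y])
  also have "\<dots> = (\<Sum>j\<in>J. X j * (\<Sum>l\<in>J. lgram N d y j l * christoffel N d y l k i))"
    by (simp add: inner_of_def sum_distrib_left mult_ac)
  also have "\<dots> = (\<Sum>j\<in>J. X j * ((dG k i j y + dG i k j y - dG j k i y) / 2))"
    by (intro sum.cong refl) (simp only: christoffel_lower[OF y])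
  finally show ?thesis .
qed

lemma ip_conn:
  assumes y: "y \<in> V"
  shows "ip y (conn N d y a X) Z =
    (\<Sum>k\<in>J. \<Sum>i\<in>J. \<Sum>j\<in>J. a k * X i * Z j * ((dG k i j y + dG i k j y - dG j k i y) / 2))"
proof -
  have "ip y (conn N d y a X) Z = ip y (\<lambda>l. \<Sum>k\<in>J. \<Sum>i\<in>J. (a k * X i) * christoffel N d y l k i) Z"
    by (intro inner_of_cong) (auto simp: conn_def mult_ac)
  also have "\<dots> = (\<Sum>k\<in>J. \<Sum>i\<in>J. (a k * X i) * ip y (\<lambda>l. christoffel N d y l k i) Z)"
    by (simp only: inner_of_linear)
  finally show ?thesis using ip_christoffel[OF y] by (simp add: sum_distrib_left mult_ac)
qed

text \<open>Metric compatibility: in the sum of the symbols of the first kind for (k, i; j) and (k,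
  j; i), all derivatives of the metric cancel except the one of g_ij in direction k.\<close>

lemma metric_derivative:
  assumes y: "y \<in> V"
  shows "(\<Sum>i\<in>J. \<Sum>j\<in>J. (\<Sum>k\<in>J. dG k i j y * a k) * X i * Z j)
    = ip y (conn N d y a X) Z + ip y X (conn N d y a Z)"
proof -
  have 1: "(\<Sum>i\<in>J. \<Sum>j\<in>J. (\<Sum>k\<in>J. dG k i j y * a k) * X i * Z j)
    = (\<Sum>k\<in>J. \<Sum>i\<in>J. \<Sum>j\<in>J. a k * X i * Z j * dG k i j y)"
  proof -
    have "(\<Sum>i\<in>J. \<Sum>j\<in>J. (\<Sum>k\<in>J. dG k i j y * a k) * X i * Z j)
      = (\<Sum>i\<in>J. \<Sum>j\<in>J. \<Sum>k\<in>J. a k * X i * Z j * dG k i j y)"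
      by (simp add: sum_distrib_left sum_distrib_right mult_ac)
    also have "\<dots> = (\<Sum>i\<in>J. \<Sum>k\<in>J. \<Sum>j\<in>J. a k * X i * Z j * dG k i j y)"
      by (intro sum.cong refl sum.swap)
    also have "\<dots> = (\<Sum>k\<in>J. \<Sum>i\<in>J. \<Sum>j\<in>J. a k * X i * Z j * dG k i j y)"
      by (rule sum.swap)
    finally show ?thesis .
  qed
  have 2: "ip y X (conn N d y a Z) =
      (\<Sum>k\<in>J. \<Sum>i\<in>J. \<Sum>j\<in>J. a k * X i * Z j * ((dG k j i y + dG j k i y - dG i k j y) / 2))"
  proof -
    have "ip y X (conn N d y a Z) = (\<Sum>k\<in>J. \<Sum>j\<in>J. \<Sum>i\<in>J. a k * Z j * X i * ((dG k j i y + dG j k i y - dG i k j y) / 2))"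
      using ip_conn[OF y, of a Z X] ip_commute[OF y] by simp
    also have "\<dots> = (\<Sum>k\<in>J. \<Sum>i\<in>J. \<Sum>j\<in>J. a k * Z j * X i * ((dG k j i y + dG j k i y - dG i k j y) / 2))"
      by (intro sum.cong refl sum.swap)
    finally show ?thesis by (simp add: mult_ac)
  qed
  have "a k * X i * Z j * dG k i j y = a k * X i * Z j * ((dG k i j y + dG i k j y - dG j k i y) / 2)
      + a k * X i * Z j * ((dG k j i y + dG j k i y - dG i k j y) / 2)"
    if "k \<in> J" "i \<in> J" "j \<in> J" for k i j
  proof -
    have "p * q = p * ((q + r - s) / 2) + p * ((q + s - r) / 2)" for p q r s :: real
      by (simp add: field_simps)
    then show ?thesis unfolding dG_commute[OF y that] .
  qed
  then show ?thesis
    unfolding 1 2 ip_conn[OF y] sum.distrib[symmetric] by (intro sum.cong refl) auto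
qed

lemma lgram_has_gradient: "y \<in> V \<Longrightarrow> i \<in> J \<Longrightarrow> j \<in> J \<Longrightarrow>
    has_gradient J (\<lambda>y. lgram N d y i j) (\<lambda>k. dG k i j y) y"
  by (rule smooth_on_has_gradient[OF finite_J open_V smooth_lgram])

lemma dG_has_gradient: "y \<in> V \<Longrightarrow> i \<in> J \<Longrightarrow> j \<in> J \<Longrightarrow> k \<in> J \<Longrightarrow>
    has_gradient J (dG k i j) (\<lambda>l. pderivative l (dG k i j) y) y"
  by (rule smooth_on_has_gradient[OF finite_J open_V smooth_on_pderivative[OF smooth_lgram]])

lemma inverse_has_gradient:
  assumes y: "y \<in> V" and ij: "i \<in> J" "j \<in> J"
  shows "has_gradient J (\<lambda>y. inverse_matrix J (lgram N d y) i j)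
    (\<lambda>q. - (\<Sum>k\<in>J. \<Sum>l\<in>J. inverse_matrix J (lgram N d y) i k * dG q k l y * inverse_matrix J (lgram N d y) l j)) y"
  unfolding has_gradient_def
proof (intro allI impI)
  fix \<gamma> v t
  assume \<gamma>: "\<gamma> t = y" "\<forall>\<^sub>F s in nhds t. \<gamma> s \<in> extensional J"
    "\<forall>i\<in>J. ((\<lambda>s. \<gamma> s i) has_real_derivative v i) (at t)"
  have ev: "\<forall>\<^sub>F s in nhds t. \<gamma> s \<in> V"
    using \<gamma> y by (intro curve_eventually_in_open[OF finite_J open_V]) auto
  let ?B = "inverse_matrix J (lgram N d y)"
  have "((\<lambda>s. inverse_matrix J (lgram N d (\<gamma> s)) i j) has_real_derivative
      - (\<Sum>k\<in>J. \<Sum>l\<in>J. inverse_matrix J (lgram N d (\<gamma> t)) i k * (\<Sum>q\<in>J. dG q k l y * v q) * inverse_matrix J (lgram N d (\<gamma> t)) l j)) (at t)"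
  proof (rule DERIV_matrix_inverse[OF finite_J, where A = "\<lambda>s. lgram N d (\<gamma> s)"])
    show "((\<lambda>s. lgram N d (\<gamma> s) k l) has_real_derivative (\<Sum>q\<in>J. dG q k l y * v q)) (at t)"
      if "k \<in> J" "l \<in> J" for k l
      using \<gamma> by (intro has_gradientD[OF lgram_has_gradient[OF y that]]) auto
    show "\<forall>\<^sub>F s in nhds t. \<forall>i\<in>J. \<forall>j\<in>J. (\<Sum>k\<in>J. inverse_matrix J (lgram N d (\<gamma> s)) i k * lgram N d (\<gamma> s) k j) = (if i = j then 1 else 0)"
      using ev by eventually_elim (use inverse_matrix(1)[OF finite_J sym_lgram pos_lgram] in blast)
    show "(\<Sum>k\<in>J. lgram N d (\<gamma> t) i k * inverse_matrix J (lgram N d (\<gamma> t)) k j) = (if i = j then 1 else 0)"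
      if "i \<in> J" "j \<in> J" for i j
      using inverse_matrix(2)[OF finite_J sym_lgram[OF y] pos_lgram[OF y] that] \<gamma>(1) by simp
  qed (use ij in auto)
  moreover have "(\<Sum>k\<in>J. \<Sum>l\<in>J. ?B i k * (\<Sum>q\<in>J. dG q k l y * v q) * ?B l j)
      = (\<Sum>q\<in>J. (\<Sum>k\<in>J. \<Sum>l\<in>J. ?B i k * dG q k l y * ?B l j) * v q)"
  proof -
    have "(\<Sum>k\<in>J. \<Sum>l\<in>J. ?B i k * (\<Sum>q\<in>J. dG q k l y * v q) * ?B l j)
        = (\<Sum>k\<in>J. \<Sum>l\<in>J. \<Sum>q\<in>J. ?B i k * dG q k l y * ?B l j * v q)"
      by (simp add: sum_distrib_left sum_distrib_right mult_ac)
    also have "\<dots> = (\<Sum>k\<in>J. \<Sum>q\<in>J. \<Sum>l\<in>J. ?B i k * dG q k l y * ?B l j * v q)"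
      by (intro sum.cong refl sum.swap)
    also have "\<dots> = (\<Sum>q\<in>J. \<Sum>k\<in>J. \<Sum>l\<in>J. ?B i k * dG q k l y * ?B l j * v q)"
      by (rule sum.swap)
    finally show ?thesis by (simp add: sum_distrib_right)
  qed
  ultimately show "((\<lambda>s. inverse_matrix J (lgram N d (\<gamma> s)) i j) has_real_derivative
      (\<Sum>q\<in>J. - (\<Sum>k\<in>J. \<Sum>l\<in>J. ?B i k * dG q k l y * ?B l j) * v q)) (at t)"
    using \<gamma>(1) by (simp add: sum_negf)
qed

text \<open>The form of the gradient is irrelevant: the derivation rules supply some
  \<open>D\<close>, and the components of any gradient are the partial derivatives. The factor 1/2
  is written as a product to fit these rules.\<close>

lemma christoffel_has_gradient:
  assumes y: "y \<in> V" and l: "l \<in> J" and ij: "i \<in> J" "j \<in> J"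
  shows "has_gradient J (\<lambda>y. christoffel N d y l i j) (\<lambda>k. pderivative k (\<lambda>y. christoffel N d y l i j) y) y"
proof -
  have "\<exists>D. has_gradient J (\<lambda>y. (\<Sum>m\<in>J. inverse_matrix J (lgram N d y) l m *
       (dG i j m y + dG j i m y - dG m i j y)) * (1/2)) D y"
    by (rule exI, (rule has_gradient_mult has_gradient_sum has_gradient_add has_gradient_diff has_gradient_const
        inverse_has_gradient dG_has_gradient y l ij | assumption)+)
  then obtain D where D: "has_gradient J (\<lambda>y. christoffel N d y l i j) D y"
    by (auto simp: christoffel_def)
  show ?thesis by (rule has_gradient_pderivatives[OF D finite_J V_ext[OF y]])
qed

text \<open>The product rule along a curve, where \<open>X' + conn \<gamma>' X\<close> is the
  covariant derivative of the field \<open>X\<close>. It combines the ordinary product rule with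
  metric compatibility.\<close>

lemma DERIV_ip:
  assumes "\<gamma> t = y" and y: "y \<in> V" and ext: "\<forall>\<^sub>F s in nhds t. \<gamma> s \<in> extensional J"
    and \<gamma>: "\<And>i. i \<in> J \<Longrightarrow> ((\<lambda>s. \<gamma> s i) has_real_derivative \<gamma>' i) (at t)"
    and X: "\<And>i. i \<in> J \<Longrightarrow> ((\<lambda>s. X s i) has_real_derivative X' i) (at t)"
    and Z: "\<And>i. i \<in> J \<Longrightarrow> ((\<lambda>s. Z s i) has_real_derivative Z' i) (at t)"
  shows "((\<lambda>s. ip (\<gamma> s) (X s) (Z s)) has_real_derivative
    ip y (\<lambda>i. X' i + conn N d y \<gamma>' (X t) i) (Z t) + ip y (X t) (\<lambda>i. Z' i + conn N d y \<gamma>' (Z t) i)) (at t)"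
proof -
  have "((\<lambda>s. ip (\<gamma> s) (X s) (Z s)) has_real_derivative
      (\<Sum>i\<in>J. \<Sum>j\<in>J. ((\<Sum>k\<in>J. dG k i j y * \<gamma>' k) * X t i + X' i * lgram N d (\<gamma> t) i j) * Z t j
        + Z' j * (lgram N d (\<gamma> t) i j * X t i))) (at t)"
    unfolding inner_of_def
    using has_gradientD[OF lgram_has_gradient[OF y] assms(1) ext \<gamma>] X Z
    by (intro DERIV_sum DERIV_mult) auto
  moreover have "(\<Sum>i\<in>J. \<Sum>j\<in>J. ((\<Sum>k\<in>J. dG k i j y * \<gamma>' k) * X t i + X' i * lgram N d (\<gamma> t) i j) * Z t j
        + Z' j * (lgram N d (\<gamma> t) i j * X t i))
      = (\<Sum>i\<in>J. \<Sum>j\<in>J. (\<Sum>k\<in>J. dG k i j y * \<gamma>' k) * X t i * Z t j) + ip y X' (Z t) + ip y (X t) Z'"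
    using assms(1) by (simp add: inner_of_def sum.distrib[symmetric] algebra_simps)
  ultimately show ?thesis
    unfolding metric_derivative[OF y] inner_of_add_left inner_of_add_right by (simp add: algebra_simps)
qed

lemma DERIV_conn:
  assumes "\<gamma> t = y" and y: "y \<in> V" and ext: "\<forall>\<^sub>F s in nhds t. \<gamma> s \<in> extensional J"
    and \<gamma>: "\<And>i. i \<in> J \<Longrightarrow> ((\<lambda>s. \<gamma> s i) has_real_derivative \<gamma>' i) (at t)"
    and A: "\<And>i. i \<in> J \<Longrightarrow> ((\<lambda>s. A s i) has_real_derivative A' i) (at t)"
    and B: "\<And>i. i \<in> J \<Longrightarrow> ((\<lambda>s. B s i) has_real_derivative B' i) (at t)"
    and l: "l \<in> J"
  shows "((\<lambda>s. conn N d (\<gamma> s) (A s) (B s) l) has_real_derivative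
    conn_deriv N d y \<gamma>' (A t) (B t) l + conn N d y A' (B t) l + conn N d y (A t) B' l) (at t)"
proof -
  let ?C = "\<lambda>k i j. pderivative k (\<lambda>y. christoffel N d y l i j) y"
  have "((\<lambda>s. conn N d (\<gamma> s) (A s) (B s) l) has_real_derivative
      (\<Sum>i\<in>J. \<Sum>j\<in>J. ((\<Sum>k\<in>J. ?C k i j * \<gamma>' k) * A t i + A' i * christoffel N d (\<gamma> t) l i j) * B t j
        + B' j * (christoffel N d (\<gamma> t) l i j * A t i))) (at t)"
    unfolding conn_def
    using has_gradientD[OF christoffel_has_gradient[OF y l] assms(1) ext \<gamma>] A B
    by (intro DERIV_sum DERIV_mult) auto
  moreover have "(\<Sum>i\<in>J. \<Sum>j\<in>J. ((\<Sum>k\<in>J. ?C k i j * \<gamma>' k) * A t i + A' i * christoffel N d (\<gamma> t) l i j) * B t j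
        + B' j * (christoffel N d (\<gamma> t) l i j * A t i))
      = (\<Sum>i\<in>J. \<Sum>j\<in>J. (\<Sum>k\<in>J. ?C k i j * \<gamma>' k) * A t i * B t j)
        + conn N d y A' (B t) l + conn N d y (A t) B' l"
    using assms(1) by (simp add: conn_def sum.distrib[symmetric] algebra_simps)
  moreover have "(\<Sum>i\<in>J. \<Sum>j\<in>J. (\<Sum>k\<in>J. ?C k i j * \<gamma>' k) * A t i * B t j) = conn_deriv N d y \<gamma>' (A t) (B t) l"
  proof -
    have "(\<Sum>i\<in>J. \<Sum>j\<in>J. (\<Sum>k\<in>J. ?C k i j * \<gamma>' k) * A t i * B t j)
      = (\<Sum>i\<in>J. \<Sum>j\<in>J. \<Sum>k\<in>J. ?C k i j * \<gamma>' k * A t i * B t j)"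
      by (simp add: sum_distrib_right)
    also have "\<dots> = (\<Sum>i\<in>J. \<Sum>k\<in>J. \<Sum>j\<in>J. ?C k i j * \<gamma>' k * A t i * B t j)"
      by (intro sum.cong refl sum.swap)
    also have "\<dots> = (\<Sum>k\<in>J. \<Sum>i\<in>J. \<Sum>j\<in>J. ?C k i j * \<gamma>' k * A t i * B t j)"
      by (rule sum.swap)
    finally show ?thesis by (simp add: conn_deriv_def)
  qed
  ultimately show ?thesis by simp
qed

text \<open>Both sides are second derivatives of \<open>\<langle>X, Z\<rangle>\<close>, for constant \<open>X, Z\<close>, in the directions \<open>a, b\<close>.\<close>

lemma metric_second_derivative:
  assumes y: "y \<in> V"
  shows "(\<Sum>i\<in>J. \<Sum>j\<in>J. (\<Sum>k\<in>J. (\<Sum>l\<in>J. pderivative l (dG k i j) y * b l) * a k) * X i * Z j)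
    = ip y (\<lambda>i. conn_deriv N d y b a X i + conn N d y b (conn N d y a X) i) Z
      + ip y (conn N d y a X) (conn N d y b Z) + ip y (conn N d y b X) (conn N d y a Z)
      + ip y X (\<lambda>i. conn_deriv N d y b a Z i + conn N d y b (conn N d y a Z) i)"
proof -
  let ?f = "\<lambda>s. \<Sum>i\<in>J. \<Sum>j\<in>J. (\<Sum>k\<in>J. dG k i j (affine_line J y b s) * a k) * X i * Z j"
  let ?g = "\<lambda>s. ip (affine_line J y b s) (conn N d (affine_line J y b s) a X) Z + ip (affine_line J y b s) X (conn N d (affine_line J y b s) a Z)"
  note L = affine_line_facts[OF finite_J open_V y]
  have 1: "(?f has_real_derivative
      (\<Sum>i\<in>J. \<Sum>j\<in>J. (\<Sum>k\<in>J. (\<Sum>l\<in>J. pderivative l (dG k i j) y * b l) * a k) * X i * Z j)) (at 0)"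
    using has_gradientD[OF dG_has_gradient[OF y] L(1) always_eventually[OF allI[OF L(2)]] L(3)]
    by (intro DERIV_sum DERIV_cmult_right) auto
  have zero: "conn N d y (\<lambda>_. 0) X l = 0" "conn N d y a (\<lambda>_. 0) l = 0" for a X l
    by (simp_all add: conn_def)
  have C: "((\<lambda>s. conn N d (affine_line J y b s) a X l) has_real_derivative conn_deriv N d y b a X l) (at 0)" if "l \<in> J" for X l
    using DERIV_conn[OF L(1) y always_eventually[OF allI[OF L(2)]] L(3) DERIV_const DERIV_const that, of b a X]
    by (simp add: zero)
  have 2: "(?g has_real_derivative
      (ip y (\<lambda>i. conn_deriv N d y b a X i + conn N d y b (conn N d (affine_line J y b 0) a X) i) Z
        + ip y (conn N d (affine_line J y b 0) a X) (\<lambda>i. 0 + conn N d y b Z i))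
      + (ip y (\<lambda>i. 0 + conn N d y b X i) (conn N d (affine_line J y b 0) a Z)
        + ip y X (\<lambda>i. conn_deriv N d y b a Z i + conn N d y b (conn N d (affine_line J y b 0) a Z) i))) (at 0)"
    by (intro DERIV_add DERIV_ip[OF L(1) y always_eventually[OF allI[OF L(2)]] L(3)] C DERIV_const)
  have "\<forall>\<^sub>F s in nhds 0. ?f s = ?g s"
    using L(4) by eventually_elim (rule metric_derivative)
  then have "(?g has_real_derivative
      (\<Sum>i\<in>J. \<Sum>j\<in>J. (\<Sum>k\<in>J. (\<Sum>l\<in>J. pderivative l (dG k i j) y * b l) * a k) * X i * Z j)) (at 0)"
    using 1 DERIV_cong_ev[of 0 0 ?f ?g] by simp
  from DERIV_unique[OF this 2] show ?thesis by (simp add: L(1))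
qed

text \<open>Second derivatives of the metric are symmetric in the two directions. Antisymmetrising
  \<open>metric_second_derivative\<close> in \<open>a, b\<close> removes them together with the
  products of first covariant derivatives, and leaves the two curvature terms with sum zero.\<close>

lemma ip_curv_skew:
  assumes y: "y \<in> V"
  shows "ip y (curv N d y a b X) Z = - ip y (curv N d y a b Z) X"
proof -
  let ?S = "\<lambda>a b. (\<Sum>i\<in>J. \<Sum>j\<in>J. (\<Sum>k\<in>J. (\<Sum>l\<in>J. pderivative l (dG k i j) y * b l) * a k) * X i * Z j)"
  have "(\<Sum>k\<in>J. (\<Sum>l\<in>J. pderivative l (dG k i j) y * b l) * a k) = (\<Sum>k\<in>J. (\<Sum>l\<in>J. pderivative l (dG k i j) y * a l) * b k)"
    if ij: "i \<in> J" "j \<in> J" for i j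
  proof -
    have "(\<Sum>k\<in>J. (\<Sum>l\<in>J. pderivative l (dG k i j) y * b l) * a k) = (\<Sum>k\<in>J. \<Sum>l\<in>J. pderivative l (dG k i j) y * b l * a k)"
      by (simp add: sum_distrib_right)
    also have "\<dots> = (\<Sum>l\<in>J. \<Sum>k\<in>J. pderivative l (dG k i j) y * b l * a k)" by (rule sum.swap)
    also have "\<dots> = (\<Sum>l\<in>J. \<Sum>k\<in>J. pderivative k (dG l i j) y * b l * a k)"
      using pderivative_commute[OF finite_J open_V smooth_lgram[OF ij] y] by (intro sum.cong refl) simp
    finally show ?thesis by (simp add: sum_distrib_left sum_distrib_right mult_ac)
  qed
  then have "?S a b = ?S b a" by simp
  then have "ip y (\<lambda>i. conn_deriv N d y a b X i + conn N d y a (conn N d y b X) i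
        - (conn_deriv N d y b a X i + conn N d y b (conn N d y a X) i)) Z
      + ip y X (\<lambda>i. conn_deriv N d y a b Z i + conn N d y a (conn N d y b Z) i
        - (conn_deriv N d y b a Z i + conn N d y b (conn N d y a Z) i)) = 0"
    unfolding metric_second_derivative[OF y] inner_of_linear by simp
  then have "ip y (curv N d y a b X) Z + ip y X (curv N d y a b Z) = 0"
    by (simp add: curv_commutator[abs_def] algebra_simps)
  then show ?thesis using ip_commute[OF y] by (simp add: algebra_simps)
qed

end

section \<open>The maximal sectional curvature\<close>

lemma chart_at:
  assumes "(\<Union>c\<in>charts M. cdom M c) = points M" "p \<in> points M"
  shows "chart_at M p \<in> charts M" "p \<in> cdom M (chart_at M p)"
proof -
  have "\<exists>c. c \<in> charts M \<and> p \<in> cdom M c"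
    using assms by blast
  from someI_ex[OF this] show "chart_at M p \<in> charts M" "p \<in> cdom M (chart_at M p)"
    unfolding chart_at_def by blast+
qed

lemma curvature_op_eq_curv: "curvature_op N p v w z = curv N (chart_at N p) (coords_at N p) v w z"
  by (simp add: fun_eq_iff curvature_op_def curv_def)

context riemannian_chart
begin

lemma pointwise_at:
  assumes "d = chart_at N p" "p \<in> cdom N d"
  shows "coords_at N p = cmap N d p" "coords_at N p \<in> V" "inner_at N p = ip (coords_at N p)"
  using assms(2) by (auto simp: coords_at_def inner_at_def gram_at_def lgram_cmap assms(1)[symmetric])

lemma sectional_curvature_orthonormal:
  assumes "d = chart_at N p" "p \<in> cdom N d"
    and "inner_at N p X X = 1" "inner_at N p Y Y = 1" "inner_at N p X Y = 0"
  shows "sectional_curvature N p X Y = inner_at N p (curv N d (coords_at N p) X Y Y) X"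
  using assms by (simp add: sectional_curvature_def curvature_op_eq_curv)

text \<open>Numerator and denominator both acquire the factor a^2 c^2; the multiple \<open>b\<close>
  of \<open>X\<close> drops out by skew symmetry. Triangular changes suffice, as Gram--Schmidt
  relates any basis of a plane to an orthonormal one by such a change.\<close>

lemma sectional_curvature_change_basis:
  assumes p: "d = chart_at N p" "p \<in> cdom N d"
    and on: "inner_at N p X X = 1" "inner_at N p Y Y = 1" "inner_at N p X Y = 0"
    and ac: "a \<noteq> 0" "c \<noteq> 0"
  shows "sectional_curvature N p (\<lambda>i. a * X i) (\<lambda>i. b * X i + c * Y i) = sectional_curvature N p X Y"
proof -
  let ?y = "coords_at N p"
  note P = pointwise_at[OF p]
  let ?R = "curv N d ?y"
  have YX: "ip ?y Y X = 0" using on(3) ip_commute[OF P(2)] by (simp add: P(3))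
  have XX: "?R X X z l = 0" for z l using curv_skew[of N d ?y X X z l] by simp
  have X0: "(\<lambda>i. a * X i) = (\<lambda>i. a * X i + 0 * Y i)" by simp
  have R: "?R (\<lambda>i. a * X i) (\<lambda>i. b * X i + c * Y i) (\<lambda>i. b * X i + c * Y i)
      = (\<lambda>l. (a * c * b) * ?R X Y X l + (a * c * c) * ?R X Y Y l)"
    by (rule ext, subst X0, simp only: curv_linear1 curv_linear2 curv_linear3 XX, simp add: algebra_simps)
  have "ip ?y (?R X Y X) X = 0" using ip_curv_skew[OF P(2), of X Y X X] by simp
  then have num: "ip ?y (?R (\<lambda>i. a * X i) (\<lambda>i. b * X i + c * Y i) (\<lambda>i. b * X i + c * Y i)) (\<lambda>i. a * X i)
      = a\<^sup>2 * c\<^sup>2 * ip ?y (?R X Y Y) X"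
    unfolding R inner_of_linear by (simp add: power2_eq_square)
  have den: "ip ?y (\<lambda>i. a * X i) (\<lambda>i. a * X i) * ip ?y (\<lambda>i. b * X i + c * Y i) (\<lambda>i. b * X i + c * Y i)
      - (ip ?y (\<lambda>i. a * X i) (\<lambda>i. b * X i + c * Y i))\<^sup>2 = a\<^sup>2 * c\<^sup>2"
    using on YX unfolding P(3) inner_of_linear by (simp add: power2_eq_square algebra_simps)
  show ?thesis
    unfolding sectional_curvature_orthonormal[OF p on]
    unfolding sectional_curvature_def curvature_op_eq_curv p(1)[symmetric] P(3) num den
    using ac by simp
qed

end

text \<open>A product of compact intervals. Coefficient families are taken as functions on the full
  index type, with value 0 off \<open>I\<close>, so that the topology of the function type and its
  theory of continuity apply.\<close>

lemma compact_supported_box: "compact {\<xi> :: 'i \<Rightarrow> real. \<forall>i. \<xi> i \<in> (if i \<in> I then {-1..1} else {0})}"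
proof -
  have "compactin (product_topology (\<lambda>i. euclidean) UNIV) (PiE UNIV (\<lambda>i. if i \<in> I then {-1..1::real} else {0}))"
    by (subst compactin_PiE) auto
  then show ?thesis
    by (simp add: euclidean_product_topology compactin_euclidean_iff PiE_UNIV_domain Pi_def)
qed

text \<open>In terms of coefficients, the orthonormal pairs of the span form a compact set on which
  curvature is a polynomial, so it attains a maximum. Each independent pair has the curvature of an
  orthonormal pair spanning the same plane, so this maximum is the value of
  \<open>GREATEST\<close>.\<close>

lemma sectional_curvature_le_Greatest:
  fixes E :: "'i \<Rightarrow> 'j \<Rightarrow> real"
  assumes N: "riemannian_manifold N" and p: "p \<in> points N" and I: "finite I"
    and E: "\<And>r q. r \<in> I \<Longrightarrow> q \<in> I \<Longrightarrow> inner_at N p (E r) (E q) = (if r = q then 1 else 0)"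
    and T: "T = range (\<lambda>c \<alpha>. \<Sum>r\<in>I. c r * E r \<alpha>)"
    and rq: "r0 \<in> I" "q0 \<in> I" "r0 \<noteq> q0"
  shows "sectional_curvature N p (E r0) (E q0) \<le>
    (GREATEST K. \<exists>X\<in>T. \<exists>Y\<in>T. independent_pair (cindex N) X Y \<and> K = sectional_curvature N p X Y)"
proof -
  have top: "(\<Union>c\<in>charts N. cdom N c) = points N"
    using N by (simp add: riemannian_manifold_def topological_manifold_def)
  define d where "d = chart_at N p"
  have pd: "p \<in> cdom N d" using chart_at[OF top p] by (simp add: d_def)
  interpret riemannian_chart N d
    using N chart_at[OF top p] by unfold_locales (auto simp: d_def)
  let ?y = "coords_at N p"
  note P = pointwise_at[OF d_def pd]
  define comb where "comb c = (\<lambda>\<alpha>. \<Sum>r\<in>I. c r * E r \<alpha>)" for c :: "'i \<Rightarrow> real"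
  have ip: "inner_at N p (comb c) (comb c') = (\<Sum>r\<in>I. c r * c' r)" for c c'
  proof -
    have "inner_at N p (comb c) (comb c') = (\<Sum>r\<in>I. \<Sum>q\<in>I. c r * (c' q * inner_at N p (E r) (E q)))"
      unfolding comb_def P(3) inner_of_sum_left inner_of_scale_left inner_of_sum_right inner_of_scale_right
      by (simp add: sum_distrib_left)
    also have "\<dots> = (\<Sum>r\<in>I. \<Sum>q\<in>I. if q = r then c r * c' r else 0)"
      using E by (intro sum.cong) auto
    finally show ?thesis using I by simp
  qed
  define A where "A = {\<xi> :: 'i \<Rightarrow> real. \<forall>i. \<xi> i \<in> (if i \<in> I then {-1..1} else {0})}"
  define C where "C = {z :: ('i \<Rightarrow> real) \<times> ('i \<Rightarrow> real). (\<Sum>r\<in>I. fst z r * fst z r) = 1} \<inter>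
    {z. (\<Sum>r\<in>I. snd z r * snd z r) = 1} \<inter> {z. (\<Sum>r\<in>I. fst z r * snd z r) = 0}"
  have coord: "continuous_on UNIV (\<lambda>z :: ('i \<Rightarrow> real) \<times> ('i \<Rightarrow> real). fst z r)"
    "continuous_on UNIV (\<lambda>z :: ('i \<Rightarrow> real) \<times> ('i \<Rightarrow> real). snd z r)" for r
    by (rule continuous_on_product_then_coordinatewise, rule continuous_on_fst continuous_on_snd, rule continuous_on_id)+
  have "closed C"
    unfolding C_def by (intro closed_Int closed_Collect_eq continuous_on_sum continuous_on_mult coord continuous_on_const)
  then have "compact ((A \<times> A) \<inter> C)"
    unfolding A_def by (intro compact_Int_closed compact_Times compact_supported_box)
  \<comment> \<open>Unit coefficient vectors: they show that the compact set is nonempty, and since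
    they represent \<open>E r0\<close> and \<open>E q0\<close> they also bring the given plane into
    the final comparison.\<close>
  moreover define \<delta> where "\<delta> r = (\<lambda>i. if i = r then 1 else 0 :: real)" for r :: 'i
  have "(\<delta> r0, \<delta> q0) \<in> (A \<times> A) \<inter> C"
    using rq I by (auto simp: A_def C_def \<delta>_def if_distrib[of "\<lambda>z. z * _"] cong: if_cong)
  moreover have "continuous_on ((A \<times> A) \<inter> C)
      (\<lambda>z. inner_at N p (curv N d ?y (comb (fst z)) (comb (snd z)) (comb (snd z))) (comb (fst z)))"
    unfolding P(3) inner_of_def curv_def comb_def
    by (intro continuous_on_sum continuous_on_mult continuous_on_const continuous_on_subset[OF coord(1)]
        continuous_on_subset[OF coord(2)]) auto
  ultimately obtain z0 where z0: "z0 \<in> (A \<times> A) \<inter> C"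
    and max: "\<And>z. z \<in> (A \<times> A) \<inter> C \<Longrightarrow>
      inner_at N p (curv N d ?y (comb (fst z)) (comb (snd z)) (comb (snd z))) (comb (fst z))
      \<le> inner_at N p (curv N d ?y (comb (fst z0)) (comb (snd z0)) (comb (snd z0))) (comb (fst z0))"
    using continuous_attains_sup[of "(A \<times> A) \<inter> C"] by blast
  have K: "sectional_curvature N p (comb (fst z)) (comb (snd z))
      = inner_at N p (curv N d ?y (comb (fst z)) (comb (snd z)) (comb (snd z))) (comb (fst z))"
    if "z \<in> (A \<times> A) \<inter> C" for z
    using that by (intro sectional_curvature_orthonormal[OF d_def pd]) (auto simp: ip C_def)
  have max': "sectional_curvature N p (comb (fst z)) (comb (snd z)) \<le> sectional_curvature N p (comb (fst z0)) (comb (snd z0))"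
    if "z \<in> (A \<times> A) \<inter> C" for z
    using max[OF that] K[OF that] K[OF z0] by simp
  have sq_nonneg: "0 \<le> (\<Sum>r\<in>I. c r * c r)" for c :: "'i \<Rightarrow> real"
    by (intro sum_nonneg) simp
  have inA: "c \<in> A" if "\<And>i. i \<notin> I \<Longrightarrow> c i = 0" "(\<Sum>r\<in>I. c r * c r) = 1" for c
  proof -
    have "\<bar>c i\<bar> \<le> 1" if "i \<in> I" for i
    proof -
      have "c i * c i \<le> (\<Sum>r\<in>I. c r * c r)" using that I by (intro member_le_sum) auto
      then have "\<bar>c i\<bar>\<^sup>2 \<le> 1\<^sup>2" using \<open>(\<Sum>r\<in>I. c r * c r) = 1\<close> by (simp add: power2_eq_square)
      then show ?thesis by (rule power2_le_imp_le) simp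
    qed
    then show ?thesis using that(1) by (auto simp: A_def abs_le_iff)
  qed
  have indep: "independent_pair J (comb (fst z)) (comb (snd z))" if "z \<in> (A \<times> A) \<inter> C" for z
    unfolding independent_pair_def
  proof (intro allI impI)
    fix a b assume ab: "\<forall>i\<in>J. a * comb (fst z) i + b * comb (snd z) i = 0"
    have on: "ip ?y (comb (fst z)) (comb (fst z)) = 1" "ip ?y (comb (snd z)) (comb (snd z)) = 1"
      "ip ?y (comb (fst z)) (comb (snd z)) = 0" "ip ?y (comb (snd z)) (comb (fst z)) = 0"
      using that ip_commute[OF P(2), of "comb (snd z)"] unfolding P(3)[symmetric] by (auto simp: ip C_def mult.commute)
    have *: "ip ?y (\<lambda>i. a * comb (fst z) i + b * comb (snd z) i) w = 0" for w
      using ab by (simp add: inner_of_def)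
    show "a = 0 \<and> b = 0"
      using *[of "comb (fst z)"] *[of "comb (snd z)"] unfolding inner_of_linear on by simp
  qed
  have "(GREATEST K. \<exists>X\<in>T. \<exists>Y\<in>T. independent_pair (cindex N) X Y \<and> K = sectional_curvature N p X Y)
      = sectional_curvature N p (comb (fst z0)) (comb (snd z0))"
  proof (rule Greatest_equality)
    show "\<exists>X\<in>T. \<exists>Y\<in>T. independent_pair J X Y \<and>
        sectional_curvature N p (comb (fst z0)) (comb (snd z0)) = sectional_curvature N p X Y"
      using indep[OF z0] unfolding T comb_def by blast
  next
    fix L assume "\<exists>X\<in>T. \<exists>Y\<in>T. independent_pair J X Y \<and> L = sectional_curvature N p X Y"
    then obtain c c' where ind: "independent_pair J (comb c) (comb c')"
      and L: "L = sectional_curvature N p (comb c) (comb c')"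
      unfolding T comb_def by blast
    have cne: "(\<Sum>r\<in>I. c r * c r) \<noteq> 0"
    proof
      assume "(\<Sum>r\<in>I. c r * c r) = 0"
      then have "\<forall>r\<in>I. c r * c r = 0" using I by (subst (asm) sum_nonneg_eq_0_iff) auto
      then have "\<forall>i\<in>J. 1 * comb c i + 0 * comb c' i = 0" by (simp add: comb_def)
      then have "(1::real) = 0" using ind unfolding independent_pair_def by blast
      then show False by simp
    qed
    \<comment> \<open>Gram--Schmidt on the coefficients, with \<open>\<xi>, \<eta>\<close> as
      orthonormal pair: the first vector is \<open>a\<close> times \<open>\<xi>\<close>, the second
      is \<open>b\<close> times \<open>\<xi>\<close> plus \<open>e\<close> times
      \<open>\<eta>\<close>. Independence makes \<open>a\<close> and \<open>e\<close>
      nonzero.\<close>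
    define a where "a = sqrt (\<Sum>r\<in>I. c r * c r)"
    have a: "a > 0" "a * a = (\<Sum>r\<in>I. c r * c r)"
      using cne sq_nonneg[of c] by (auto simp: a_def order_less_le)
    define \<xi> where "\<xi> i = (if i \<in> I then c i / a else 0)" for i
    have \<xi>\<xi>: "(\<Sum>r\<in>I. \<xi> r * \<xi> r) = 1"
      using a by (simp add: \<xi>_def sum_divide_distrib[symmetric] flip: a(2))
    define b where "b = (\<Sum>r\<in>I. c' r * \<xi> r)"
    define w where "w i = c' i - b * \<xi> i" for i
    have combw: "comb w i = comb c' i - b * comb \<xi> i" for i
      by (simp add: comb_def w_def algebra_simps sum_subtractf sum_distrib_left)
    have combc: "comb c i = a * comb \<xi> i" for i
      using a by (simp add: comb_def \<xi>_def sum_distrib_left)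
    have wne: "(\<Sum>r\<in>I. w r * w r) \<noteq> 0"
    proof
      assume "(\<Sum>r\<in>I. w r * w r) = 0"
      then have "\<forall>r\<in>I. w r * w r = 0" using I by (subst (asm) sum_nonneg_eq_0_iff) auto
      then have "comb w i = 0" for i by (simp add: comb_def)
      then have "\<forall>i\<in>J. (- b / a) * comb c i + 1 * comb c' i = 0" using combw combc a by simp
      then have "(1::real) = 0" using ind unfolding independent_pair_def by blast
      then show False by simp
    qed
    define e where "e = sqrt (\<Sum>r\<in>I. w r * w r)"
    have e: "e > 0" "e * e = (\<Sum>r\<in>I. w r * w r)"
      using wne sq_nonneg[of w] by (auto simp: e_def order_less_le)
    define \<eta> where "\<eta> i = (if i \<in> I then w i / e else 0)" for i
    have \<eta>\<eta>: "(\<Sum>r\<in>I. \<eta> r * \<eta> r) = 1"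
      using e by (simp add: \<eta>_def sum_divide_distrib[symmetric] flip: e(2))
    have "(\<Sum>r\<in>I. \<xi> r * w r) = b - b * (\<Sum>r\<in>I. \<xi> r * \<xi> r)"
    proof -
      have "(\<Sum>r\<in>I. \<xi> r * w r) = (\<Sum>r\<in>I. c' r * \<xi> r - b * (\<xi> r * \<xi> r))"
        by (simp add: w_def algebra_simps)
      then show ?thesis by (simp only: sum_subtractf sum_distrib_left[symmetric] b_def[symmetric])
    qed
    moreover have "(\<Sum>r\<in>I. \<xi> r * \<eta> r) = (\<Sum>r\<in>I. \<xi> r * w r) / e"
      by (simp add: \<eta>_def sum_divide_distrib)
    ultimately have \<xi>\<eta>: "(\<Sum>r\<in>I. \<xi> r * \<eta> r) = 0" using \<xi>\<xi> by simp
    have combe: "comb w i = e * comb \<eta> i" for i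
      using e by (simp add: comb_def \<eta>_def sum_distrib_left)
    have "(\<xi>, \<eta>) \<in> (A \<times> A) \<inter> C"
      using inA[of \<xi>] inA[of \<eta>] \<xi>\<xi> \<eta>\<eta> \<xi>\<eta> by (auto simp: C_def \<xi>_def \<eta>_def)
    from max'[OF this] have "sectional_curvature N p (comb \<xi>) (comb \<eta>) \<le> sectional_curvature N p (comb (fst z0)) (comb (snd z0))"
      by simp
    moreover have "comb c = (\<lambda>i. a * comb \<xi> i)" "comb c' = (\<lambda>i. b * comb \<xi> i + e * comb \<eta> i)"
      using combc combw combe by (auto simp: fun_eq_iff algebra_simps)
    then have "L = sectional_curvature N p (comb \<xi>) (comb \<eta>)"
      unfolding L using a(1) e(1)
      by (simp add: sectional_curvature_change_basis[OF d_def pd] ip \<xi>\<xi> \<eta>\<eta> \<xi>\<eta>)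
    ultimately show "L \<le> sectional_curvature N p (comb (fst z0)) (comb (snd z0))" by simp
  qed
  moreover have "comb (\<delta> r) = E r" if "r \<in> I" for r
    using that I by (simp add: comb_def \<delta>_def if_distrib[of "\<lambda>z. z * _"] cong: if_cong)
  ultimately show ?thesis
    using max'[OF \<open>(\<delta> r0, \<delta> q0) \<in> (A \<times> A) \<inter> C\<close>] rq by simp
qed

section \<open>Isometric immersions in fixed charts\<close>

lemma has_gradient_cong:
  assumes I: "finite I" and U: "openin (powertop_real I) U" and x: "x \<in> U"
    and eq: "\<And>y. y \<in> U \<Longrightarrow> f y = g y" and g: "has_gradient I g D x"
  shows "has_gradient I f D x"
  unfolding has_gradient_def
proof (intro allI impI)
  fix \<gamma> v t
  assume \<gamma>: "\<gamma> t = x" "\<forall>\<^sub>F s in nhds t. \<gamma> s \<in> extensional I"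
    "\<forall>i\<in>I. ((\<lambda>s. \<gamma> s i) has_real_derivative v i) (at t)"
  have "\<forall>\<^sub>F s in nhds t. \<gamma> s \<in> U"
    using \<gamma> x by (intro curve_eventually_in_open[OF I U]) auto
  then have "\<forall>\<^sub>F s in nhds t. f (\<gamma> s) = g (\<gamma> s)" by eventually_elim (rule eq)
  moreover have "((\<lambda>s. g (\<gamma> s)) has_real_derivative (\<Sum>i\<in>I. D i * v i)) (at t)"
    using has_gradientD[OF g \<gamma>(1,2)] \<gamma>(3) by blast
  ultimately show "((\<lambda>s. f (\<gamma> s)) has_real_derivative (\<Sum>i\<in>I. D i * v i)) (at t)"
    using DERIV_cong_ev[of t t "\<lambda>s. f (\<gamma> s)" "\<lambda>s. g (\<gamma> s)"] by auto
qed

text \<open>The topological facts about a chart on which locality arguments rest, in a form that can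
  be checked factor by factor for product charts.\<close>

definition coordinate_chart :: "('a, 'c, 'i) riem_manifold \<Rightarrow> 'c \<Rightarrow> bool"
  where "coordinate_chart M c \<longleftrightarrow>
    finite (cindex M) \<and> openin (powertop_real (cindex M)) (cmap M c ` cdom M c) \<and>
    inj_on (cmap M c) (cdom M c) \<and> openin (mtop M) (cdom M c) \<and>
    continuous_map (subtopology (powertop_real (cindex M)) (cmap M c ` cdom M c)) (mtop M) (cinv M c)"

lemma coordinate_chart_cinv:
  assumes "coordinate_chart M c"
  shows "p \<in> cdom M c \<Longrightarrow> cinv M c (cmap M c p) = p"
    and "x \<in> cmap M c ` cdom M c \<Longrightarrow> cmap M c (cinv M c x) = x"
    and "x \<in> cmap M c ` cdom M c \<Longrightarrow> cinv M c x \<in> cdom M c"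
    and "p \<in> cdom M c \<Longrightarrow> cmap M c p \<in> extensional (cindex M)"
  using assms openin_powertop_real_extensional[of "cindex M" "cmap M c ` cdom M c"]
  by (auto simp: coordinate_chart_def cinv_def f_inv_into_f inv_into_into)

lemma coordinate_chart_preimage_open:
  assumes c: "coordinate_chart M c" and "openin (mtop M) O'"
  shows "openin (powertop_real (cindex M)) {x \<in> cmap M c ` cdom M c. cinv M c x \<in> O'}"
proof -
  let ?W = "cmap M c ` cdom M c"
  have W: "openin (powertop_real (cindex M)) ?W"
    and co: "continuous_map (subtopology (powertop_real (cindex M)) ?W) (mtop M) (cinv M c)"
    using c by (auto simp: coordinate_chart_def)
  have "openin (subtopology (powertop_real (cindex M)) ?W)
      {x \<in> topspace (subtopology (powertop_real (cindex M)) ?W). cinv M c x \<in> O'}"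
    by (rule openin_continuous_map_preimage[OF co assms(2)])
  moreover have "topspace (subtopology (powertop_real (cindex M)) ?W) = ?W"
    using openin_subset[OF W] by auto
  ultimately have "openin (powertop_real (cindex M)) {x \<in> topspace (subtopology (powertop_real (cindex M)) ?W). cinv M c x \<in> O'}"
    using W openin_open_subtopology by blast
  then show ?thesis
    unfolding \<open>topspace (subtopology (powertop_real (cindex M)) ?W) = ?W\<close> .
qed

lemma (in riemannian_chart) coordinate_chart: "coordinate_chart N d"
proof -
  obtain g where g: "homeomorphic_maps (subtopology (mtop N) (cdom N d)) (subtopology (powertop_real J) V) (cmap N d) g"
    using homeo homeomorphic_map_maps by blast
  have top: "topspace (subtopology (mtop N) (cdom N d)) = cdom N d" "topspace (subtopology (powertop_real J) V) = V"
    using openin_subset[OF open_cdom] openin_subset[OF open_V] by auto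
  have cont: "continuous_map (subtopology (powertop_real J) V) (mtop N) g"
    using g by (auto simp: homeomorphic_maps_def continuous_map_in_subtopology)
  have g_eq: "g y = cinv N d y" if y: "y \<in> V" for y
  proof -
    obtain p where p: "p \<in> cdom N d" "y = cmap N d p" using y by blast
    then have "g (cmap N d p) = p" using g top by (simp add: homeomorphic_maps_def)
    then show ?thesis using p cinv_cmap by simp
  qed
  have "continuous_map (subtopology (powertop_real J) V) (mtop N) (cinv N d)"
    by (rule continuous_map_eq[OF cont]) (simp only: top g_eq)
  then show ?thesis
    using finite_J open_V inj_cmap open_cdom unfolding coordinate_chart_def by (intro conjI)
qed

text \<open>
  The part of being a Riemannian manifold that the change of charts needs. For warped products it is
  easier to verify than the smoothness of the metric.
\<close>

definition c1_manifold :: "('a, 'c, 'i) riem_manifold \<Rightarrow> bool"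
  where "c1_manifold M \<longleftrightarrow>
    (\<Union>c\<in>charts M. cdom M c) = points M \<and>
    (\<forall>c\<in>charts M. coordinate_chart M c) \<and>
    (\<forall>c\<in>charts M. \<forall>d\<in>charts M. \<forall>p\<in>cdom M c \<inter> cdom M d.
       (\<forall>m\<in>cindex M. has_gradient (cindex M) (transition M c d m)
          (\<lambda>i. pderivative i (transition M c d m) (cmap M c p)) (cmap M c p)) \<and>
       (\<forall>i\<in>cindex M. \<forall>j\<in>cindex M.
         gram M c p i j =
         inner_of (cindex M) (gram M d p)
           (\<lambda>k. pderivative i (transition M c d k) (cmap M c p))
           (\<lambda>k. pderivative j (transition M c d k) (cmap M c p))))"

lemma open_chart_overlap:
  assumes N: "riemannian_manifold N" and cd: "c \<in> charts N" "d \<in> charts N"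
  shows "openin (powertop_real (cindex N)) (cmap N c ` (cdom N c \<inter> cdom N d))"
proof -
  interpret c: riemannian_chart N c using N cd by unfold_locales
  interpret d: riemannian_chart N d using N cd by unfold_locales
  have "cmap N c ` (cdom N c \<inter> cdom N d) = {x \<in> cmap N c ` cdom N c. cinv N c x \<in> cdom N d}"
    using c.cinv_cmap by auto
  then show ?thesis
    using coordinate_chart_preimage_open[OF c.coordinate_chart d.open_cdom] by simp
qed

lemma riemannian_manifold_c1:
  assumes N: "riemannian_manifold N"
  shows "c1_manifold N"
  unfolding c1_manifold_def
proof (intro conjI ballI)
  show "(\<Union>c\<in>charts N. cdom N c) = points N"
    using N by (simp add: riemannian_manifold_def topological_manifold_def)
  show "coordinate_chart N c" if "c \<in> charts N" for c
    using riemannian_chart.coordinate_chart[OF riemannian_chart.intro[OF N that]] .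
  fix c d p assume cd: "c \<in> charts N" "d \<in> charts N" "p \<in> cdom N c \<inter> cdom N d"
  show "has_gradient (cindex N) (transition N c d m)
      (\<lambda>i. pderivative i (transition N c d m) (cmap N c p)) (cmap N c p)" if "m \<in> cindex N" for m
  proof (rule smooth_on_has_gradient[OF _ open_chart_overlap[OF N cd(1,2)]])
    show "finite (cindex N)" using N by (simp add: riemannian_manifold_def topological_manifold_def)
    show "smooth_on (cindex N) (cmap N c ` (cdom N c \<inter> cdom N d)) (transition N c d m)"
      using N cd that unfolding riemannian_manifold_def smooth_atlas_def by blast
  qed (use cd in blast)
  show "gram N c p i j = inner_of (cindex N) (gram N d p)
           (\<lambda>k. pderivative i (transition N c d k) (cmap N c p))
           (\<lambda>k. pderivative j (transition N c d k) (cmap N c p))"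
    if "i \<in> cindex N" "j \<in> cindex N" for i j
    using N cd that unfolding riemannian_manifold_def riemannian_metric_def by blast
qed

text \<open>
  Being isometric is defined through the charts chosen at each point; two applications of the chain
  rule and the transformation laws of both metrics carry it over to fixed charts.
\<close>

lemma isometric_in_charts:
  assumes M: "c1_manifold M" and N: "riemannian_manifold N" and f: "isometric_immersion M N f"
    and c: "c \<in> charts M" and d: "d \<in> charts N" and q: "q \<in> cdom M c" "f q \<in> cdom N d"
    and ij: "i \<in> cindex M" "j \<in> cindex M"
  shows "inner_of (cindex N) (gram N d (f q)) (\<lambda>\<alpha>. pderivative i (local_rep M N f c d \<alpha>) (cmap M c q))
      (\<lambda>\<alpha>. pderivative j (local_rep M N f c d \<alpha>) (cmap M c q)) = gram M c q i j"
proof -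
  let ?I = "cindex M" and ?J = "cindex N"
  have N1: "c1_manifold N" by (rule riemannian_manifold_c1[OF N])
  have qM: "q \<in> points M" using M c q by (auto simp: c1_manifold_def)
  have fc: "continuous_map (mtop M) (mtop N) f" using f by (simp add: isometric_immersion_def smooth_map_def)
  have fqN: "f q \<in> points N" using fc qM by (auto simp: continuous_map_def)
  define c' where "c' = chart_at M q"
  define d' where "d' = chart_at N (f q)"
  have c': "c' \<in> charts M" "q \<in> cdom M c'" using chart_at[of M q] M qM by (auto simp: c'_def c1_manifold_def)
  have d': "d' \<in> charts N" "f q \<in> cdom N d'" using chart_at[of N "f q"] N1 fqN by (auto simp: d'_def c1_manifold_def)
  have cc: "coordinate_chart M c" "coordinate_chart M c'" "coordinate_chart N d" "coordinate_chart N d'"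
    using M N1 c c' d d' by (auto simp: c1_manifold_def)
  have fin: "finite ?I" "finite ?J" using cc by (auto simp: coordinate_chart_def)
  define x where "x = cmap M c q"
  define x' where "x' = cmap M c' q"
  define TM where "TM i = (\<lambda>m. pderivative i (transition M c c' m) x)" for i
  define TN where "TN \<beta> = (\<lambda>\<alpha>. pderivative \<beta> (transition N d' d \<alpha>) (cmap N d' (f q)))" for \<beta>
  \<comment> \<open>The points at which the given charts can be compared with the chosen ones, in
    source and target at once.\<close>
  define O1 where "O1 = cdom M c' \<inter> {p \<in> topspace (mtop M). f p \<in> cdom N d \<inter> cdom N d'}"
  have "openin (mtop M) O1"
    unfolding O1_def using cc
    by (intro openin_Int openin_continuous_map_preimage[OF fc]) (auto simp: coordinate_chart_def)
  then have U: "openin (powertop_real ?I) {y \<in> cmap M c ` cdom M c. cinv M c y \<in> O1}" (is "openin _ ?U")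
    by (rule coordinate_chart_preimage_open[OF cc(1)])
  have xU: "x \<in> ?U"
    using q c' d' qM coordinate_chart_cinv(1)[OF cc(1) q(1)] by (auto simp: x_def O1_def)
  define U' where "U' = cmap M c' ` (cdom M c' \<inter> f -` cdom N d')"
  have "openin (mtop M) {p \<in> topspace (mtop M). f p \<in> cdom N d'}"
    using cc by (intro openin_continuous_map_preimage[OF fc]) (auto simp: coordinate_chart_def)
  from coordinate_chart_preimage_open[OF cc(2) this]
  have U': "openin (powertop_real ?I) U'"
  proof (rule back_subst[of "openin (powertop_real ?I)"])
    have "p \<in> topspace (mtop M)" if "p \<in> cdom M c'" for p
      using that cc(2) openin_subset by (auto simp: coordinate_chart_def)
    then show "{x \<in> cmap M c' ` cdom M c'. cinv M c' x \<in> {p \<in> topspace (mtop M). f p \<in> cdom N d'}} = U'"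
      using coordinate_chart_cinv(1)[OF cc(2)] by (auto simp: U'_def)
  qed
  have sm: "smooth_on ?I U' (local_rep M N f c' d' \<beta>)" if "\<beta> \<in> ?J" for \<beta>
    using f c' d' that unfolding isometric_immersion_def smooth_map_def U'_def by blast
  have x'U': "x' \<in> U'" using c' d' by (auto simp: x'_def U'_def)
  have coords: "coords_at M q = x'" by (simp add: coords_at_def x'_def c'_def)
  have dF: "differential M N f q v \<beta> = (\<Sum>m\<in>?I. pderivative m (local_rep M N f c' d' \<beta>) x' * v m)" for v \<beta>
    by (simp add: differential_def coords c'_def d'_def)
  \<comment> \<open>The chain rule along a coordinate line of \<open>c\<close>: \<open>y1\<close> is
    that line read in \<open>c'\<close>, \<open>y2\<close> its image read in \<open>d'\<close>, and
    the last transition leads from \<open>d'\<close> to \<open>d\<close>. The differential, defined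
    through the chosen charts, appears in the middle.\<close>
  have key: "pderivative i (local_rep M N f c d \<alpha>) x = (\<Sum>\<beta>\<in>?J. TN \<beta> \<alpha> * differential M N f q (TM i) \<beta>)"
    if i: "i \<in> ?I" and \<alpha>: "\<alpha> \<in> ?J" for i \<alpha>
  proof -
    define \<gamma> where "\<gamma> s = x(i := s)" for s
    define y1 where "y1 s = cmap M c' (cinv M c (\<gamma> s))" for s
    define y2 where "y2 s = cmap N d' (f (cinv M c' (y1 s)))" for s
    have \<gamma>U: "\<forall>\<^sub>F s in nhds (x i). \<gamma> s \<in> ?U"
      unfolding \<gamma>_def by (rule line_eventually_in_open[OF fin(1) U xU i])
    have at0: "\<gamma> (x i) = x" "y1 (x i) = x'" "y2 (x i) = cmap N d' (f q)"
      using coordinate_chart_cinv(1)[OF cc(1) q(1)] coordinate_chart_cinv(1)[OF cc(2) c'(2)]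
      by (auto simp: \<gamma>_def y1_def y2_def x_def x'_def)
    have \<gamma>e: "\<forall>\<^sub>F s in nhds (x i). \<gamma> s \<in> extensional ?I"
      using \<gamma>U by eventually_elim (use openin_powertop_real_extensional[OF U] in blast)
    have D1: "((\<lambda>s. y1 s m) has_real_derivative TM i m) (at (x i))" if m: "m \<in> ?I" for m
    proof -
      have g: "has_gradient ?I (transition M c c' m) (\<lambda>i. pderivative i (transition M c c' m) x) x"
        using M c c' q m unfolding c1_manifold_def x_def by blast
      have "((\<lambda>s. transition M c c' m (\<gamma> s)) has_real_derivative
          (\<Sum>j\<in>?I. pderivative j (transition M c c' m) x * (if j = i then 1 else 0))) (at (x i))"
        using g at0(1) \<gamma>e by (rule has_gradientD) (auto simp: \<gamma>_def)
      moreover have "(\<Sum>j\<in>?I. pderivative j (transition M c c' m) x * (if j = i then 1 else 0)) = TM i m"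
        using fin i by (simp add: TM_def if_distrib[of "\<lambda>z. _ * z"] cong: if_cong)
      ultimately show ?thesis by (simp add: y1_def transition_def)
    qed
    have y1e: "\<forall>\<^sub>F s in nhds (x i). y1 s \<in> extensional ?I"
      using \<gamma>U by eventually_elim (use coordinate_chart_cinv(4)[OF cc(2)] in \<open>auto simp: y1_def O1_def\<close>)
    have D2: "((\<lambda>s. y2 s \<beta>) has_real_derivative differential M N f q (TM i) \<beta>) (at (x i))" if b: "\<beta> \<in> ?J" for \<beta>
    proof -
      have "((\<lambda>s. local_rep M N f c' d' \<beta> (y1 s)) has_real_derivative
          (\<Sum>m\<in>?I. pderivative m (local_rep M N f c' d' \<beta>) x' * TM i m)) (at (x i))"
        by (rule has_gradientD[OF smooth_on_has_gradient[OF fin(1) U' sm[OF b] x'U'] at0(2) y1e D1])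
      then show ?thesis by (simp add: dF y2_def local_rep_def)
    qed
    have y2y: "\<forall>\<^sub>F s in nhds (x i). y2 s = cmap N d' (f (cinv M c (\<gamma> s)))"
      using \<gamma>U by eventually_elim
        (use coordinate_chart_cinv(1)[OF cc(2)] in \<open>auto simp: y1_def y2_def O1_def\<close>)
    have y2e: "\<forall>\<^sub>F s in nhds (x i). y2 s \<in> extensional ?J"
      using \<gamma>U y2y by eventually_elim (use coordinate_chart_cinv(4)[OF cc(4)] in \<open>auto simp: O1_def\<close>)
    have gN: "has_gradient ?J (transition N d' d \<alpha>) (\<lambda>\<beta>. TN \<beta> \<alpha>) (cmap N d' (f q))"
      using N1 d d' q \<alpha> unfolding c1_manifold_def TN_def by blast
    have D3: "((\<lambda>s. transition N d' d \<alpha> (y2 s)) has_real_derivative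
        (\<Sum>\<beta>\<in>?J. TN \<beta> \<alpha> * differential M N f q (TM i) \<beta>)) (at (x i))"
      using has_gradientD[OF gN at0(3) y2e] D2 by blast
    have ev: "\<forall>\<^sub>F s in nhds (x i). transition N d' d \<alpha> (y2 s) = local_rep M N f c d \<alpha> (\<gamma> s)"
      using \<gamma>U y2y by eventually_elim
        (use coordinate_chart_cinv(1)[OF cc(4)] in \<open>auto simp: transition_def local_rep_def O1_def\<close>)
    have "((\<lambda>s. local_rep M N f c d \<alpha> (\<gamma> s)) has_real_derivative
        (\<Sum>\<beta>\<in>?J. TN \<beta> \<alpha> * differential M N f q (TM i) \<beta>)) (at (x i))"
      using D3 DERIV_cong_ev[OF refl ev refl] by simp
    then show ?thesis unfolding pderivative_def \<gamma>_def by (rule DERIV_imp_deriv)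
  qed
  \<comment> \<open>The transformation law of the target metric, extended bilinearly from coordinate
    vectors.\<close>
  have pull: "inner_of ?J (gram N d (f q)) (\<lambda>\<alpha>. \<Sum>\<beta>\<in>?J. TN \<beta> \<alpha> * A \<beta>) (\<lambda>\<alpha>. \<Sum>\<beta>\<in>?J. TN \<beta> \<alpha> * B \<beta>)
      = inner_of ?J (gram N d' (f q)) A B" for A B
  proof -
    have g: "gram N d' (f q) \<beta> \<beta>' = inner_of ?J (gram N d (f q)) (TN \<beta>) (TN \<beta>')"
      if "\<beta> \<in> ?J" "\<beta>' \<in> ?J" for \<beta> \<beta>'
      using N1 d d' q that unfolding c1_manifold_def TN_def by blast
    have "inner_of ?J (gram N d (f q)) (\<lambda>\<alpha>. \<Sum>\<beta>\<in>?J. A \<beta> * TN \<beta> \<alpha>) (\<lambda>\<alpha>. \<Sum>\<beta>\<in>?J. B \<beta> * TN \<beta> \<alpha>)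
      = (\<Sum>\<beta>\<in>?J. A \<beta> * (\<Sum>\<beta>'\<in>?J. B \<beta>' * inner_of ?J (gram N d (f q)) (TN \<beta>) (TN \<beta>')))"
      unfolding inner_of_sum_left inner_of_scale_left inner_of_sum_right inner_of_scale_right by simp
    also have "\<dots> = inner_of ?J (gram N d' (f q)) A B"
      unfolding inner_of_def[of _ "gram N d' (f q)"] by (simp add: g sum_distrib_left mult_ac)
    finally show ?thesis by (simp add: mult.commute)
  qed
  have "inner_of ?J (gram N d (f q)) (\<lambda>\<alpha>. pderivative i (local_rep M N f c d \<alpha>) x)
      (\<lambda>\<alpha>. pderivative j (local_rep M N f c d \<alpha>) x)
    = inner_of ?J (gram N d (f q)) (\<lambda>\<alpha>. \<Sum>\<beta>\<in>?J. TN \<beta> \<alpha> * differential M N f q (TM i) \<beta>)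
      (\<lambda>\<alpha>. \<Sum>\<beta>\<in>?J. TN \<beta> \<alpha> * differential M N f q (TM j) \<beta>)"
    using key ij by (intro inner_of_cong) auto
  also have "\<dots> = inner_at N (f q) (differential M N f q (TM i)) (differential M N f q (TM j))"
    unfolding pull by (simp add: inner_at_def gram_at_def d'_def)
  also have "\<dots> = inner_at M q (TM i) (TM j)"
    using f qM by (simp add: isometric_immersion_def)
  also have "\<dots> = inner_of ?I (gram M c' q) (TM i) (TM j)"
    by (simp add: inner_at_def gram_at_def c'_def)
  also have "\<dots> = gram M c q i j"
    using M c c' q ij unfolding c1_manifold_def TM_def x_def by (metis IntI)
  finally show ?thesis by (simp add: x_def)
qed

section \<open>Warped products\<close>

locale warped_product =
  fixes k :: nat and F :: "nat \<Rightarrow> ('a, 'c, 'i) riem_manifold" and u :: "nat \<Rightarrow> 'a \<Rightarrow> real"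
  assumes k: "1 \<le> k"
    and riem: "\<And>i. i \<in> {1..k} \<Longrightarrow> riemannian_manifold (F i)"
    and smooth_u: "\<And>i. i \<in> {2..k} \<Longrightarrow> smooth_function (F 1) (u i)"
    and u_pos: "\<And>i q. i \<in> {2..k} \<Longrightarrow> q \<in> points (F 1) \<Longrightarrow> u i q > 0"
begin

abbreviation M where "M \<equiv> multiply_warped_product k F u"
abbreviation I where "I \<equiv> Sigma {1..k} (\<lambda>i. cindex (F i))"

lemma M_simps:
  "mtop M = product_topology (\<lambda>i. mtop (F i)) {1..k}"
  "cindex M = I"
  "charts M = PiE {1..k} (\<lambda>i. charts (F i))"
  "cdom M = (\<lambda>c. PiE {1..k} (\<lambda>i. cdom (F i) (c i)))"
  "cmap M = (\<lambda>c p. restrict (\<lambda>(i, a). cmap (F i) (c i) (p i) a) I)"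
  "points M = PiE {1..k} (\<lambda>i. points (F i))"
  by (simp_all add: multiply_warped_product_def)

definition scale :: "nat \<Rightarrow> (nat \<Rightarrow> 'a) \<Rightarrow> real"
  where "scale i p = (if i = 1 then 1 else (u i (p 1))\<^sup>2)"

lemma gram_M: "gram M c p (i, a) (j, b) = (if i = j then scale i p * gram (F i) (c i) (p i) a b else 0)"
  by (simp add: multiply_warped_product_def scale_def)

definition slice :: "nat \<Rightarrow> (nat \<times> 'i \<Rightarrow> real) \<Rightarrow> 'i \<Rightarrow> real"
  where "slice i x = restrict (\<lambda>a. x (i, a)) (cindex (F i))"

lemma factor_chart:
  assumes "c \<in> charts M" "i \<in> {1..k}"
  shows "riemannian_chart (F i) (c i)"
  using assms riem by (auto simp: riemannian_chart_def M_simps)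

lemma finite_I: "finite I"
proof (rule finite_SigmaI)
  fix i assume "i \<in> {1..k}"
  then show "finite (cindex (F i))"
    using riem by (auto simp: riemannian_manifold_def topological_manifold_def)
qed simp

lemma slice_cmap:
  assumes c: "c \<in> charts M" and p: "p \<in> cdom M c" and i: "i \<in> {1..k}"
  shows "slice i (cmap M c p) = cmap (F i) (c i) (p i)"
proof -
  interpret riemannian_chart "F i" "c i" by (rule factor_chart[OF c i])
  have "p i \<in> cdom (F i) (c i)" using p i by (auto simp: M_simps)
  then have "cmap (F i) (c i) (p i) \<in> extensional (cindex (F i))" using V_ext by blast
  then show ?thesis using i by (auto simp: slice_def M_simps fun_eq_iff extensional_def)
qed

lemma cmap_of_slices:
  assumes c: "c \<in> charts M" and x: "x \<in> extensional I"
    and s: "\<forall>i\<in>{1..k}. slice i x \<in> cmap (F i) (c i) ` cdom (F i) (c i)"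
  defines "p \<equiv> (\<lambda>i\<in>{1..k}. cinv (F i) (c i) (slice i x))"
  shows "p \<in> cdom M c" "cmap M c p = x"
proof -
  have cd: "cinv (F i) (c i) (slice i x) \<in> cdom (F i) (c i)"
    "cmap (F i) (c i) (cinv (F i) (c i) (slice i x)) = slice i x" if i: "i \<in> {1..k}" for i
    using riemannian_chart.cinv_cdom[OF factor_chart[OF c i] bspec[OF s i]]
      riemannian_chart.cmap_cinv[OF factor_chart[OF c i] bspec[OF s i]] by auto
  show "p \<in> cdom M c" unfolding p_def M_simps using cd(1) by auto
  show "cmap M c p = x"
  proof
    fix m
    show "cmap M c p m = x m"
    proof (cases "m \<in> I")
      case True
      then obtain i a where m: "m = (i, a)" "i \<in> {1..k}" "a \<in> cindex (F i)" by auto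
      then have "cmap M c p m = cmap (F i) (c i) (p i) a" by (simp add: M_simps)
      also have "\<dots> = slice i x a" using m cd(2)[OF m(2)] by (simp add: p_def)
      finally show ?thesis using m by (simp add: slice_def)
    next
      case False
      then show ?thesis by (simp add: M_simps extensional_arb[OF x False])
    qed
  qed
qed

lemma cmap_image:
  assumes c: "c \<in> charts M"
  shows "cmap M c ` cdom M c =
    {x \<in> extensional I. \<forall>i\<in>{1..k}. slice i x \<in> cmap (F i) (c i) ` cdom (F i) (c i)}" (is "?W = ?R")
proof
  show "?W \<subseteq> ?R"
  proof
    fix x assume "x \<in> ?W"
    then obtain p where p: "p \<in> cdom M c" "x = cmap M c p" by blast
    have "slice i x \<in> cmap (F i) (c i) ` cdom (F i) (c i)" if "i \<in> {1..k}" for i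
      unfolding p(2) slice_cmap[OF c p(1) that] using p(1) that by (auto simp: M_simps)
    then show "x \<in> ?R" using p(2) by (simp add: M_simps)
  qed
  show "?R \<subseteq> ?W"
  proof
    fix x assume "x \<in> ?R"
    then have "x \<in> extensional I" "\<forall>i\<in>{1..k}. slice i x \<in> cmap (F i) (c i) ` cdom (F i) (c i)"
      by simp_all
    note p = cmap_of_slices[OF c this]
    show "x \<in> ?W" using imageI[OF p(1), of "cmap M c"] unfolding p(2) .
  qed
qed

lemma inj_cmap_M:
  assumes c: "c \<in> charts M"
  shows "inj_on (cmap M c) (cdom M c)"
proof (rule inj_onI)
  fix p q assume pq: "p \<in> cdom M c" "q \<in> cdom M c" "cmap M c p = cmap M c q"
  have "p i = q i" if i: "i \<in> {1..k}" for i
  proof -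
    have "p i \<in> cdom (F i) (c i)" "q i \<in> cdom (F i) (c i)" using pq i by (auto simp: M_simps)
    moreover have "cmap (F i) (c i) (p i) = cmap (F i) (c i) (q i)"
      using slice_cmap[OF c pq(1) i] slice_cmap[OF c pq(2) i] pq(3) by simp
    ultimately show ?thesis using riemannian_chart.inj_cmap[OF factor_chart[OF c i]] by (simp add: inj_on_def)
  qed
  moreover have "p \<in> extensional {1..k}" "q \<in> extensional {1..k}" using pq by (auto simp: M_simps PiE_def)
  ultimately show "p = q" by (auto intro: extensionalityI)
qed

lemma cinv_M:
  assumes c: "c \<in> charts M" and x: "x \<in> cmap M c ` cdom M c"
  shows "cinv M c x = (\<lambda>i\<in>{1..k}. cinv (F i) (c i) (slice i x))"
proof -
  have "x \<in> extensional I" "\<forall>i\<in>{1..k}. slice i x \<in> cmap (F i) (c i) ` cdom (F i) (c i)"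
    using x unfolding cmap_image[OF c] by auto
  note p = cmap_of_slices[OF c this]
  show ?thesis
    unfolding cinv_def[of M] using p inj_cmap_M[OF c] by (intro inv_into_f_eq)
qed

lemma continuous_slice:
  "i \<in> {1..k} \<Longrightarrow> continuous_map (powertop_real I) (powertop_real (cindex (F i))) (slice i)"
  unfolding continuous_map_componentwise
  by (auto simp: slice_def intro!: continuous_map_product_projection)

text \<open>Everything splits into slices: the image is a finite intersection of preimages of the
  factors' chart images, and continuity of the inverse is checked in each factor.\<close>

lemma coordinate_chart_M:
  assumes c: "c \<in> charts M"
  shows "coordinate_chart M c"
proof -
  let ?W = "cmap M c ` cdom M c"
  have W: "openin (powertop_real I) ?W"
  proof -
    have "openin (powertop_real I) {x \<in> topspace (powertop_real I). slice i x \<in> cmap (F i) (c i) ` cdom (F i) (c i)}"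
      if "i \<in> {1..k}" for i
      by (rule openin_continuous_map_preimage[OF continuous_slice[OF that] riemannian_chart.open_V[OF factor_chart[OF c that]]])
    then have "openin (powertop_real I)
        (\<Inter>i\<in>{1..k}. {x \<in> topspace (powertop_real I). slice i x \<in> cmap (F i) (c i) ` cdom (F i) (c i)})"
      using k by (intro openin_INT2) auto
    moreover have "(\<Inter>i\<in>{1..k}. {x \<in> topspace (powertop_real I). slice i x \<in> cmap (F i) (c i) ` cdom (F i) (c i)}) = ?W"
      unfolding cmap_image[OF c] using k by (auto simp: PiE_def)
    ultimately show ?thesis by simp
  qed
  have op: "openin (mtop M) (cdom M c)"
    unfolding M_simps using riemannian_chart.open_cdom[OF factor_chart[OF c]]
    by (subst openin_PiE) auto
  have "continuous_map (subtopology (powertop_real I) ?W) (mtop M) (cinv M c)"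
  proof -
    have top: "topspace (subtopology (powertop_real I) ?W) = ?W"
      using openin_subset[OF W] by auto
    have "continuous_map (subtopology (powertop_real I) ?W) (mtop (F i)) (\<lambda>x. cinv M c x i)" if i: "i \<in> {1..k}" for i
    proof (rule continuous_map_eq)
      have "continuous_map (subtopology (powertop_real I) ?W)
          (subtopology (powertop_real (cindex (F i))) (cmap (F i) (c i) ` cdom (F i) (c i))) (slice i)"
        using continuous_map_from_subtopology[OF continuous_slice[OF i]] i top
        by (auto simp: continuous_map_in_subtopology cmap_image[OF c])
      moreover have "continuous_map (subtopology (powertop_real (cindex (F i))) (cmap (F i) (c i) ` cdom (F i) (c i)))
          (mtop (F i)) (cinv (F i) (c i))"
        using riemannian_chart.coordinate_chart[OF factor_chart[OF c i]] by (simp add: coordinate_chart_def)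
      ultimately show "continuous_map (subtopology (powertop_real I) ?W) (mtop (F i)) (cinv (F i) (c i) \<circ> slice i)"
        by (rule continuous_map_compose)
      show "(cinv (F i) (c i) \<circ> slice i) x = cinv M c x i"
        if "x \<in> topspace (subtopology (powertop_real I) ?W)" for x
        using that i unfolding top by (simp add: cinv_M[OF c])
    qed
    moreover have "cinv M c x \<in> extensional {1..k}" if "x \<in> ?W" for x
      using cinv_M[OF c that] by simp
    ultimately show ?thesis
      unfolding M_simps(1) continuous_map_componentwise top by blast
  qed
  then show ?thesis
    unfolding coordinate_chart_def M_simps(2) using finite_I W inj_cmap_M[OF c] op by (intro conjI)
qed

lemma has_gradient_slice:
  assumes j: "j \<in> {1..k}" and h: "has_gradient (cindex (F j)) h D (slice j x)"
  shows "has_gradient I (\<lambda>y. h (slice j y)) (\<lambda>(i, a). if i = j then D a else 0) x"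
  unfolding has_gradient_def
proof (intro allI impI)
  fix \<gamma> v t
  assume \<gamma>: "\<gamma> t = x" "\<forall>i\<in>I. ((\<lambda>s. \<gamma> s i) has_real_derivative v i) (at t)"
  have "((\<lambda>s. h (slice j (\<gamma> s))) has_real_derivative (\<Sum>a\<in>cindex (F j). D a * v (j, a))) (at t)"
  proof (rule has_gradientD[OF h])
    show "((\<lambda>s. slice j (\<gamma> s) a) has_real_derivative v (j, a)) (at t)" if "a \<in> cindex (F j)" for a
      using \<gamma>(2) j that by (auto simp: slice_def)
  qed (use \<gamma>(1) in \<open>auto simp: slice_def\<close>)
  moreover have "(\<Sum>i\<in>I. (case i of (i, a) \<Rightarrow> if i = j then D a else 0) * v i) = (\<Sum>a\<in>cindex (F j). D a * v (j, a))"
  proof -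
    have "(\<Sum>i\<in>I. (case i of (i, a) \<Rightarrow> if i = j then D a else 0) * v i)
      = (\<Sum>i\<in>{1..k}. \<Sum>a\<in>cindex (F i). (if i = j then D a else 0) * v (i, a))"
      using riem by (subst sum.Sigma) (auto simp: riemannian_manifold_def topological_manifold_def intro!: sum.cong)
    also have "\<dots> = (\<Sum>i\<in>{1..k}. if i = j then (\<Sum>a\<in>cindex (F j). D a * v (j, a)) else 0)"
      by (intro sum.cong) auto
    finally show ?thesis using j by simp
  qed
  ultimately show "((\<lambda>s. h (slice j (\<gamma> s))) has_real_derivative
      (\<Sum>i\<in>I. (case i of (i, a) \<Rightarrow> if i = j then D a else 0) * v i)) (at t)" by simp
qed

lemma inner_of_gram_M:
  "inner_of I (gram M c p) v w = (\<Sum>i\<in>{1..k}. scale i p *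
    inner_of (cindex (F i)) (gram (F i) (c i) (p i)) (\<lambda>a. v (i, a)) (\<lambda>a. w (i, a)))"
proof -
  have fin: "\<And>i. i \<in> {1..k} \<Longrightarrow> finite (cindex (F i))"
    using riem by (auto simp: riemannian_manifold_def topological_manifold_def)
  have "inner_of I (gram M c p) v w
    = (\<Sum>i\<in>{1..k}. \<Sum>a\<in>cindex (F i). \<Sum>j\<in>{1..k}. \<Sum>b\<in>cindex (F j). gram M c p (i, a) (j, b) * v (i, a) * w (j, b))"
    unfolding inner_of_def using fin by (simp add: sum.Sigma split_def)
  also have "\<dots> = (\<Sum>i\<in>{1..k}. \<Sum>a\<in>cindex (F i). \<Sum>j\<in>{1..k}. if j = i then
      (\<Sum>b\<in>cindex (F i). gram M c p (i, a) (i, b) * v (i, a) * w (i, b)) else 0)"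
    by (intro sum.cong refl) (auto simp: gram_M intro!: sum.neutral)
  also have "\<dots> = (\<Sum>i\<in>{1..k}. scale i p *
      inner_of (cindex (F i)) (gram (F i) (c i) (p i)) (\<lambda>a. v (i, a)) (\<lambda>a. w (i, a)))"
    by (intro sum.cong refl) (simp add: gram_M inner_of_def sum_distrib_left mult_ac)
  finally show ?thesis .
qed

lemma cdom_points: "c \<in> charts M \<Longrightarrow> p \<in> cdom M c \<Longrightarrow> p \<in> points M"
  using coordinate_chart_M openin_subset unfolding coordinate_chart_def by blast

lemma scale_pos: "i \<in> {1..k} \<Longrightarrow> p \<in> points M \<Longrightarrow> scale i p > 0"
  using u_pos[of i "p 1"] k by (auto simp: scale_def M_simps PiE_iff)

text \<open>The Jacobian of a product transition is block diagonal, and each block obeys the tensor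
  law of its factor. The warping factor \<open>scale\<close> depends on the point and not on the
  chart, so it passes through the law unchanged.\<close>

lemma c1_manifold_M: "c1_manifold M"
  unfolding c1_manifold_def
proof (intro conjI ballI)
  show "(\<Union>c\<in>charts M. cdom M c) = points M"
  proof
    show "(\<Union>c\<in>charts M. cdom M c) \<subseteq> points M" using cdom_points by blast
    show "points M \<subseteq> (\<Union>c\<in>charts M. cdom M c)"
    proof
      fix p assume p: "p \<in> points M"
      have "\<exists>c. c \<in> charts (F i) \<and> p i \<in> cdom (F i) c" if i: "i \<in> {1..k}" for i
      proof -
        have "p i \<in> points (F i)" using p i by (auto simp: M_simps)
        then show ?thesis
          using riem[OF i] unfolding riemannian_manifold_def topological_manifold_def by blast
      qed
      then obtain c where c: "\<And>i. i \<in> {1..k} \<Longrightarrow> c i \<in> charts (F i) \<and> p i \<in> cdom (F i) (c i)" by metis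
      have "restrict c {1..k} \<in> charts M" "p \<in> cdom M (restrict c {1..k})"
        using c p by (auto simp: M_simps PiE_iff)
      then show "p \<in> (\<Union>c\<in>charts M. cdom M c)" by blast
    qed
  qed
  show "coordinate_chart M c" if "c \<in> charts M" for c by (rule coordinate_chart_M[OF that])
  fix c d p assume cd: "c \<in> charts M" "d \<in> charts M" "p \<in> cdom M c \<inter> cdom M d"
  let ?x = "cmap M c p"
  have cdi: "c i \<in> charts (F i)" "d i \<in> charts (F i)" "p i \<in> cdom (F i) (c i) \<inter> cdom (F i) (d i)"
    if "i \<in> {1..k}" for i using cd that by (auto simp: M_simps)
  have c1: "c1_manifold (F i)" if "i \<in> {1..k}" for i using riemannian_manifold_c1 riem that by blast
  have sl: "slice i ?x = cmap (F i) (c i) (p i)" if "i \<in> {1..k}" for i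
    using slice_cmap cd that by blast
  have G: "has_gradient I (transition M c d (j, e))
      (\<lambda>(i, a). if i = j then pderivative a (transition (F j) (c j) (d j) e) (cmap (F j) (c j) (p j)) else 0) ?x"
    if j: "j \<in> {1..k}" and e: "e \<in> cindex (F j)" for j e
  proof (rule has_gradient_cong[OF finite_I])
    show "openin (powertop_real I) (cmap M c ` cdom M c)"
      using coordinate_chart_M[OF cd(1)] by (simp add: coordinate_chart_def M_simps(2))
    show "?x \<in> cmap M c ` cdom M c" using cd by blast
    show "transition M c d (j, e) y = transition (F j) (c j) (d j) e (slice j y)"
      if "y \<in> cmap M c ` cdom M c" for y
      using j e that unfolding transition_def by (subst cinv_M[OF cd(1) that]) (simp add: M_simps)
    have "has_gradient (cindex (F j)) (transition (F j) (c j) (d j) e)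
        (\<lambda>a. pderivative a (transition (F j) (c j) (d j) e) (cmap (F j) (c j) (p j))) (slice j ?x)"
      using c1[OF j] cdi[OF j] e sl[OF j] unfolding c1_manifold_def by auto
    then show "has_gradient I (\<lambda>y. transition (F j) (c j) (d j) e (slice j y))
      (\<lambda>(i, a). if i = j then pderivative a (transition (F j) (c j) (d j) e) (cmap (F j) (c j) (p j)) else 0) ?x"
      by (rule has_gradient_slice[OF j])
  qed
  have xe: "?x \<in> extensional I" by (simp add: M_simps)
  show "has_gradient (cindex M) (transition M c d m) (\<lambda>i. pderivative i (transition M c d m) ?x) ?x"
    if "m \<in> cindex M" for m
    using that has_gradient_pderivatives[OF G finite_I xe] by (auto simp: M_simps(2))
  have P: "pderivative (i, a) (transition M c d (j, e)) ?x
      = (if i = j then pderivative a (transition (F j) (c j) (d j) e) (cmap (F j) (c j) (p j)) else 0)"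
    if "j \<in> {1..k}" "e \<in> cindex (F j)" "(i, a) \<in> I" for i a j e
    using has_gradient_pderivative(2)[OF G[OF that(1,2)] finite_I xe that(3)] by simp
  show "gram M c p m n = inner_of (cindex M) (gram M d p)
      (\<lambda>l. pderivative m (transition M c d l) ?x) (\<lambda>l. pderivative n (transition M c d l) ?x)"
    if mn: "m \<in> cindex M" "n \<in> cindex M" for m n
  proof -
    obtain i a where m: "m = (i, a)" "i \<in> {1..k}" "a \<in> cindex (F i)" using mn by (auto simp: M_simps)
    obtain j b where n: "n = (j, b)" "j \<in> {1..k}" "b \<in> cindex (F j)" using mn by (auto simp: M_simps)
    let ?T = "\<lambda>l a e. pderivative a (transition (F l) (c l) (d l) e) (cmap (F l) (c l) (p l))"
    have "inner_of (cindex M) (gram M d p)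
      (\<lambda>l. pderivative m (transition M c d l) ?x) (\<lambda>l. pderivative n (transition M c d l) ?x)
      = (\<Sum>l\<in>{1..k}. scale l p * inner_of (cindex (F l)) (gram (F l) (d l) (p l))
          (\<lambda>e. if i = l then ?T l a e else 0) (\<lambda>e. if j = l then ?T l b e else 0))"
      unfolding M_simps(2) inner_of_gram_M
      using m n by (intro sum.cong refl arg_cong2[where f = "(*)"] inner_of_cong) (auto simp: P)
    also have "\<dots> = (\<Sum>l\<in>{1..k}. if l = i then (if i = j then scale i p *
        inner_of (cindex (F i)) (gram (F i) (d i) (p i)) (?T i a) (?T i b) else 0) else 0)"
      by (intro sum.cong refl) auto
    also have "\<dots> = (if i = j then scale i p *
        inner_of (cindex (F i)) (gram (F i) (d i) (p i)) (?T i a) (?T i b) else 0)"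
      using m by simp
    also have "\<dots> = gram M c p m n"
    proof (cases "i = j")
      case True
      have "gram (F i) (c i) (p i) a b = inner_of (cindex (F i)) (gram (F i) (d i) (p i)) (?T i a) (?T i b)"
        using c1[OF m(2)] cdi[OF m(2)] m n True unfolding c1_manifold_def by blast
      then show ?thesis using m n True by (simp add: gram_M)
    qed (use m n in \<open>simp add: gram_M\<close>)
    finally show ?thesis by simp
  qed
qed

end

section \<open>The second fundamental form in a chart\<close>

lemma smooth_on_DERIV_affine_line:
  assumes "finite I" "openin (powertop_real I) U" "smooth_on I U f" "affine_line I x v t \<in> U"
  shows "((\<lambda>s. f (affine_line I x v s)) has_real_derivative (\<Sum>i\<in>I. pderivative i f (affine_line I x v t) * v i)) (at t)"
  by (rule has_gradientD[OF smooth_on_has_gradient[OF assms]])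
    (auto simp: affine_line_def intro!: derivative_eq_intros)

text \<open>A map into a single chart image, whose domain carries no metric: the curvature
  computation differentiates in coordinate-constant directions only, and the domain metric will
  reappear as the pullback of the target metric.\<close>

locale chart_map = riemannian_chart N d
  for N :: "('b, 'd, 'j) riem_manifold" and d +
  fixes I :: "'i set" and U :: "('i \<Rightarrow> real) set" and \<Phi> :: "('i \<Rightarrow> real) \<Rightarrow> 'j \<Rightarrow> real"
  assumes finite_I: "finite I" and open_U: "openin (powertop_real I) U"
    and smooth_\<Phi>: "\<And>\<alpha>. \<alpha> \<in> cindex N \<Longrightarrow> smooth_on I U (\<lambda>x. \<Phi> x \<alpha>)"
    and \<Phi>_V: "\<And>x. x \<in> U \<Longrightarrow> \<Phi> x \<in> cmap N d ` cdom N d"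
begin

abbreviation P where "P i \<alpha> \<equiv> pderivative i (\<lambda>x. \<Phi> x \<alpha>)"

definition d1 :: "('i \<Rightarrow> real) \<Rightarrow> ('i \<Rightarrow> real) \<Rightarrow> 'j \<Rightarrow> real"
  where "d1 v x \<alpha> = (\<Sum>i\<in>I. P i \<alpha> x * v i)"

definition d2 :: "('i \<Rightarrow> real) \<Rightarrow> ('i \<Rightarrow> real) \<Rightarrow> ('i \<Rightarrow> real) \<Rightarrow> 'j \<Rightarrow> real"
  where "d2 v w x \<alpha> = (\<Sum>j\<in>I. (\<Sum>i\<in>I. pderivative i (P j \<alpha>) x * v i) * w j)"

definition d3 :: "('i \<Rightarrow> real) \<Rightarrow> ('i \<Rightarrow> real) \<Rightarrow> ('i \<Rightarrow> real) \<Rightarrow> ('i \<Rightarrow> real) \<Rightarrow> 'j \<Rightarrow> real"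
  where "d3 v w z x \<alpha> = (\<Sum>k\<in>I. (\<Sum>j\<in>I. (\<Sum>i\<in>I. pderivative i (pderivative j (P k \<alpha>)) x * v i) * w j) * z k)"

text \<open>The ambient covariant derivative along \<open>v\<close> of the image field of the
  constant field \<open>w\<close>. Unlike the second fundamental form it retains its tangential
  part, so it can be differentiated further without projections.\<close>

definition hess :: "('i \<Rightarrow> real) \<Rightarrow> ('i \<Rightarrow> real) \<Rightarrow> ('i \<Rightarrow> real) \<Rightarrow> 'j \<Rightarrow> real"
  where "hess v w x \<alpha> = d2 v w x \<alpha> + conn N d (\<Phi> x) (d1 v x) (d1 w x) \<alpha>"

text \<open>The covariant derivative, in the direction \<open>v\<close>, of \<open>hess w z\<close>.\<close>

definition dhess :: "('i \<Rightarrow> real) \<Rightarrow> ('i \<Rightarrow> real) \<Rightarrow> ('i \<Rightarrow> real) \<Rightarrow> ('i \<Rightarrow> real) \<Rightarrow> 'j \<Rightarrow> real"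
  where "dhess v w z x \<alpha> = d3 v w z x \<alpha>
    + (conn_deriv N d (\<Phi> x) (d1 v x) (d1 w x) (d1 z x) \<alpha>
       + conn N d (\<Phi> x) (d2 v w x) (d1 z x) \<alpha> + conn N d (\<Phi> x) (d1 w x) (d2 v z x) \<alpha>)
    + conn N d (\<Phi> x) (d1 v x) (hess w z x) \<alpha>"

lemma DERIV_smooth_line:
  "smooth_on I U f \<Longrightarrow> x \<in> U \<Longrightarrow>
    ((\<lambda>s. f (affine_line I x v s)) has_real_derivative (\<Sum>i\<in>I. pderivative i f x * v i)) (at 0)"
  using smooth_on_DERIV_affine_line[OF finite_I open_U, of f x v 0] affine_line_facts(1)[OF finite_I open_U]
  by simp

lemma DERIV_\<Phi>:
  assumes "x \<in> U" "\<alpha> \<in> J"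
  shows "((\<lambda>s. \<Phi> (affine_line I x v s) \<alpha>) has_real_derivative d1 v x \<alpha>) (at 0)"
  unfolding d1_def by (rule DERIV_smooth_line[OF smooth_\<Phi>[OF assms(2)] assms(1)])

lemma DERIV_d1:
  assumes "x \<in> U" "\<alpha> \<in> J"
  shows "((\<lambda>s. d1 w (affine_line I x v s) \<alpha>) has_real_derivative d2 v w x \<alpha>) (at 0)"
  unfolding d1_def d2_def
  by (intro DERIV_sum DERIV_cmult_right DERIV_smooth_line smooth_on_pderivative smooth_\<Phi> assms)

lemma DERIV_d2:
  assumes "x \<in> U" "\<alpha> \<in> J"
  shows "((\<lambda>s. d2 w z (affine_line I x v s) \<alpha>) has_real_derivative d3 v w z x \<alpha>) (at 0)"
  unfolding d2_def d3_def
  by (intro DERIV_sum DERIV_cmult_right DERIV_smooth_line smooth_on_pderivative smooth_\<Phi> assms)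

lemma line_0: "x \<in> U \<Longrightarrow> affine_line I x v 0 = x"
  using affine_line_facts(1)[OF finite_I open_U] .

lemma \<Phi>_line_ext:
  assumes "x \<in> U"
  shows "\<forall>\<^sub>F s in nhds 0. \<Phi> (affine_line I x v s) \<in> extensional J"
  using affine_line_facts(4)[OF finite_I open_U assms] by eventually_elim (use \<Phi>_V V_ext in blast)

lemma DERIV_hess:
  assumes x: "x \<in> U" and \<alpha>: "\<alpha> \<in> J"
  shows "((\<lambda>s. hess w z (affine_line I x v s) \<alpha>) has_real_derivative d3 v w z x \<alpha>
    + (conn_deriv N d (\<Phi> x) (d1 v x) (d1 w x) (d1 z x) \<alpha>
       + conn N d (\<Phi> x) (d2 v w x) (d1 z x) \<alpha> + conn N d (\<Phi> x) (d1 w x) (d2 v z x) \<alpha>)) (at 0)"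
  unfolding hess_def
  using DERIV_conn[where \<gamma> = "\<lambda>s. \<Phi> (affine_line I x v s)" and t = 0 and l = \<alpha>
      and A = "\<lambda>s. d1 w (affine_line I x v s)" and B = "\<lambda>s. d1 z (affine_line I x v s)",
      OF _ \<Phi>_V[OF x] \<Phi>_line_ext[OF x] DERIV_\<Phi>[OF x] DERIV_d1[OF x] DERIV_d1[OF x] \<alpha>]
  by (intro DERIV_add DERIV_d2 x \<alpha>) (simp add: line_0[OF x])

lemma DERIV_ip_line:
  assumes x: "x \<in> U"
    and X: "\<And>\<alpha>. \<alpha> \<in> J \<Longrightarrow> ((\<lambda>s. X (affine_line I x v s) \<alpha>) has_real_derivative X' \<alpha>) (at 0)"
    and Z: "\<And>\<alpha>. \<alpha> \<in> J \<Longrightarrow> ((\<lambda>s. Z (affine_line I x v s) \<alpha>) has_real_derivative Z' \<alpha>) (at 0)"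
  shows "((\<lambda>s. ip (\<Phi> (affine_line I x v s)) (X (affine_line I x v s)) (Z (affine_line I x v s))) has_real_derivative
    ip (\<Phi> x) (\<lambda>i. X' i + conn N d (\<Phi> x) (d1 v x) (X x) i) (Z x)
      + ip (\<Phi> x) (X x) (\<lambda>i. Z' i + conn N d (\<Phi> x) (d1 v x) (Z x) i)) (at 0)"
  using DERIV_ip[where \<gamma> = "\<lambda>s. \<Phi> (affine_line I x v s)" and t = 0
      and X = "\<lambda>s. X (affine_line I x v s)" and Z = "\<lambda>s. Z (affine_line I x v s)",
      OF _ \<Phi>_V[OF x] \<Phi>_line_ext[OF x] DERIV_\<Phi>[OF x] X Z]
  by (simp add: line_0[OF x])

lemma DERIV_ip_d1_d1:
  assumes x: "x \<in> U"
  shows "((\<lambda>s. ip (\<Phi> (affine_line I x v s)) (d1 w (affine_line I x v s)) (d1 z (affine_line I x v s))) has_real_derivative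
    ip (\<Phi> x) (hess v w x) (d1 z x) + ip (\<Phi> x) (d1 w x) (hess v z x)) (at 0)"
  using DERIV_ip_line[OF x DERIV_d1[OF x] DERIV_d1[OF x]] by (simp add: hess_def[abs_def])

lemma DERIV_ip_hess_d1:
  assumes x: "x \<in> U"
  shows "((\<lambda>s. ip (\<Phi> (affine_line I x v s)) (hess w z (affine_line I x v s)) (d1 y (affine_line I x v s))) has_real_derivative
    ip (\<Phi> x) (dhess v w z x) (d1 y x) + ip (\<Phi> x) (hess w z x) (hess v y x)) (at 0)"
proof -
  have "hess v y x = (\<lambda>\<alpha>. d2 v y x \<alpha> + conn N d (\<Phi> x) (d1 v x) (d1 y x) \<alpha>)"
    by (simp add: hess_def fun_eq_iff)
  then show ?thesis
    using DERIV_ip_line[OF x DERIV_hess[OF x] DERIV_d1[OF x]] by (simp add: dhess_def[abs_def])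
qed

lemma sum_swap_weighted:
  "(\<Sum>j\<in>I. (\<Sum>i\<in>I. A i j * v i) * w j) = (\<Sum>j\<in>I. (\<Sum>i\<in>I. A j i * w i) * v j)" for A :: "'i \<Rightarrow> 'i \<Rightarrow> real"
proof -
  have "(\<Sum>j\<in>I. (\<Sum>i\<in>I. A i j * v i) * w j) = (\<Sum>j\<in>I. \<Sum>i\<in>I. A i j * w j * v i)"
    by (simp add: sum_distrib_left sum_distrib_right mult_ac)
  also have "\<dots> = (\<Sum>i\<in>I. \<Sum>j\<in>I. A i j * w j * v i)" by (rule sum.swap)
  finally show ?thesis by (simp add: sum_distrib_right)
qed

lemma d2_commute:
  assumes "x \<in> U" "\<alpha> \<in> J"
  shows "d2 v w x \<alpha> = d2 w v x \<alpha>"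
proof -
  have "d2 v w x \<alpha> = (\<Sum>j\<in>I. (\<Sum>i\<in>I. pderivative j (P i \<alpha>) x * w i) * v j)"
    unfolding d2_def by (rule sum_swap_weighted)
  also have "\<dots> = d2 w v x \<alpha>"
    unfolding d2_def using pderivative_commute[OF finite_I open_U smooth_\<Phi>[OF assms(2)] assms(1)]
    by (intro sum.cong refl arg_cong2[where f = "(*)"]) simp
  finally show ?thesis .
qed

lemma d3_commute:
  assumes "x \<in> U" "\<alpha> \<in> J"
  shows "d3 v w z x \<alpha> = d3 w v z x \<alpha>"
proof -
  have "(\<Sum>j\<in>I. (\<Sum>i\<in>I. pderivative i (pderivative j (P k \<alpha>)) x * v i) * w j)
      = (\<Sum>j\<in>I. (\<Sum>i\<in>I. pderivative i (pderivative j (P k \<alpha>)) x * w i) * v j)" if k: "k \<in> I" for k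
  proof -
    have "(\<Sum>j\<in>I. (\<Sum>i\<in>I. pderivative i (pderivative j (P k \<alpha>)) x * v i) * w j)
      = (\<Sum>j\<in>I. (\<Sum>i\<in>I. pderivative j (pderivative i (P k \<alpha>)) x * w i) * v j)"
      by (rule sum_swap_weighted)
    also have "\<dots> = (\<Sum>j\<in>I. (\<Sum>i\<in>I. pderivative i (pderivative j (P k \<alpha>)) x * w i) * v j)"
      using pderivative_commute[OF finite_I open_U smooth_on_pderivative[OF smooth_\<Phi>[OF assms(2)] k] assms(1)]
      by (intro sum.cong refl arg_cong2[where f = "(*)"]) simp
    finally show ?thesis .
  qed
  then show ?thesis unfolding d3_def by simp
qed

lemma conn_cong: "(\<And>i. i \<in> J \<Longrightarrow> a i = a' i) \<Longrightarrow> (\<And>i. i \<in> J \<Longrightarrow> b i = b' i) \<Longrightarrow> conn N d y a b l = conn N d y a' b' l"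
  by (simp add: conn_def)

lemma conn_commute:
  assumes "y \<in> V"
  shows "conn N d y a b l = conn N d y b a l"
proof -
  have "conn N d y a b l = (\<Sum>i\<in>J. \<Sum>j\<in>J. christoffel N d y l j i * b j * a i)"
    unfolding conn_def using christoffel_commute[OF assms] by (intro sum.cong refl) simp
  also have "\<dots> = conn N d y b a l" unfolding conn_def by (rule sum.swap)
  finally show ?thesis .
qed

lemma hess_commute:
  assumes "x \<in> U" "\<alpha> \<in> J"
  shows "hess v w x \<alpha> = hess w v x \<alpha>"
  using d2_commute[OF assms] conn_commute[OF \<Phi>_V[OF assms(1)]] by (simp add: hess_def)

text \<open>The Ricci identity for a field along the map: third partial derivatives and the terms
  with second ones are symmetric in \<open>v, w\<close>, and what survives is the commutator form of
  the curvature.\<close>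

lemma dhess_commutator:
  assumes x: "x \<in> U" and \<alpha>: "\<alpha> \<in> J"
  shows "dhess v w z x \<alpha> - dhess w v z x \<alpha> = curv N d (\<Phi> x) (d1 v x) (d1 w x) (d1 z x) \<alpha>"
proof -
  let ?C = "conn N d (\<Phi> x)"
  have h: "?C a (hess w z x) \<alpha> = ?C a (d2 w z x) \<alpha> + ?C a (?C (d1 w x) (d1 z x)) \<alpha>" for a w
    unfolding hess_def[abs_def] by (rule conn_add_right)
  have "?C (d2 v w x) (d1 z x) \<alpha> = ?C (d2 w v x) (d1 z x) \<alpha>"
    using d2_commute[OF x] by (intro conn_cong) auto
  then show ?thesis
    unfolding dhess_def h curv_commutator using d3_commute[OF x \<alpha>, of v w z] by simp
qed

text \<open>As \<open>v\<close> and \<open>w\<close> stay orthogonal and second covariant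
  derivatives commute, <D_v v, w> = - <v, D_v w> = - <v, D_w v>, which is minus half the derivative
  of |v|^2 along \<open>w\<close>.\<close>

lemma hess_orthogonal:
  assumes x: "x \<in> U" and vw: "\<And>y. y \<in> U \<Longrightarrow> ip (\<Phi> y) (d1 v y) (d1 w y) = 0"
    and vv: "((\<lambda>s. ip (\<Phi> (affine_line I x w s)) (d1 v (affine_line I x w s)) (d1 v (affine_line I x w s)))
      has_real_derivative 0) (at 0)"
  shows "ip (\<Phi> x) (hess v v x) (d1 w x) = 0"
proof -
  have ev: "\<forall>\<^sub>F s in nhds 0. affine_line I x v s \<in> U" by (rule affine_line_facts(4)[OF finite_I open_U x])
  then have "\<forall>\<^sub>F s in nhds 0. ip (\<Phi> (affine_line I x v s)) (d1 v (affine_line I x v s)) (d1 w (affine_line I x v s)) = 0"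
    by eventually_elim (rule vw)
  from DERIV_cong_ev[OF refl this refl]
  have "((\<lambda>s. ip (\<Phi> (affine_line I x v s)) (d1 v (affine_line I x v s)) (d1 w (affine_line I x v s)))
      has_real_derivative 0) (at 0)" by simp
  from DERIV_unique[OF this DERIV_ip_d1_d1[OF x]]
  have 1: "ip (\<Phi> x) (hess v v x) (d1 w x) + ip (\<Phi> x) (d1 v x) (hess v w x) = 0" by simp
  have "ip (\<Phi> x) (hess w v x) (d1 v x) + ip (\<Phi> x) (d1 v x) (hess w v x) = 0"
    using DERIV_unique[OF vv DERIV_ip_d1_d1[OF x]] by simp
  then have "ip (\<Phi> x) (d1 v x) (hess w v x) = 0" using ip_commute[OF \<Phi>_V[OF x]] by simp
  moreover have "ip (\<Phi> x) (d1 v x) (hess w v x) = ip (\<Phi> x) (d1 v x) (hess v w x)"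
    using hess_commute[OF x] by (intro inner_of_cong) auto
  ultimately show ?thesis using 1 by simp
qed

text \<open>
  A Gauss equation: the intrinsic curvature of the plane of \<open>v\<close> and \<open>w\<close> enters through the second
  derivative of \<open>\<bar>w\<bar>\<^sup>2\<close> along \<open>v\<close>.
\<close>

lemma gauss_mixed:
  assumes x: "x \<in> U" and vw: "\<And>y. y \<in> U \<Longrightarrow> ip (\<Phi> y) (d1 v y) (d1 w y) = 0"
    and vv: "\<And>y. y \<in> U \<Longrightarrow> ((\<lambda>s. ip (\<Phi> (affine_line I y w s)) (d1 v (affine_line I y w s)) (d1 v (affine_line I y w s)))
      has_real_derivative 0) (at 0)"
    and ww: "\<And>y. y \<in> U \<Longrightarrow> ((\<lambda>s. ip (\<Phi> (affine_line I y v s)) (d1 w (affine_line I y v s)) (d1 w (affine_line I y v s)))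
      has_real_derivative G y) (at 0)"
    and G: "((\<lambda>s. G (affine_line I x v s)) has_real_derivative G') (at 0)"
  shows "G' / 2 = - ip (\<Phi> x) (curv N d (\<Phi> x) (d1 v x) (d1 w x) (d1 w x)) (d1 v x)
    + ip (\<Phi> x) (hess w v x) (hess w v x) - ip (\<Phi> x) (hess v v x) (hess w w x)"
proof -
  have ev: "\<forall>\<^sub>F s in nhds 0. affine_line I x z s \<in> U" for z by (rule affine_line_facts(4)[OF finite_I open_U x])
  \<comment> \<open>The relation <D_v v, w> = 0 holds on all of \<open>U\<close>, so it may be
    differentiated along \<open>w\<close>.\<close>
  have "\<forall>\<^sub>F s in nhds 0. ip (\<Phi> (affine_line I x w s)) (hess v v (affine_line I x w s)) (d1 w (affine_line I x w s)) = 0"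
    using ev[of w] by eventually_elim (rule hess_orthogonal[OF _ vw vv])
  from DERIV_cong_ev[OF refl this refl]
  have "((\<lambda>s. ip (\<Phi> (affine_line I x w s)) (hess v v (affine_line I x w s)) (d1 w (affine_line I x w s)))
      has_real_derivative 0) (at 0)" by simp
  from DERIV_unique[OF this DERIV_ip_hess_d1[OF x]]
  have 1: "ip (\<Phi> x) (dhess w v v x) (d1 w x) + ip (\<Phi> x) (hess v v x) (hess w w x) = 0" by simp
  \<comment> \<open>The derivative of |w|^2 along \<open>v\<close> is 2 <D_w v, w>. Differentiating
    it once more along \<open>v\<close> yields a third-order term that differs from the one in fact
    1 by an interchange of \<open>v\<close> and \<open>w\<close>.\<close>
  have "2 * ip (\<Phi> y) (hess w v y) (d1 w y) = G y" if y: "y \<in> U" for y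
  proof -
    have "G y = ip (\<Phi> y) (hess v w y) (d1 w y) + ip (\<Phi> y) (d1 w y) (hess v w y)"
      by (rule DERIV_unique[OF ww[OF y] DERIV_ip_d1_d1[OF y]])
    also have "\<dots> = 2 * ip (\<Phi> y) (hess v w y) (d1 w y)"
      using ip_commute[OF \<Phi>_V[OF y], of "d1 w y"] by simp
    also have "ip (\<Phi> y) (hess v w y) (d1 w y) = ip (\<Phi> y) (hess w v y) (d1 w y)"
      using hess_commute[OF y] by (intro inner_of_cong) auto
    finally show ?thesis by simp
  qed
  then have "\<forall>\<^sub>F s in nhds 0. 2 * ip (\<Phi> (affine_line I x v s)) (hess w v (affine_line I x v s)) (d1 w (affine_line I x v s))
      = G (affine_line I x v s)"
    using ev[of v] by (auto elim!: eventually_mono)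
  from DERIV_cong_ev[OF refl this refl] G
  have "((\<lambda>s. 2 * ip (\<Phi> (affine_line I x v s)) (hess w v (affine_line I x v s)) (d1 w (affine_line I x v s)))
      has_real_derivative G') (at 0)" by simp
  from DERIV_unique[OF this DERIV_cmult[OF DERIV_ip_hess_d1[OF x]]]
  have 2: "G' / 2 = ip (\<Phi> x) (dhess v w v x) (d1 w x) + ip (\<Phi> x) (hess w v x) (hess v w x)" by simp
  have 3: "ip (\<Phi> x) (hess w v x) (hess v w x) = ip (\<Phi> x) (hess w v x) (hess w v x)"
    using hess_commute[OF x] by (intro inner_of_cong) auto
  \<comment> \<open>The third-order terms are traded for curvature by the Ricci identity; skew
    symmetry brings the result to the form that defines sectional curvature.\<close>
  have "ip (\<Phi> x) (dhess v w v x) (d1 w x) - ip (\<Phi> x) (dhess w v v x) (d1 w x)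
      = ip (\<Phi> x) (\<lambda>\<alpha>. dhess v w v x \<alpha> - dhess w v v x \<alpha>) (d1 w x)"
    by (simp add: inner_of_diff_left)
  also have "\<dots> = ip (\<Phi> x) (curv N d (\<Phi> x) (d1 v x) (d1 w x) (d1 v x)) (d1 w x)"
    using dhess_commutator[OF x] by (intro inner_of_cong) auto
  also have "\<dots> = - ip (\<Phi> x) (curv N d (\<Phi> x) (d1 v x) (d1 w x) (d1 w x)) (d1 v x)"
    by (rule ip_curv_skew[OF \<Phi>_V[OF x]])
  finally show ?thesis using 1 2 3 by simp
qed

end

section \<open>Warping functions and the maximum of the potential\<close>

text \<open>If \<open>D\<close> were positive, \<open>g\<close> would be positive immediately to the
  right of 0, and the mean value theorem would push \<open>f\<close> above its maximum.\<close>

lemma local_max_second_derivative: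
  fixes f g :: "real \<Rightarrow> real"
  assumes f: "\<forall>\<^sub>F s in nhds 0. (f has_real_derivative g s) (at s)"
    and g: "(g has_real_derivative D) (at 0)"
    and max: "\<forall>\<^sub>F s in nhds 0. f s \<le> f 0"
  shows "g 0 = 0" "D \<le> 0"
proof -
  obtain e where e: "e > 0" "\<And>s. \<bar>s\<bar> < e \<Longrightarrow> (f has_real_derivative g s) (at s) \<and> f s \<le> f 0"
    using eventually_conj[OF f max] unfolding eventually_nhds_metric by (auto simp: dist_real_def)
  show g0: "g 0 = 0"
    using DERIV_local_max[of f "g 0" 0 e] e by auto
  show "D \<le> 0"
  proof (rule ccontr)
    assume "\<not> D \<le> 0"
    then obtain r where r: "r > 0" "\<And>h. h > 0 \<Longrightarrow> h < r \<Longrightarrow> g 0 < g (0 + h)"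
      using DERIV_pos_inc_right[OF g] by auto
    define b where "b = min r e / 2"
    have b: "b > 0" "b < r" "b < e" using r(1) e(1) by (auto simp: b_def min_def)
    obtain z where z: "0 < z" "z < b" "f b - f 0 = (b - 0) * g z"
      using MVT2[of 0 b f g] e(2) b by auto
    have "g z > 0" using r(2)[of z] z b g0 by simp
    then have "f b > f 0" using z b by (simp add: algebra_simps)
    then show False using e(2)[of b] b by auto
  qed
qed

lemma (in riemannian_chart) smooth_function_local_continuous:
  assumes u: "smooth_function N u" and O': "open O'"
  shows "openin (mtop N) {q \<in> cdom N d. u q \<in> O'}"
proof -
  have top: "topspace (subtopology (mtop N) (cdom N d)) = cdom N d"
    using openin_subset[OF open_cdom] by auto
  have "continuous_map (subtopology (powertop_real J) V) euclideanreal (\<lambda>x. u (cinv N d x))"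
    using u d unfolding smooth_function_def by (intro smooth_on_continuous) blast
  then have co: "continuous_map (subtopology (mtop N) (cdom N d)) euclideanreal ((\<lambda>x. u (cinv N d x)) \<circ> cmap N d)"
    by (rule continuous_map_compose[OF homeomorphic_imp_continuous_map[OF homeo]])
  have "openin (subtopology (mtop N) (cdom N d))
      {q \<in> topspace (subtopology (mtop N) (cdom N d)). ((\<lambda>x. u (cinv N d x)) \<circ> cmap N d) q \<in> O'}"
    by (rule openin_continuous_map_preimage[OF co]) (use O' in simp)
  then have "openin (subtopology (mtop N) (cdom N d)) {q \<in> cdom N d. u q \<in> O'}"
    unfolding top by (rule back_subst[of "openin _"]) (auto simp: cinv_cmap)
  then show ?thesis using open_cdom openin_open_subtopology by blast
qed

lemma smooth_function_continuous:
  assumes N: "riemannian_manifold N" and u: "smooth_function N u"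
  shows "continuous_map (mtop N) euclideanreal u"
  unfolding continuous_map_def
proof (intro conjI allI impI)
  show "u \<in> points N \<rightarrow> topspace euclideanreal" by simp
  fix O' :: "real set" assume "openin euclideanreal O'"
  then have O': "open O'" by simp
  have cov: "(\<Union>c\<in>charts N. cdom N c) = points N"
    using N by (simp add: riemannian_manifold_def topological_manifold_def)
  have "openin (mtop N) (\<Union>c\<in>charts N. {q \<in> cdom N c. u q \<in> O'})"
    using riemannian_chart.smooth_function_local_continuous[OF riemannian_chart.intro[OF N] u O']
    by (intro openin_Union) auto
  moreover have "(\<Union>c\<in>charts N. {q \<in> cdom N c. u q \<in> O'}) = {x \<in> points N. u x \<in> O'}"
    using cov by blast
  ultimately show "openin (mtop N) {x \<in> points N. u x \<in> O'}" by simp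
qed

context warped_product
begin

section \<open>Vectors tangent to one factor and their lengths\<close>

definition in_block :: "nat \<Rightarrow> (nat \<times> 'i \<Rightarrow> real) \<Rightarrow> bool"
  where "in_block i v \<longleftrightarrow> (\<forall>m\<in>I. fst m \<noteq> i \<longrightarrow> v m = 0)"

abbreviation part :: "nat \<Rightarrow> (nat \<times> 'i \<Rightarrow> real) \<Rightarrow> 'i \<Rightarrow> real"
  where "part i v \<equiv> \<lambda>a. v (i, a)"

lemma in_blockD: "in_block i v \<Longrightarrow> j \<in> {1..k} \<Longrightarrow> a \<in> cindex (F j) \<Longrightarrow> j \<noteq> i \<Longrightarrow> v (j, a) = 0"
  by (auto simp: in_block_def)

lemma inner_of_part_zero: "in_block i v \<Longrightarrow> j \<in> {1..k} \<Longrightarrow> j \<noteq> i \<Longrightarrow>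
    inner_of (cindex (F j)) G (part j v) w = 0 \<and> inner_of (cindex (F j)) G w (part j v) = 0"
  unfolding inner_of_def using in_blockD by (auto intro!: sum.neutral)

lemma inner_different_blocks:
  assumes "in_block i v" "in_block j w" "i \<noteq> j"
  shows "inner_of I (gram M c q) v w = 0"
  unfolding inner_of_gram_M
proof (rule sum.neutral, rule ballI)
  fix l assume l: "l \<in> {1..k}"
  show "scale l q * inner_of (cindex (F l)) (gram (F l) (c l) (q l)) (part l v) (part l w) = 0"
    using inner_of_part_zero[OF assms(1) l] inner_of_part_zero[OF assms(2) l] assms(3) by (cases "l = i") auto
qed

lemma inner_same_block:
  assumes "in_block i v" "i \<in> {1..k}"
  shows "inner_of I (gram M c q) v w = scale i q * inner_of (cindex (F i)) (gram (F i) (c i) (q i)) (part i v) (part i w)"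
proof -
  have "inner_of I (gram M c q) v w = (\<Sum>l\<in>{1..k}. if l = i then
      scale i q * inner_of (cindex (F i)) (gram (F i) (c i) (q i)) (part i v) (part i w) else 0)"
    unfolding inner_of_gram_M using inner_of_part_zero[OF assms(1)] by (intro sum.cong refl) auto
  then show ?thesis using assms(2) by simp
qed

lemma gram_M_symmetric:
  assumes "c \<in> charts M" "q \<in> cdom M c"
  shows "symmetric_matrix I (gram M c q)"
  unfolding symmetric_matrix_def
proof (intro ballI)
  fix m n assume "m \<in> I" "n \<in> I"
  then obtain i a j b where m: "m = (i, a)" "i \<in> {1..k}" "a \<in> cindex (F i)"
    and n: "n = (j, b)" "j \<in> {1..k}" "b \<in> cindex (F j)" by blast
  have "gram (F i) (c i) (q i) a b = gram (F i) (c i) (q i) b a" if "i = j"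
  proof -
    interpret riemannian_chart "F i" "c i" by (rule factor_chart[OF assms(1) m(2)])
    have "q i \<in> cdom (F i) (c i)" using assms m by (auto simp: M_simps)
    then have "symmetric_matrix (cindex (F i)) (gram (F i) (c i) (q i))"
      using sym_lgram[of "cmap (F i) (c i) (q i)"] by (simp add: lgram_cmap)
    then show ?thesis using m(3) n(3) that by (simp add: symmetric_matrix_def)
  qed
  then show "gram M c q m n = gram M c q n m" unfolding m n gram_M by auto
qed

lemma gram_M_positive:
  assumes "c \<in> charts M" "q \<in> cdom M c"
  shows "positive_matrix I (gram M c q)"
  unfolding positive_matrix_def
proof (intro allI impI)
  fix v assume "\<exists>m\<in>I. v m \<noteq> (0::real)"
  then obtain i a where i: "i \<in> {1..k}" and a: "a \<in> cindex (F i)" "v (i, a) \<noteq> 0" by auto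
  have pos: "positive_matrix (cindex (F j)) (gram (F j) (c j) (q j))" if j: "j \<in> {1..k}" for j
  proof -
    interpret riemannian_chart "F j" "c j" by (rule factor_chart[OF assms(1) j])
    have "q j \<in> cdom (F j) (c j)" using assms j by (auto simp: M_simps)
    then show ?thesis using pos_lgram[of "cmap (F j) (c j) (q j)"] by (simp add: lgram_cmap)
  qed
  have sc: "scale j q > 0" if "j \<in> {1..k}" for j
    using scale_pos[OF that] cdom_points assms by blast
  show "inner_of I (gram M c q) v v > 0"
    unfolding inner_of_gram_M
  proof (rule sum_pos2[OF _ i])
    show "0 < scale i q * inner_of (cindex (F i)) (gram (F i) (c i) (q i)) (part i v) (part i v)"
      using pos[OF i] a sc[OF i] unfolding positive_matrix_def by (intro mult_pos_pos) auto
    show "0 \<le> scale j q * inner_of (cindex (F j)) (gram (F j) (c j) (q j)) (part j v) (part j v)"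
      if "j \<in> {1..k}" for j
      using positive_matrix_nonneg[OF pos[OF that]] sc[OF that] by simp
  qed simp
qed

lemma slice_line: "slice i (affine_line I x v s) = affine_line (cindex (F i)) (slice i x) (part i v) s"
  if "i \<in> {1..k}"
  using that by (auto simp: slice_def affine_line_def fun_eq_iff)

lemma slice_line_other:
  assumes "in_block j v" "i \<in> {1..k}" "i \<noteq> j"
  shows "slice i (affine_line I x v s) = slice i x"
  unfolding slice_line[OF assms(2)]
  using in_blockD[OF assms(1,2) _ assms(3)] by (auto simp: slice_def affine_line_def fun_eq_iff)

lemma slice_in_V:
  assumes "c \<in> charts M" "x \<in> cmap M c ` cdom M c" "i \<in> {1..k}"
  shows "slice i x \<in> cmap (F i) (c i) ` cdom (F i) (c i)"
  using assms unfolding cmap_image[OF assms(1)] by blast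

definition warp :: "(nat \<Rightarrow> 'c) \<Rightarrow> nat \<Rightarrow> ('i \<Rightarrow> real) \<Rightarrow> real"
  where "warp c i z = u i (cinv (F 1) (c 1) z)"

lemma first_index: "1 \<in> {1..k}" using k by simp

lemma later_index: "i \<in> {2..k} \<Longrightarrow> i \<in> {1..k} \<and> i \<noteq> 1" by auto

lemma smooth_warp:
  assumes "c \<in> charts M" "i \<in> {2..k}"
  shows "smooth_on (cindex (F 1)) (cmap (F 1) (c 1) ` cdom (F 1) (c 1)) (warp c i)"
proof -
  have "c 1 \<in> charts (F 1)" using assms(1) first_index by (auto simp: M_simps)
  then show ?thesis using smooth_u[OF assms(2)] unfolding smooth_function_def warp_def by blast
qed

lemma warp_pos:
  assumes "c \<in> charts M" "i \<in> {2..k}" "z \<in> cmap (F 1) (c 1) ` cdom (F 1) (c 1)"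
  shows "warp c i z > 0"
proof -
  interpret riemannian_chart "F 1" "c 1" by (rule factor_chart[OF assms(1) first_index])
  have "cinv (F 1) (c 1) z \<in> points (F 1)"
    using cinv_cdom[OF assms(3)] openin_subset[OF open_cdom] by blast
  then show ?thesis unfolding warp_def by (rule u_pos[OF assms(2)])
qed

lemma gram_cinv:
  assumes c: "c \<in> charts M" and x: "x \<in> cmap M c ` cdom M c" and i: "i \<in> {1..k}"
  shows "gram (F i) (c i) (cinv M c x i) = lgram (F i) (c i) (slice i x)"
  using i by (simp add: cinv_M[OF c x] lgram_def fun_eq_iff)

lemma scale_cinv:
  assumes c: "c \<in> charts M" and x: "x \<in> cmap M c ` cdom M c" and i: "i \<in> {2..k}"
  shows "scale i (cinv M c x) = (warp c i (slice 1 x))\<^sup>2"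
  using first_index later_index[OF i] by (simp add: cinv_M[OF c x] scale_def warp_def)

abbreviation norm2 :: "(nat \<Rightarrow> 'c) \<Rightarrow> (nat \<times> 'i \<Rightarrow> real) \<Rightarrow> (nat \<times> 'i \<Rightarrow> real) \<Rightarrow> real"
  where "norm2 c v x \<equiv> inner_of I (gram M c (cinv M c x)) v v"

lemma norm2_first:
  assumes c: "c \<in> charts M" and x: "x \<in> cmap M c ` cdom M c" and v: "in_block 1 v"
  shows "norm2 c v x = inner_of (cindex (F 1)) (lgram (F 1) (c 1) (slice 1 x)) (part 1 v) (part 1 v)"
  unfolding inner_same_block[OF v first_index] gram_cinv[OF c x first_index] by (simp add: scale_def)

lemma norm2_warped:
  assumes c: "c \<in> charts M" and x: "x \<in> cmap M c ` cdom M c" and i: "i \<in> {2..k}" and w: "in_block i w"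
  shows "norm2 c w x = (warp c i (slice 1 x))\<^sup>2 *
    inner_of (cindex (F i)) (lgram (F i) (c i) (slice i x)) (part i w) (part i w)"
  using inner_same_block[OF w, of c "cinv M c x" w] gram_cinv[OF c x, of i] later_index[OF i] scale_cinv[OF c x i] by auto

lemma line_eventually_W:
  assumes c: "c \<in> charts M" and x: "x \<in> cmap M c ` cdom M c"
  shows "\<forall>\<^sub>F s in nhds 0. affine_line I x v s \<in> cmap M c ` cdom M c"
proof (rule affine_line_facts(4)[OF finite_I _ x])
  show "openin (powertop_real I) (cmap M c ` cdom M c)"
    using coordinate_chart_M[OF c] by (simp add: coordinate_chart_def M_simps(2))
qed

text \<open>Moving along another factor leaves the coordinates of \<open>F 1\<close> unchanged, and
  the metric of \<open>F 1\<close> is not warped.\<close>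

lemma norm2_first_constant:
  assumes c: "c \<in> charts M" and x: "x \<in> cmap M c ` cdom M c" and v: "in_block 1 v"
    and i: "i \<in> {2..k}" and w: "in_block i w"
  shows "((\<lambda>s. norm2 c v (affine_line I x w s)) has_real_derivative 0) (at 0)"
proof -
  have "\<forall>\<^sub>F s in nhds 0. norm2 c v (affine_line I x w s) = norm2 c v x"
    using line_eventually_W[OF c x, of w]
  proof eventually_elim
    case (elim s)
    show ?case
      unfolding norm2_first[OF c elim v] norm2_first[OF c x v]
      using slice_line_other[OF w first_index] later_index[OF i] by simp
  qed
  from DERIV_cong_ev[OF refl this refl] show ?thesis by simp
qed

definition dwarp :: "(nat \<Rightarrow> 'c) \<Rightarrow> nat \<Rightarrow> ('i \<Rightarrow> real) \<Rightarrow> ('i \<Rightarrow> real) \<Rightarrow> real"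
  where "dwarp c i b z = (\<Sum>a\<in>cindex (F 1). pderivative a (warp c i) z * b a)"

text \<open>A second derivative along a coordinate line, with no connection term; where the first
  derivatives vanish it is the covariant Hessian.\<close>

definition ddwarp :: "(nat \<Rightarrow> 'c) \<Rightarrow> nat \<Rightarrow> ('i \<Rightarrow> real) \<Rightarrow> ('i \<Rightarrow> real) \<Rightarrow> real"
  where "ddwarp c i b z = (\<Sum>e\<in>cindex (F 1). (\<Sum>a\<in>cindex (F 1). pderivative a (pderivative e (warp c i)) z * b a) * b e)"

lemma first_chart_facts:
  assumes c: "c \<in> charts M"
  shows "finite (cindex (F 1))" "openin (powertop_real (cindex (F 1))) (cmap (F 1) (c 1) ` cdom (F 1) (c 1))"
  using riemannian_chart.finite_J[OF factor_chart[OF c first_index]] riemannian_chart.open_V[OF factor_chart[OF c first_index]] .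

lemma DERIV_warp:
  assumes c: "c \<in> charts M" and i: "i \<in> {2..k}"
    and z: "affine_line (cindex (F 1)) z b t \<in> cmap (F 1) (c 1) ` cdom (F 1) (c 1)"
  shows "((\<lambda>s. warp c i (affine_line (cindex (F 1)) z b s)) has_real_derivative
      dwarp c i b (affine_line (cindex (F 1)) z b t)) (at t)"
    "((\<lambda>s. dwarp c i b (affine_line (cindex (F 1)) z b s)) has_real_derivative
      ddwarp c i b (affine_line (cindex (F 1)) z b t)) (at t)"
  unfolding dwarp_def ddwarp_def
  by (intro DERIV_sum DERIV_cmult_right smooth_on_DERIV_affine_line[OF first_chart_facts[OF c]]
      smooth_on_pderivative smooth_warp[OF c i] z; assumption)+

lemma first_line_0:
  assumes c: "c \<in> charts M" and x: "x \<in> cmap M c ` cdom M c"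
  shows "affine_line (cindex (F 1)) (slice 1 x) b 0 = slice 1 x"
  by (rule affine_line_facts(1)[OF first_chart_facts[OF c] slice_in_V[OF c x first_index]])

lemma DERIV_norm2_warped:
  assumes c: "c \<in> charts M" and x: "x \<in> cmap M c ` cdom M c" and v: "in_block 1 v"
    and i: "i \<in> {2..k}" and w: "in_block i w"
  shows "((\<lambda>s. norm2 c w (affine_line I x v s)) has_real_derivative
    2 * warp c i (slice 1 x) * dwarp c i (part 1 v) (slice 1 x) *
      inner_of (cindex (F i)) (lgram (F i) (c i) (slice i x)) (part i w) (part i w)) (at 0)"
proof -
  let ?g = "inner_of (cindex (F i)) (lgram (F i) (c i) (slice i x)) (part i w) (part i w)"
  let ?L = "affine_line (cindex (F 1)) (slice 1 x) (part 1 v)"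
  have ev: "\<forall>\<^sub>F s in nhds 0. norm2 c w (affine_line I x v s) = (warp c i (?L s))\<^sup>2 * ?g"
    using line_eventually_W[OF c x, of v]
  proof eventually_elim
    case (elim s)
    show ?case
      unfolding norm2_warped[OF c elim i w]
      using slice_line_other[OF v, of i] later_index[OF i] slice_line[OF first_index] by simp
  qed
  have z: "?L 0 \<in> cmap (F 1) (c 1) ` cdom (F 1) (c 1)"
    unfolding first_line_0[OF c x] by (rule slice_in_V[OF c x first_index])
  have "((\<lambda>s. (warp c i (?L s))\<^sup>2 * ?g) has_real_derivative
      (2 * warp c i (?L 0) * dwarp c i (part 1 v) (?L 0)) * ?g) (at 0)"
    unfolding power2_eq_square
    by (intro DERIV_cmult_right DERIV_cong[OF DERIV_mult[OF DERIV_warp(1)[OF c i z] DERIV_warp(1)[OF c i z]]]) simp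
  then show ?thesis
    unfolding first_line_0[OF c x] using DERIV_cong_ev[OF refl ev refl] by simp
qed

text \<open>Along \<open>v\<close> only u_i varies, and (u^2)'' = 2 u'^2 + 2 u u''. With u' = 0 this
  is 2 (u''/u) u^2, and u^2 together with the metric of the factor reassembles |w|^2.\<close>

lemma DERIV2_norm2_warped:
  assumes c: "c \<in> charts M" and x: "x \<in> cmap M c ` cdom M c" and v: "in_block 1 v"
    and i: "i \<in> {2..k}" and w: "in_block i w" and crit: "dwarp c i (part 1 v) (slice 1 x) = 0"
  shows "((\<lambda>s. 2 * warp c i (slice 1 (affine_line I x v s)) * dwarp c i (part 1 v) (slice 1 (affine_line I x v s)) *
      inner_of (cindex (F i)) (lgram (F i) (c i) (slice i (affine_line I x v s))) (part i w) (part i w))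
    has_real_derivative 2 * (ddwarp c i (part 1 v) (slice 1 x) / warp c i (slice 1 x)) * norm2 c w x) (at 0)"
proof -
  let ?g = "inner_of (cindex (F i)) (lgram (F i) (c i) (slice i x)) (part i w) (part i w)"
  let ?L = "affine_line (cindex (F 1)) (slice 1 x) (part 1 v)"
  have z: "?L 0 \<in> cmap (F 1) (c 1) ` cdom (F 1) (c 1)"
    unfolding first_line_0[OF c x] by (rule slice_in_V[OF c x first_index])
  have pos: "warp c i (slice 1 x) > 0" by (rule warp_pos[OF c i slice_in_V[OF c x first_index]])
  have "((\<lambda>s. 2 * warp c i (?L s) * dwarp c i (part 1 v) (?L s) * ?g) has_real_derivative
      (2 * dwarp c i (part 1 v) (?L 0) * dwarp c i (part 1 v) (?L 0)
        + 2 * warp c i (?L 0) * ddwarp c i (part 1 v) (?L 0)) * ?g) (at 0)"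
    by (intro DERIV_cmult_right DERIV_cong[OF DERIV_mult[OF DERIV_cmult[OF DERIV_warp(1)[OF c i z]] DERIV_warp(2)[OF c i z]]])
      (simp add: mult_ac)
  also have "(2 * dwarp c i (part 1 v) (?L 0) * dwarp c i (part 1 v) (?L 0)
        + 2 * warp c i (?L 0) * ddwarp c i (part 1 v) (?L 0)) * ?g
      = 2 * (ddwarp c i (part 1 v) (slice 1 x) / warp c i (slice 1 x)) * norm2 c w x"
    unfolding first_line_0[OF c x] norm2_warped[OF c x i w] crit using pos
    by (simp add: power2_eq_square)
  finally show ?thesis
    using slice_line_other[OF v, of i] later_index[OF i] slice_line[OF first_index] by simp
qed

section \<open>The potential and its maximum\<close>

definition potential :: "(nat \<Rightarrow> 'a) \<Rightarrow> real"
  where "potential q = (\<Sum>i\<in>{2..k}. real (mdim (F i)) * ln (u i (q 1)))"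

lemma potential_attains_max:
  assumes "closed_manifold M"
  obtains p where "p \<in> points M" "\<And>q. q \<in> points M \<Longrightarrow> potential q \<le> potential p"
proof -
  have "continuous_map (mtop M) euclideanreal (\<lambda>q. ln (u i (q 1)))" if i: "i \<in> {2..k}" for i
  proof -
    have co: "continuous_map (mtop (F 1)) euclideanreal (u i)"
      by (rule smooth_function_continuous[OF riem[OF first_index] smooth_u[OF i]])
    have "continuous_map (mtop M) (mtop (F 1)) (\<lambda>q. q 1)"
      unfolding M_simps by (rule continuous_map_product_projection[OF first_index])
    from continuous_map_compose[OF this co]
    have "continuous_map (mtop M) euclideanreal (\<lambda>q. u i (q 1))" by (simp add: o_def)
    moreover have "u i (q 1) > 0" if "q \<in> points M" for q
      using that first_index by (intro u_pos[OF i]) (auto simp: M_simps)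
    \<comment> \<open>The codomain is narrowed to the positive reals, where the logarithm is
      continuous.\<close>
    ultimately have 1: "continuous_map (mtop M) (top_of_set {0<..}) (\<lambda>q. u i (q 1))"
      by (auto simp: continuous_map_in_subtopology)
    have 2: "continuous_map (top_of_set {0<..}) euclideanreal (ln :: real \<Rightarrow> real)"
      by (auto intro!: continuous_intros)
    from continuous_map_compose[OF 1 2] show ?thesis by (simp add: o_def)
  qed
  then have "continuous_map (mtop M) euclideanreal potential"
    unfolding potential_def by (intro continuous_map_sum continuous_map_real_mult_left) auto
  moreover have "compactin (mtop M) (points M)"
    using assms by (simp add: closed_manifold_def compact_space_def)
  ultimately have "compact (potential ` points M)"
    using image_compactin by (metis compactin_euclidean_iff)
  moreover have "potential ` points M \<noteq> {}"
    using assms by (simp add: closed_manifold_def)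
  ultimately obtain y where "y \<in> potential ` points M" "\<forall>z\<in>potential ` points M. z \<le> y"
    using compact_attains_sup by blast
  then show thesis using that by blast
qed

text \<open>Restricted to a line in \<open>F 1\<close> the potential has a local maximum at 0. The
  vanishing of the weighted sum does not give the vanishing of each derivative of u_i; that will
  come from the orthogonality of the H_i, and the second claim takes it as a premise.\<close>

lemma potential_critical:
  assumes c: "c \<in> charts M" and x: "x \<in> cmap M c ` cdom M c"
    and max: "\<And>q. q \<in> points M \<Longrightarrow> potential q \<le> potential (cinv M c x)" and v: "in_block 1 v"
  shows "(\<Sum>i\<in>{2..k}. real (mdim (F i)) * (dwarp c i (part 1 v) (slice 1 x) / warp c i (slice 1 x))) = 0"
    and "(\<And>i. i \<in> {2..k} \<Longrightarrow> dwarp c i (part 1 v) (slice 1 x) = 0) \<Longrightarrow>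
      (\<Sum>i\<in>{2..k}. real (mdim (F i)) * (ddwarp c i (part 1 v) (slice 1 x) / warp c i (slice 1 x))) \<le> 0"
proof -
  let ?b = "part 1 v"
  let ?L = "affine_line (cindex (F 1)) (slice 1 x) ?b"
  let ?V = "cmap (F 1) (c 1) ` cdom (F 1) (c 1)"
  define f where "f s = (\<Sum>i\<in>{2..k}. real (mdim (F i)) * ln (warp c i (?L s)))" for s
  define g where "g s = (\<Sum>i\<in>{2..k}. real (mdim (F i)) * (dwarp c i ?b (?L s) / warp c i (?L s)))" for s
  have z0: "?L 0 = slice 1 x" by (rule first_line_0[OF c x])
  have zV: "slice 1 x \<in> ?V" by (rule slice_in_V[OF c x first_index])
  have ev: "\<forall>\<^sub>F s in nhds 0. ?L s \<in> ?V"
    by (rule affine_line_facts(4)[OF first_chart_facts[OF c] zV])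
  have 1: "\<forall>\<^sub>F s in nhds 0. (f has_real_derivative g s) (at s)"
    using ev
  proof eventually_elim
    case (elim s)
    have "((\<lambda>s. ln (warp c i (?L s))) has_real_derivative dwarp c i ?b (?L s) / warp c i (?L s)) (at s)"
      if i: "i \<in> {2..k}" for i
      using DERIV_warp(1)[OF c i elim] warp_pos[OF c i elim]
      by (auto intro!: derivative_eq_intros simp: field_simps)
    then show ?case unfolding f_def g_def by (intro DERIV_sum DERIV_cmult)
  qed
  \<comment> \<open>The quotient rule for u'/u. Under the premise of the second claim the terms with
    u'^2 disappear and only u''/u remains.\<close>
  define D where "D = (\<Sum>i\<in>{2..k}. real (mdim (F i)) *
    ((ddwarp c i ?b (?L 0) * warp c i (?L 0) - dwarp c i ?b (?L 0) * dwarp c i ?b (?L 0)) / (warp c i (?L 0) * warp c i (?L 0))))"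
  have 2: "(g has_real_derivative D) (at 0)"
    unfolding g_def D_def
  proof (intro DERIV_sum DERIV_cmult DERIV_divide)
    fix i assume i: "i \<in> {2..k}"
    show "warp c i (?L 0) \<noteq> 0" unfolding z0 using warp_pos[OF c i zV] by simp
    have z: "?L 0 \<in> ?V" unfolding z0 by (rule zV)
    show "((\<lambda>s. warp c i (?L s)) has_real_derivative dwarp c i ?b (?L 0)) (at 0)"
      "((\<lambda>s. dwarp c i ?b (?L s)) has_real_derivative ddwarp c i ?b (?L 0)) (at 0)"
      by (rule DERIV_warp[OF c i z])+
  qed
  have pot: "potential (cinv M c (affine_line I x v s)) = f s"
    if "affine_line I x v s \<in> cmap M c ` cdom M c" for s
  proof -
    have "cinv M c (affine_line I x v s) 1 = cinv (F 1) (c 1) (?L s)"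
      by (simp only: cinv_M[OF c that] restrict_apply if_P[OF first_index] slice_line[OF first_index])
    then show ?thesis by (simp only: potential_def f_def warp_def)
  qed
  have x0: "affine_line I x v 0 = x"
    using coordinate_chart_M[OF c] x unfolding coordinate_chart_def M_simps(2) by (intro affine_line_facts(1)) auto
  have 3: "\<forall>\<^sub>F s in nhds 0. f s \<le> f 0"
    using line_eventually_W[OF c x, of v]
  proof eventually_elim
    case (elim s)
    have "cinv M c (affine_line I x v s) \<in> cdom M c"
      using coordinate_chart_cinv(3)[OF coordinate_chart_M[OF c] elim] .
    then have "potential (cinv M c (affine_line I x v s)) \<le> potential (cinv M c x)"
      using max cdom_points[OF c] by blast
    then show ?case using pot[OF elim] pot[of 0] x x0 by simp
  qed
  note R = local_max_second_derivative[OF 1 2 3]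
  show "(\<Sum>i\<in>{2..k}. real (mdim (F i)) * (dwarp c i ?b (slice 1 x) / warp c i (slice 1 x))) = 0"
    using R(1) unfolding g_def z0 .
  assume crit: "\<And>i. i \<in> {2..k} \<Longrightarrow> dwarp c i (part 1 v) (slice 1 x) = 0"
  have "D = (\<Sum>i\<in>{2..k}. real (mdim (F i)) * (ddwarp c i ?b (slice 1 x) / warp c i (slice 1 x)))"
    unfolding D_def z0 by (intro sum.cong refl arg_cong2[where f = "(*)"]) (simp only: crit, simp)
  then show "(\<Sum>i\<in>{2..k}. real (mdim (F i)) * (ddwarp c i ?b (slice 1 x) / warp c i (slice 1 x))) \<le> 0"
    using R(2) by simp
qed

end

section \<open>Mean curvature of the factors\<close>

lemma positive_matrix_subset:
  assumes I: "finite I" and G: "positive_matrix I G" and B: "B \<subseteq> I"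
  shows "positive_matrix B G"
  unfolding positive_matrix_def
proof (intro allI impI)
  fix v :: "'a \<Rightarrow> real" assume v: "\<exists>i\<in>B. v i \<noteq> 0"
  define v' where "v' i = (if i \<in> B then v i else 0)" for i
  have "inner_of I G v' v' = inner_of B G v' v'"
    unfolding inner_of_def using I B
    by (auto simp: v'_def intro!: sum.mono_neutral_cong_right sum.neutral)
  also have "\<dots> = inner_of B G v v" by (intro inner_of_cong) (auto simp: v'_def)
  finally have "inner_of I G v' v' = inner_of B G v v" .
  moreover have "\<exists>i\<in>I. v' i \<noteq> 0" using v B by (auto simp: v'_def)
  ultimately show "inner_of B G v v > 0" using G unfolding positive_matrix_def by metis
qed

lemma inner_of_basis_zero:
  assumes "finite I" "\<And>m. m \<in> I \<Longrightarrow> inner_of I G z (\<lambda>i. if i = m then 1 else 0) = 0"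
  shows "inner_of I G z w = 0"
proof -
  have "inner_of I G z w = inner_of I G z (\<lambda>i. \<Sum>m\<in>I. w m * (if i = m then 1 else 0))"
    using assms(1) by (intro inner_of_cong) (auto simp: if_distrib[of "\<lambda>z. _ * z"] cong: if_cong)
  then show ?thesis using assms(2) by (simp add: inner_of_linear)
qed

context warped_product
begin

abbreviation basis :: "nat \<times> 'i \<Rightarrow> nat \<times> 'i \<Rightarrow> real"
  where "basis m \<equiv> \<lambda>i. if i = m then 1 else 0"

lemma lgram_M:
  assumes c: "c \<in> charts M" and p: "p \<in> cdom M c"
  shows "lgram M c (cmap M c p) = gram M c p"
  by (intro ext) (simp only: lgram_def coordinate_chart_cinv(1)[OF coordinate_chart_M[OF c] p])

lemma inner_gram_commute:
  assumes "c \<in> charts M" "p \<in> cdom M c"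
  shows "inner_of I (gram M c p) v w = inner_of I (gram M c p) w v"
  using gram_M_symmetric[OF assms] unfolding symmetric_matrix_def by (intro inner_of_commute) blast

lemma line_eventually_W':
  assumes c: "c \<in> charts M" and x: "x \<in> cmap M c ` cdom M c" and m: "m \<in> I"
  shows "\<forall>\<^sub>F s in nhds (x m). x(m := s) \<in> cmap M c ` cdom M c"
proof (rule line_eventually_in_open[OF finite_I _ x m])
  show "openin (powertop_real I) (cmap M c ` cdom M c)"
    using coordinate_chart_M[OF c] by (simp add: coordinate_chart_def M_simps(2))
qed

lemma lgram_M_entry:
  assumes c: "c \<in> charts M" and x: "x \<in> cmap M c ` cdom M c" and i: "i \<in> {2..k}"
  shows "lgram M c x (i, a) (i, b) = (warp c i (slice 1 x))\<^sup>2 * lgram (F i) (c i) (slice i x) a b"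
proof -
  have "i \<in> {1..k}" using later_index[OF i] by blast
  from gram_cinv[OF c x this] show ?thesis
    unfolding lgram_def[of M] gram_M scale_cinv[OF c x i] by simp
qed

lemma lgram_M_pderivative_off:
  "fst m \<noteq> fst n \<Longrightarrow> pderivative l (\<lambda>y. lgram M c y m n) x = 0"
  unfolding pderivative_def lgram_def by (cases m; cases n) (simp add: gram_M)

lemma slice_upd:
  "j \<in> {1..k} \<Longrightarrow> e \<in> cindex (F j) \<Longrightarrow> i \<in> {1..k} \<Longrightarrow>
    slice i (x((j, e) := s)) = (if i = j then (slice i x)(e := s) else slice i x)"
  by (auto simp: slice_def fun_eq_iff)

text \<open>The entry is u_i^2, a function on \<open>F 1\<close>, times a function of the
  coordinates of factor \<open>i\<close>; outside block \<open>i\<close> only the logarithmic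
  derivative of u_i^2 can contribute.\<close>

lemma lgram_M_pderivative_block:
  assumes c: "c \<in> charts M" and x: "x \<in> cmap M c ` cdom M c" and i: "i \<in> {2..k}"
    and j: "j \<in> {1..k}" "e \<in> cindex (F j)" "j \<noteq> i"
  shows "pderivative (j, e) (\<lambda>y. lgram M c y (i, a) (i, b)) x =
    (if j = 1 then 2 * (pderivative e (warp c i) (slice 1 x) / warp c i (slice 1 x)) * lgram M c x (i, a) (i, b) else 0)"
proof -
  let ?f = "\<lambda>s. lgram M c (x((j, e) := s)) (i, a) (i, b)"
  have m: "(j, e) \<in> I" using j by blast
  have ev: "\<forall>\<^sub>F s in nhds (x (j, e)). ?f s = (warp c i (slice 1 (x((j, e) := s))))\<^sup>2 * lgram (F i) (c i) (slice i x) a b"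
    using line_eventually_W'[OF c x m]
  proof eventually_elim
    case (elim s)
    have "slice i (x((j, e) := s)) = slice i x"
      using slice_upd[OF j(1,2)] later_index[OF i] j(3) by auto
    then show ?case unfolding lgram_M_entry[OF c elim i] by simp
  qed
  show ?thesis
  proof (cases "j = 1")
    case False
    have "\<forall>\<^sub>F s in nhds (x (j, e)). ?f s = (warp c i (slice 1 x))\<^sup>2 * lgram (F i) (c i) (slice i x) a b"
      using ev by eventually_elim (use slice_upd[OF j(1,2) first_index] False in auto)
    from deriv_cong_ev[OF this refl] show ?thesis using False by (simp add: pderivative_def)
  next
    case True
    have e: "e \<in> cindex (F 1)" using j True by simp
    have z: "slice 1 x \<in> cmap (F 1) (c 1) ` cdom (F 1) (c 1)" by (rule slice_in_V[OF c x first_index])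
    have sx: "slice 1 x e = x (j, e)" using e True by (simp add: slice_def)
    let ?h = "\<lambda>s. warp c i ((slice 1 x)(e := s))"
    have "(slice 1 x)(e := slice 1 x e) \<in> cmap (F 1) (c 1) ` cdom (F 1) (c 1)" using z by simp
    from smooth_on_DERIV_line[OF smooth_warp[OF c i] e this]
    have D: "(?h has_real_derivative pderivative e (warp c i) (slice 1 x)) (at (x (j, e)))"
      unfolding fun_upd_triv unfolding sx .
    have h0: "warp c i ((slice 1 x)(e := x (j, e))) = warp c i (slice 1 x)"
      unfolding sx[symmetric] fun_upd_triv ..
    have ev': "\<forall>\<^sub>F s in nhds (x (j, e)). ?f s = ?h s * ?h s * lgram (F i) (c i) (slice i x) a b"
      using ev by eventually_elim (use slice_upd[OF j(1,2) first_index] True in \<open>simp add: power2_eq_square\<close>)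
    have "((\<lambda>s. ?h s * ?h s * lgram (F i) (c i) (slice i x) a b) has_real_derivative
        (2 * warp c i (slice 1 x) * pderivative e (warp c i) (slice 1 x)) * lgram (F i) (c i) (slice i x) a b) (at (x (j, e)))"
      by (intro DERIV_cmult_right DERIV_cong[OF DERIV_mult[OF D D]]) (simp only: h0, simp)
    then have "deriv ?f (x (j, e)) = (2 * warp c i (slice 1 x) * pderivative e (warp c i) (slice 1 x)) * lgram (F i) (c i) (slice i x) a b"
      using DERIV_imp_deriv deriv_cong_ev[OF ev' refl] by simp
    then show ?thesis
      unfolding pderivative_def[of "(j, e)"] lgram_M_entry[OF c x i] using True warp_pos[OF c i z]
      by (simp add: power2_eq_square)
  qed
qed

text \<open>For \<open>a, b\<close> in block \<open>i\<close> and \<open>m\<close> outside it, the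
  mixed metric entries vanish identically, so the symbol of the first kind reduces to minus half the
  derivative of g_ab in direction \<open>m\<close>. The factor is thus totally umbilical, with
  normal - grad log u_i.\<close>

lemma second_form_inner:
  assumes c: "c = chart_at M p" "c \<in> charts M" and p: "p \<in> cdom M c" and i: "i \<in> {2..k}"
    and ab: "a \<in> {i} \<times> cindex (F i)" "b \<in> {i} \<times> cindex (F i)" and m: "m \<in> I"
  shows "inner_of I (gram M c p) (distribution_second_form M ({i} \<times> cindex (F i)) p a b) (basis m) =
    (if fst m = 1 then - (pderivative (snd m) (warp c i) (slice 1 (cmap M c p)) / warp c i (slice 1 (cmap M c p))) * gram M c p a b else 0)"
proof -
  let ?B = "{i} \<times> cindex (F i)"
  let ?G = "gram M c p"
  define x where "x = cmap M c p"
  have x: "x \<in> cmap M c ` cdom M c" using p by (simp add: x_def)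
  have G: "lgram M c x = ?G" unfolding x_def by (rule lgram_M[OF c(2) p])
  have sym: "symmetric_matrix I ?G" by (rule gram_M_symmetric[OF c(2) p])
  have pos: "positive_matrix I ?G" by (rule gram_M_positive[OF c(2) p])
  have symL: "symmetric_matrix I (lgram M c x)" and posL: "positive_matrix I (lgram M c x)"
    unfolding G by (rule sym, rule pos)
  have i': "i \<in> {1..k}" "i \<noteq> 1" using later_index[OF i] by auto
  have BI: "?B \<subseteq> I" using i' by auto
  let ?w = "\<lambda>l. christoffel M c x l a b"
  \<comment> \<open>Blocks are orthogonal, so splitting the components into those outside and those
    inside block \<open>i\<close> is the orthogonal decomposition.\<close>
  define z where "z l = (if l \<in> ?B then 0 else ?w l)" for l
  define t where "t l = (if l \<in> ?B then ?w l else 0)" for l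
  have ob: "inner_of I ?G v w = 0" if "\<And>l. l \<in> ?B \<Longrightarrow> v l = 0" "\<And>l. l \<in> I \<Longrightarrow> l \<notin> ?B \<Longrightarrow> w l = 0" for v w
  proof -
    have w: "in_block i w" using that(2) by (auto simp: in_block_def)
    have "inner_of I ?G w v = scale i p * inner_of (cindex (F i)) (gram (F i) (c i) (p i)) (part i w) (part i v)"
      by (rule inner_same_block[OF w i'(1)])
    also have "inner_of (cindex (F i)) (gram (F i) (c i) (p i)) (part i w) (part i v) = 0"
      unfolding inner_of_def using that(1) by (intro sum.neutral ballI) auto
    finally show ?thesis
      unfolding inner_gram_commute[OF c(2) p, of v w] by simp
  qed
  have np: "distribution_second_form M ?B p a b l = z l" if l: "l \<in> I" for l
  proof -
    have "distribution_second_form M ?B p a b l = normal_part I ?G (coordinate_distribution I ?B) ?w l"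
      by (simp add: distribution_second_form_def M_simps(2) gram_at_def coords_at_def x_def c(1))
    also have "\<dots> = z l"
    proof (rule normal_part_eq[OF pos _ _ _ _ l])
      show "(\<lambda>i. s i - t i) \<in> coordinate_distribution I ?B"
        if "s \<in> coordinate_distribution I ?B" "t \<in> coordinate_distribution I ?B" for s t
        using that by (auto simp: coordinate_distribution_def)
      show "inner_of I ?G z r = 0" if "r \<in> coordinate_distribution I ?B" for r
        using that by (intro ob) (auto simp: z_def coordinate_distribution_def)
      show "t \<in> coordinate_distribution I ?B" by (auto simp: t_def coordinate_distribution_def)
      show "?w j = z j + t j" for j by (simp add: z_def t_def)
    qed
    finally show ?thesis .
  qed
  have "inner_of I ?G (distribution_second_form M ?B p a b) (basis m) = inner_of I ?G z (basis m)"
    using np by (intro inner_of_cong) auto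
  also have "\<dots> = (if fst m = 1 then - (pderivative (snd m) (warp c i) (slice 1 x) / warp c i (slice 1 x)) * ?G a b else 0)"
  proof (cases "m \<in> ?B")
    case True
    then have "inner_of I ?G z (basis m) = 0" by (intro ob) (auto simp: z_def)
    then show ?thesis using True i'(2) by auto
  next
    case False
    obtain j e where je: "m = (j, e)" "j \<in> {1..k}" "e \<in> cindex (F j)" using m by blast
    have ji: "j \<noteq> i" using False je by auto
    obtain a' b' where a: "a = (i, a')" and b: "b = (i, b')" using ab by auto
    have "inner_of I ?G (basis m) t = 0"
      using False by (intro ob) (auto simp: t_def)
    moreover have "inner_of I ?G (basis m) ?w = inner_of I ?G (basis m) (\<lambda>l. z l + t l)"
      by (intro inner_of_cong) (auto simp: z_def t_def)
    ultimately have "inner_of I ?G (basis m) z = inner_of I ?G (basis m) ?w"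
      by (simp add: inner_of_add_right)
    also have "\<dots> = (\<Sum>l\<in>I. lgram M c x m l * christoffel M c x l a b)"
      unfolding inner_of_delta_left[OF finite_I m] G ..
    also have "\<dots> = (pderivative a (\<lambda>y. lgram M c y b m) x + pderivative b (\<lambda>y. lgram M c y a m) x
       - pderivative m (\<lambda>y. lgram M c y a b) x) / 2"
      by (rule lower_christoffel[of M, unfolded M_simps(2), OF finite_I symL posL m])
    also have "\<dots> = - pderivative m (\<lambda>y. lgram M c y a b) x / 2"
      using ji by (simp add: lgram_M_pderivative_off a b je)
    also have "\<dots> = (if fst m = 1 then - (pderivative (snd m) (warp c i) (slice 1 x) / warp c i (slice 1 x)) * ?G a b else 0)"
      unfolding a b je lgram_M_pderivative_block[OF c(2) x i je(2,3) ji] G by simp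
    finally show ?thesis unfolding inner_gram_commute[OF c(2) p, of z] .
  qed
  finally show ?thesis by (simp add: x_def)
qed

text \<open>This is H_i = - n_i grad log u_i, tested against coordinate vectors so that no index
  needs to be raised. The trace of the metric over the block supplies n_i.\<close>

lemma factor_mean_curvature_inner:
  assumes c: "c = chart_at M p" "c \<in> charts M" and p: "p \<in> cdom M c" and i: "i \<in> {2..k}" and m: "m \<in> I"
  shows "inner_at M p (factor_mean_curvature k F u i p) (basis m) =
    (if fst m = 1 then - (real (mdim (F i)) *
       (pderivative (snd m) (warp c i) (slice 1 (cmap M c p)) / warp c i (slice 1 (cmap M c p)))) else 0)"
proof -
  let ?B = "{i} \<times> cindex (F i)" and ?G = "gram M c p"
  let ?r = "pderivative (snd m) (warp c i) (slice 1 (cmap M c p)) / warp c i (slice 1 (cmap M c p))"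
  have BI: "?B \<subseteq> I" using later_index[OF i] by auto
  have fB: "finite ?B" using finite_subset[OF BI finite_I] .
  have sym: "symmetric_matrix ?B ?G"
    using gram_M_symmetric[OF c(2) p] BI unfolding symmetric_matrix_def by blast
  have pos: "positive_matrix ?B ?G"
    by (rule positive_matrix_subset[OF finite_I gram_M_positive[OF c(2) p] BI])
  have "inner_at M p (factor_mean_curvature k F u i p) (basis m)
    = (\<Sum>a\<in>?B. \<Sum>b\<in>?B. inverse_matrix ?B ?G a b * inner_of I ?G (distribution_second_form M ?B p a b) (basis m))"
    unfolding inner_at_def factor_mean_curvature_def distribution_mean_curvature_def[abs_def] M_simps(2)
      gram_at_def c(1)[symmetric] by (simp only: inner_of_linear)
  also have "\<dots> = (\<Sum>a\<in>?B. \<Sum>b\<in>?B. inverse_matrix ?B ?G a b * (if fst m = 1 then - ?r * ?G a b else 0))"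
    by (intro sum.cong refl arg_cong2[where f = "(*)"] second_form_inner[OF c p i _ _ m])
  also have "\<dots> = (if fst m = 1 then - ?r * (\<Sum>a\<in>?B. \<Sum>b\<in>?B. inverse_matrix ?B ?G a b * ?G a b) else 0)"
    by (simp add: sum_distrib_left sum_negf mult_ac)
  also have "(\<Sum>a\<in>?B. \<Sum>b\<in>?B. inverse_matrix ?B ?G a b * ?G a b) = real (mdim (F i))"
    unfolding inverse_matrix_trace[OF fB sym pos] by (simp add: mdim_def card_cartesian_product)
  finally show ?thesis by (simp add: mult_ac)
qed

text \<open>At the maximum the sum of the H_j is zero. Pairing it with H_i leaves |H_i|^2 by
  orthogonality, so H_i = 0, and n_i \<ge> 1 permits solving for the derivative of u_i.\<close>

lemma dwarp_zero_at_max: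
  assumes c: "c = chart_at M p" "c \<in> charts M" and p: "p \<in> cdom M c"
    and dim: "\<And>i. i \<in> {1..k} \<Longrightarrow> mdim (F i) \<ge> 1"
    and max: "\<And>q. q \<in> points M \<Longrightarrow> potential q \<le> potential p"
    and orth: "\<And>i j. i \<in> {1..k} \<Longrightarrow> j \<in> {1..k} \<Longrightarrow> i \<noteq> j \<Longrightarrow>
      inner_at M p (factor_mean_curvature k F u i p) (factor_mean_curvature k F u j p) = 0"
    and i: "i \<in> {2..k}"
  shows "dwarp c i b (slice 1 (cmap M c p)) = 0"
proof -
  let ?H = "\<lambda>i. factor_mean_curvature k F u i p"
  let ?z = "slice 1 (cmap M c p)"
  let ?G = "gram M c p"
  have ia: "inner_at M p = inner_of I ?G" by (simp add: inner_at_def gram_at_def M_simps(2) c(1))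
  have x: "cmap M c p \<in> cmap M c ` cdom M c" using p by simp
  have zV: "?z \<in> cmap (F 1) (c 1) ` cdom (F 1) (c 1)" by (rule slice_in_V[OF c(2) x first_index])
  have max': "\<And>q. q \<in> points M \<Longrightarrow> potential q \<le> potential (cinv M c (cmap M c p))"
    using max coordinate_chart_cinv(1)[OF coordinate_chart_M[OF c(2)] p] by simp
  have fin1: "finite (cindex (F 1))" by (rule first_chart_facts(1)[OF c(2)])
  \<comment> \<open>In directions of \<open>F 1\<close> this is the criticality of the potential; in
    the other directions each H_j is orthogonal to the coordinate vector.\<close>
  have sum0: "inner_at M p (\<lambda>l. \<Sum>j\<in>{2..k}. ?H j l) (basis m) = 0" if m: "m \<in> I" for m
  proof (cases "fst m = 1")
    case True
    then obtain e where e: "m = (1, e)" "e \<in> cindex (F 1)" using m by auto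
    have dw: "dwarp c j (part 1 (basis m)) ?z = pderivative e (warp c j) ?z" for j
      using fin1 e by (simp add: dwarp_def if_distrib[of "\<lambda>z. _ * z"] cong: if_cong)
    have "in_block 1 (basis m)" using e by (auto simp: in_block_def)
    from potential_critical(1)[OF c(2) x max' this]
    have "(\<Sum>j\<in>{2..k}. real (mdim (F j)) * (pderivative e (warp c j) ?z / warp c j ?z)) = 0"
      unfolding dw .
    moreover have "inner_at M p (\<lambda>l. \<Sum>j\<in>{2..k}. ?H j l) (basis m)
        = (\<Sum>j\<in>{2..k}. - (real (mdim (F j)) * (pderivative e (warp c j) ?z / warp c j ?z)))"
      unfolding ia inner_of_sum_left unfolding ia[symmetric]
    proof (intro sum.cong refl)
      fix j assume j: "j \<in> {2..k}"
      show "inner_at M p (?H j) (basis m) = - (real (mdim (F j)) * (pderivative e (warp c j) ?z / warp c j ?z))"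
        unfolding factor_mean_curvature_inner[OF c p j m] by (simp add: e(1))
    qed
    ultimately show ?thesis by (simp add: sum_negf)
  next
    case False
    have "inner_at M p (\<lambda>l. \<Sum>j\<in>{2..k}. ?H j l) (basis m) = (\<Sum>j\<in>{2..k}. inner_at M p (?H j) (basis m))"
      unfolding ia inner_of_sum_left ..
    also have "\<dots> = 0"
      using False by (intro sum.neutral ballI) (simp add: factor_mean_curvature_inner[OF c p _ m])
    finally show ?thesis .
  qed
  have all0: "inner_at M p (\<lambda>l. \<Sum>j\<in>{2..k}. ?H j l) w = 0" for w
    unfolding ia by (rule inner_of_basis_zero[OF finite_I]) (use sum0 ia in auto)
  have "inner_at M p (\<lambda>l. \<Sum>j\<in>{2..k}. ?H j l) (?H i) = (\<Sum>j\<in>{2..k}. if j = i then inner_at M p (?H i) (?H i) else 0)"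
    unfolding ia inner_of_sum_left unfolding ia[symmetric]
    using orth i by (intro sum.cong refl) auto
  then have "inner_of I ?G (?H i) (?H i) = 0" using all0 i by (simp add: ia)
  then have H0: "?H i m = 0" if "m \<in> I" for m
    using positive_matrix_zero[OF gram_M_positive[OF c(2) p] _ that] by blast
  have "pderivative e (warp c i) ?z = 0" if e: "e \<in> cindex (F 1)" for e
  proof -
    have m: "(1, e) \<in> I" using e first_index by blast
    have "inner_at M p (?H i) (basis (1, e)) = 0"
      unfolding ia inner_of_def using H0 by simp
    then have "real (mdim (F i)) * (pderivative e (warp c i) ?z / warp c i ?z) = 0"
      unfolding factor_mean_curvature_inner[OF c p i m] by simp
    moreover have "mdim (F i) \<ge> 1" using dim later_index[OF i] by blast
    ultimately show ?thesis using warp_pos[OF c(2) i zV] by simp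
  qed
  then show ?thesis by (simp add: dwarp_def)
qed

end

section \<open>The curvature inequality\<close>

text \<open>The normal projection, written by means of an orthonormal frame of the tangent space. In
  contrast to the choice in \<open>normal_part\<close> it is visibly linear.\<close>

definition perp :: "'s set \<Rightarrow> 'j set \<Rightarrow> ('j \<Rightarrow> 'j \<Rightarrow> real) \<Rightarrow> ('s \<Rightarrow> 'j \<Rightarrow> real) \<Rightarrow> ('j \<Rightarrow> real) \<Rightarrow> 'j \<Rightarrow> real"
  where "perp S J G E X \<alpha> = X \<alpha> - (\<Sum>s\<in>S. inner_of J G X (E s) * E s \<alpha>)"

lemma perp_sum: "perp S J G E (\<lambda>\<alpha>. \<Sum>m\<in>A. w m * X m \<alpha>) \<alpha> = (\<Sum>m\<in>A. w m * perp S J G E (X m) \<alpha>)"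
proof -
  have "(\<Sum>s\<in>S. inner_of J G (\<lambda>\<alpha>. \<Sum>m\<in>A. w m * X m \<alpha>) (E s) * E s \<alpha>)
    = (\<Sum>s\<in>S. \<Sum>m\<in>A. w m * (inner_of J G (X m) (E s) * E s \<alpha>))"
    by (simp add: inner_of_linear sum_distrib_right mult.assoc)
  also have "\<dots> = (\<Sum>m\<in>A. w m * (\<Sum>s\<in>S. inner_of J G (X m) (E s) * E s \<alpha>))"
    by (subst sum.swap) (simp add: sum_distrib_left)
  finally show ?thesis by (simp add: perp_def right_diff_distrib sum_subtractf)
qed

lemma perp_cong:
  "(\<And>\<beta>. \<beta> \<in> J \<Longrightarrow> X \<beta> = Y \<beta>) \<Longrightarrow> \<alpha> \<in> J \<Longrightarrow> perp S J G E X \<alpha> = perp S J G E Y \<alpha>"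
  using inner_of_cong[of J X Y] by (simp add: perp_def)

lemma inner_perp_frame:
  assumes S: "finite S" and E: "\<And>r s. r \<in> S \<Longrightarrow> s \<in> S \<Longrightarrow> inner_of J G (E r) (E s) = (if r = s then 1 else 0)"
    and r: "r \<in> S"
  shows "inner_of J G (perp S J G E X) (E r) = 0"
proof -
  have "inner_of J G (perp S J G E X) (E r)
      = inner_of J G X (E r) - (\<Sum>s\<in>S. inner_of J G X (E s) * inner_of J G (E s) (E r))"
    unfolding perp_def by (simp only: inner_of_linear)
  also have "(\<Sum>s\<in>S. inner_of J G X (E s) * inner_of J G (E s) (E r)) = (\<Sum>s\<in>S. if s = r then inner_of J G X (E r) else 0)"
    using E r by (intro sum.cong) auto
  finally show ?thesis using S r by simp
qed

text \<open>The inner product splits into normal and tangential contributions; the subtracted sum is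
  the inner product of the tangential parts.\<close>

lemma inner_perp_perp:
  assumes S: "finite S" and E: "\<And>r s. r \<in> S \<Longrightarrow> s \<in> S \<Longrightarrow> inner_of J G (E r) (E s) = (if r = s then 1 else 0)"
    and G: "symmetric_matrix J G"
  shows "inner_of J G (perp S J G E X) (perp S J G E Y)
    = inner_of J G X Y - (\<Sum>s\<in>S. inner_of J G X (E s) * inner_of J G Y (E s))"
proof -
  have comm: "inner_of J G v w = inner_of J G w v" for v w
    using G unfolding symmetric_matrix_def by (intro inner_of_commute) blast
  have "inner_of J G (perp S J G E X) (perp S J G E Y) = inner_of J G (perp S J G E X) Y
      - (\<Sum>s\<in>S. inner_of J G Y (E s) * inner_of J G (perp S J G E X) (E s))"
    unfolding perp_def[of S J G E Y] by (simp only: inner_of_linear)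
  also have "(\<Sum>s\<in>S. inner_of J G Y (E s) * inner_of J G (perp S J G E X) (E s)) = 0"
    using inner_perp_frame[OF S E] by (intro sum.neutral) simp
  also have "inner_of J G (perp S J G E X) Y = inner_of J G X Y - (\<Sum>s\<in>S. inner_of J G X (E s) * inner_of J G (E s) Y)"
    unfolding perp_def by (simp only: inner_of_linear)
  finally show ?thesis by (simp add: comm[of Y])
qed

lemma normal_part_perp:
  assumes S: "finite S" and E: "\<And>r s. r \<in> S \<Longrightarrow> s \<in> S \<Longrightarrow> inner_of J G (E r) (E s) = (if r = s then 1 else 0)"
    and G: "positive_matrix J G" and \<alpha>: "\<alpha> \<in> J"
  shows "normal_part J G (range (\<lambda>c \<alpha>. \<Sum>r\<in>S. c r * E r \<alpha>)) X \<alpha> = perp S J G E X \<alpha>"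
proof (rule normal_part_eq[OF G _ _ _ _ \<alpha>])
  let ?T = "range (\<lambda>c \<alpha>. \<Sum>r\<in>S. c r * E r \<alpha>)"
  show "(\<lambda>i. s i - t i) \<in> ?T" if st: "s \<in> ?T" "t \<in> ?T" for s t
  proof -
    obtain a b where "s = (\<lambda>\<alpha>. \<Sum>r\<in>S. a r * E r \<alpha>)" "t = (\<lambda>\<alpha>. \<Sum>r\<in>S. b r * E r \<alpha>)" using st by blast
    then have "(\<lambda>i. s i - t i) = (\<lambda>\<alpha>. \<Sum>r\<in>S. (a r - b r) * E r \<alpha>)"
      by (simp add: left_diff_distrib sum_subtractf)
    then show ?thesis by (intro image_eqI[where x = "\<lambda>r. a r - b r"]) auto
  qed
  show "inner_of J G (perp S J G E X) t = 0" if t: "t \<in> ?T" for t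
  proof -
    obtain b where "t = (\<lambda>\<alpha>. \<Sum>r\<in>S. b r * E r \<alpha>)" using t by blast
    then show ?thesis using inner_perp_frame[OF S E] by (simp add: inner_of_linear)
  qed
  show "(\<lambda>\<alpha>. \<Sum>s\<in>S. inner_of J G X (E s) * E s \<alpha>) \<in> ?T"
    by (intro image_eqI[where x = "\<lambda>s. inner_of J G X (E s)"]) auto
  show "X i = perp S J G E X i + (\<Sum>s\<in>S. inner_of J G X (E s) * E s i)" for i
    by (simp add: perp_def)
qed

section \<open>The immersion in the charts chosen at one point and its image\<close>

locale immersed_product = warped_product k F u
  for k :: nat and F :: "nat \<Rightarrow> ('a, 'c, 'i) riem_manifold" and u :: "nat \<Rightarrow> 'a \<Rightarrow> real" +
  fixes N :: "('b, 'd, 'j) riem_manifold" and f :: "(nat \<Rightarrow> 'a) \<Rightarrow> 'b" and p :: "nat \<Rightarrow> 'a"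
  assumes N: "riemannian_manifold N" and f: "isometric_immersion (multiply_warped_product k F u) N f"
    and p: "p \<in> points (multiply_warped_product k F u)"
begin

definition c where "c = chart_at M p"
definition d where "d = chart_at N (f p)"
definition x where "x = cmap M c p"
definition \<Phi> where "\<Phi> y = cmap N d (f (cinv M c y))"
definition U where "U = {y \<in> cmap M c ` cdom M c. cinv M c y \<in> {q \<in> points M. f q \<in> cdom N d}}"

lemma chart_c: "c \<in> charts M" "p \<in> cdom M c"
  using chart_at[of M p] c1_manifold_M p by (auto simp: c_def c1_manifold_def)

lemma continuous_f: "continuous_map (mtop M) (mtop N) f"
  using f by (simp add: isometric_immersion_def smooth_map_def)

lemma fp: "f p \<in> points N"
  using continuous_f p by (auto simp: continuous_map_def)

lemma chart_d: "d \<in> charts N" "f p \<in> cdom N d"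
  using chart_at[of N "f p"] N fp by (auto simp: d_def riemannian_manifold_def topological_manifold_def)

lemma U_eq: "U = cmap M c ` (cdom M c \<inter> f -` cdom N d)"
proof -
  have "q \<in> points M" if "q \<in> cdom M c" for q using that cdom_points chart_c by blast
  then show ?thesis
    using coordinate_chart_cinv(1)[OF coordinate_chart_M[OF chart_c(1)]] unfolding U_def by auto
qed

lemma local_rep_\<Phi>: "local_rep M N f c d \<alpha> = (\<lambda>y. \<Phi> y \<alpha>)"
  by (simp add: local_rep_def \<Phi>_def fun_eq_iff)

sublocale cm: chart_map N d I U \<Phi>
proof unfold_locales
  show "riemannian_manifold N" by (rule N)
  show "d \<in> charts N" by (rule chart_d)
  show "finite I" by (rule finite_I)
  show "openin (powertop_real I) U"
  proof -
    have "openin (mtop N) (cdom N d)"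
      using riemannian_chart.open_cdom[OF riemannian_chart.intro[OF N chart_d(1)]] .
    from openin_continuous_map_preimage[OF continuous_f this]
    show ?thesis
      unfolding U_def using coordinate_chart_preimage_open[OF coordinate_chart_M[OF chart_c(1)]]
      by (simp only: M_simps(2))
  qed
  show "smooth_on I U (\<lambda>y. \<Phi> y \<alpha>)" if "\<alpha> \<in> cindex N" for \<alpha>
    using f chart_c(1) chart_d(1) that
    unfolding isometric_immersion_def smooth_map_def U_eq local_rep_\<Phi>[symmetric] M_simps(2)[symmetric] by blast
  show "\<Phi> y \<in> cmap N d ` cdom N d" if "y \<in> U" for y
    using that by (auto simp: U_def \<Phi>_def)
qed

lemma U_W: "y \<in> U \<Longrightarrow> y \<in> cmap M c ` cdom M c"
  by (simp add: U_def)

lemma cinv_x: "cinv M c x = p"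
  unfolding x_def by (rule coordinate_chart_cinv(1)[OF coordinate_chart_M[OF chart_c(1)] chart_c(2)])

lemma coords_x: "coords_at M p = x"
  by (simp add: coords_at_def x_def c_def)

lemma x_U: "x \<in> U"
  using chart_c chart_d unfolding U_eq x_def by blast

lemma \<Phi>_x: "\<Phi> x = coords_at N (f p)"
  by (simp add: \<Phi>_def cinv_x coords_at_def d_def)

lemma inner_at_N: "inner_at N (f p) = cm.ip (\<Phi> x)"
  unfolding \<Phi>_x by (rule cm.pointwise_at(3)[OF d_def chart_d(2)])

lemma gram_at_N: "gram_at N (f p) = lgram N d (\<Phi> x)"
  unfolding \<Phi>_def cinv_x by (simp add: gram_at_def d_def[symmetric] cm.lgram_cmap[OF chart_d(2)])

lemma differential_d1: "differential M N f p v = cm.d1 v x"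
  unfolding differential_def cm.d1_def
  by (simp add: fun_eq_iff coords_at_def x_def M_simps(2) c_def[symmetric] d_def[symmetric] local_rep_\<Phi>)

text \<open>Having this throughout \<open>U\<close>, and not just at \<open>x\<close>, is what
  allows differentiating it. The definition of an isometric immersion changes charts from point to
  point, so the version in fixed charts is invoked.\<close>

lemma isometry:
  assumes y: "y \<in> U"
  shows "cm.ip (\<Phi> y) (cm.d1 v y) (cm.d1 w y) = inner_of I (gram M c (cinv M c y)) v w"
proof -
  let ?q = "cinv M c y"
  have q: "?q \<in> cdom M c" "f ?q \<in> cdom N d" "cmap M c ?q = y"
    using y coordinate_chart_cinv(2,3)[OF coordinate_chart_M[OF chart_c(1)]] by (auto simp: U_def)
  have lg: "lgram N d (\<Phi> y) = gram N d (f ?q)"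
    unfolding \<Phi>_def by (rule cm.lgram_cmap[OF q(2)])
  have g: "cm.ip (\<Phi> y) (\<lambda>\<alpha>. cm.P i \<alpha> y) (\<lambda>\<alpha>. cm.P j \<alpha> y) = gram M c ?q i j" if "i \<in> I" "j \<in> I" for i j
    using isometric_in_charts[OF c1_manifold_M N f chart_c(1) chart_d(1), OF q(1,2), where i = i and j = j] that
    unfolding lg q(3) local_rep_\<Phi> M_simps(2) by blast
  have d1: "cm.d1 v y = (\<lambda>\<alpha>. \<Sum>i\<in>I. v i * cm.P i \<alpha> y)" for v
    by (rule ext) (simp only: cm.d1_def mult.commute)
  have "cm.ip (\<Phi> y) (cm.d1 v y) (cm.d1 w y)
      = (\<Sum>i\<in>I. v i * (\<Sum>j\<in>I. w j * cm.ip (\<Phi> y) (\<lambda>\<alpha>. cm.P i \<alpha> y) (\<lambda>\<alpha>. cm.P j \<alpha> y)))"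
    unfolding d1 inner_of_sum_left inner_of_scale_left inner_of_sum_right inner_of_scale_right ..
  also have "\<dots> = inner_of I (gram M c ?q) v w"
    unfolding inner_of_def[of I] sum_distrib_left by (intro sum.cong refl) (simp add: g)
  finally show ?thesis .
qed

lemma DERIV_isometry:
  assumes y: "y \<in> U" and D: "((\<lambda>s. norm2 c v (affine_line I y w s)) has_real_derivative D) (at 0)"
  shows "((\<lambda>s. cm.ip (\<Phi> (affine_line I y w s)) (cm.d1 v (affine_line I y w s)) (cm.d1 v (affine_line I y w s)))
    has_real_derivative D) (at 0)"
proof -
  have "\<forall>\<^sub>F s in nhds 0. affine_line I y w s \<in> U"
    by (rule affine_line_facts(4)[OF finite_I cm.open_U y])
  then have "\<forall>\<^sub>F s in nhds 0. cm.ip (\<Phi> (affine_line I y w s)) (cm.d1 v (affine_line I y w s)) (cm.d1 v (affine_line I y w s))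
      = norm2 c v (affine_line I y w s)"
    by eventually_elim (rule isometry)
  from DERIV_cong_ev[OF refl this refl] D show ?thesis by simp
qed

text \<open>Links \<open>cm.hess\<close> with \<open>covariant_hessian\<close>, so that a trace in
  the coordinate basis can be rewritten as a sum over a frame.\<close>

lemma hess_bilinear:
  assumes "\<alpha> \<in> cindex N"
  shows "cm.hess v w x \<alpha> = (\<Sum>i\<in>I. v i * (\<Sum>j\<in>I. w j * covariant_hessian M N f p i j \<alpha>))"
proof -
  have cov: "covariant_hessian M N f p i j \<alpha> = pderivative i (cm.P j \<alpha>) x
      + conn N d (\<Phi> x) (\<lambda>\<beta>. cm.P i \<beta> x) (\<lambda>\<gamma>. cm.P j \<gamma> x) \<alpha>" for i j
    unfolding covariant_hessian_def Let_def conn_def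
    by (simp only: c_def[symmetric] d_def[symmetric] local_rep_\<Phi> \<Phi>_x[symmetric] coords_x)
  have conn_inner: "conn N d (\<Phi> x) a b \<alpha> = inner_of (cindex N) (christoffel N d (\<Phi> x) \<alpha>) a b" for a b
    by (simp add: conn_def inner_of_def)
  have d1: "cm.d1 v x = (\<lambda>\<alpha>. \<Sum>i\<in>I. v i * cm.P i \<alpha> x)" for v
    by (rule ext) (simp only: cm.d1_def mult.commute)
  have 1: "conn N d (\<Phi> x) (cm.d1 v x) (cm.d1 w x) \<alpha>
      = (\<Sum>i\<in>I. v i * (\<Sum>j\<in>I. w j * conn N d (\<Phi> x) (\<lambda>\<beta>. cm.P i \<beta> x) (\<lambda>\<gamma>. cm.P j \<gamma> x) \<alpha>))"
    unfolding conn_inner d1 inner_of_sum_left inner_of_scale_left inner_of_sum_right inner_of_scale_right ..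
  have "cm.d2 v w x \<alpha> = (\<Sum>j\<in>I. \<Sum>i\<in>I. v i * (w j * pderivative i (cm.P j \<alpha>) x))"
    unfolding cm.d2_def by (simp add: sum_distrib_left sum_distrib_right mult_ac)
  also have "\<dots> = (\<Sum>i\<in>I. v i * (\<Sum>j\<in>I. w j * pderivative i (cm.P j \<alpha>) x))"
    by (subst sum.swap) (simp add: sum_distrib_left)
  finally have 2: "cm.d2 v w x \<alpha> = (\<Sum>i\<in>I. v i * (\<Sum>j\<in>I. w j * pderivative i (cm.P j \<alpha>) x))" .
  show ?thesis unfolding cm.hess_def 1 2 cov by (simp add: distrib_left sum.distrib)
qed

end

text \<open>The frame is orthonormal at \<open>p\<close> only. Elsewhere its vectors keep their
  coordinate components, so they stay in their blocks and vectors of different blocks remain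
  orthogonal, which is enough for the Gauss equation.\<close>

locale framed_immersed_product = immersed_product k F u N f p
  for k :: nat and F :: "nat \<Rightarrow> ('a, 'c, 'i) riem_manifold" and u :: "nat \<Rightarrow> 'a \<Rightarrow> real"
    and N :: "('b, 'd, 'j) riem_manifold" and f :: "(nat \<Rightarrow> 'a) \<Rightarrow> 'b" and p :: "nat \<Rightarrow> 'a" +
  fixes e :: "nat \<times> 'i \<Rightarrow> nat \<times> 'i \<Rightarrow> real"
  assumes frame: "orthonormal_frame I (gram (multiply_warped_product k F u) c p) e"
    and e_block: "\<And>r. r \<in> Sigma {1..k} (\<lambda>i. cindex (F i)) \<Longrightarrow> in_block (fst r) (e r)"
begin

definition E where "E r = cm.d1 (e r) x"

abbreviation G where "G \<equiv> lgram N d (\<Phi> x)"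
abbreviation nor where "nor \<equiv> perp I (cindex N) G E"
abbreviation h where "h r \<equiv> cm.hess (e r) (e r) x"

definition B1 where "B1 = {1 :: nat} \<times> cindex (F 1)"
definition B2 where "B2 = Sigma {2..k} (\<lambda>i. cindex (F i))"

lemma blocks: "I = B1 \<union> B2" "B1 \<inter> B2 = {}" "finite B1" "finite B2"
proof -
  have "{1..k} = insert 1 {2..k}" using k by auto
  then show 1: "I = B1 \<union> B2" by (auto simp: B1_def B2_def)
  show "B1 \<inter> B2 = {}" by (auto simp: B1_def B2_def)
  show "finite B1" "finite B2" using finite_I unfolding 1 by auto
qed

lemma e_B1: "r \<in> B1 \<Longrightarrow> r \<in> I \<and> in_block 1 (e r)"
  using e_block[of r] blocks(1) by (auto simp: B1_def)

lemma e_B2: "q \<in> B2 \<Longrightarrow> q \<in> I \<and> in_block (fst q) (e q) \<and> fst q \<in> {2..k}"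
  using e_block[of q] blocks(1) by (auto simp: B2_def)

lemma orthonormal_E: "r \<in> I \<Longrightarrow> s \<in> I \<Longrightarrow> cm.ip (\<Phi> x) (E r) (E s) = (if r = s then 1 else 0)"
  unfolding E_def isometry[OF x_U] cinv_x using frame unfolding orthonormal_frame_def by blast

lemma sum_blocks: "sum g I = sum g B1 + sum g B2"
  unfolding blocks(1) by (rule sum.union_disjoint[OF blocks(3,4,2)])

lemma range_differential: "range (differential M N f p) = range (\<lambda>w \<alpha>. \<Sum>r\<in>I. w r * E r \<alpha>)"
proof -
  have comb: "cm.d1 (\<lambda>i. \<Sum>r\<in>I. w r * e r i) x = (\<lambda>\<alpha>. \<Sum>r\<in>I. w r * E r \<alpha>)" for w
  proof
    fix \<alpha>
    have "cm.d1 (\<lambda>i. \<Sum>r\<in>I. w r * e r i) x \<alpha> = (\<Sum>i\<in>I. \<Sum>r\<in>I. w r * (cm.P i \<alpha> x * e r i))"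
      unfolding cm.d1_def sum_distrib_left by (intro sum.cong refl) (simp only: mult_ac)
    also have "\<dots> = (\<Sum>r\<in>I. w r * E r \<alpha>)"
      unfolding E_def cm.d1_def sum_distrib_left by (rule sum.swap)
    finally show "cm.d1 (\<lambda>i. \<Sum>r\<in>I. w r * e r i) x \<alpha> = (\<Sum>r\<in>I. w r * E r \<alpha>)" .
  qed
  have "\<exists>w. cm.d1 v x = (\<lambda>\<alpha>. \<Sum>r\<in>I. w r * E r \<alpha>)" for v
  proof -
    obtain w where "\<forall>i\<in>I. v i = (\<Sum>r\<in>I. w r * e r i)" using frame unfolding orthonormal_frame_def by blast
    then have "cm.d1 v x = cm.d1 (\<lambda>i. \<Sum>r\<in>I. w r * e r i) x"
      by (intro ext) (simp only: cm.d1_def cong: sum.cong)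
    then show ?thesis unfolding comb by blast
  qed
  then have "differential M N f p v \<in> range (\<lambda>w \<alpha>. \<Sum>r\<in>I. w r * E r \<alpha>)" for v
    unfolding differential_d1 by (simp only: image_iff) blast
  moreover have "(\<lambda>\<alpha>. \<Sum>r\<in>I. w r * E r \<alpha>) \<in> range (differential M N f p)" for w
    unfolding comb[symmetric] differential_d1[symmetric] by (rule rangeI)
  ultimately show ?thesis by (intro subset_antisym image_subsetI)
qed

lemma sym_G: "symmetric_matrix (cindex N) G" and pos_G: "positive_matrix (cindex N) G"
  using cm.sym_lgram[OF cm.\<Phi>_V[OF x_U]] cm.pos_lgram[OF cm.\<Phi>_V[OF x_U]] .

text \<open>The inverse Gram matrix is the sum of the products of frame components, and the normal
  projection is linear.\<close>

lemma mean_curvature_frame: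
  assumes \<alpha>: "\<alpha> \<in> cindex N"
  shows "mean_curvature_vector M N f p \<alpha> = (\<Sum>r\<in>I. nor (h r) \<alpha>) / real (card I)"
proof -
  have II: "second_fundamental_form M N f p i j \<alpha> = nor (covariant_hessian M N f p i j) \<alpha>" for i j
    unfolding second_fundamental_form_def gram_at_N range_differential
    by (rule normal_part_perp[OF finite_I orthonormal_E pos_G \<alpha>])
  have inv: "inverse_matrix I (gram_at M p) i j = (\<Sum>r\<in>I. e r i * e r j)" if "i \<in> I" "j \<in> I" for i j
    unfolding gram_at_def c_def[symmetric]
    by (rule inverse_matrix_frame[OF frame finite_I gram_M_symmetric[OF chart_c] that])
  let ?Q = "\<lambda>i j. nor (covariant_hessian M N f p i j) \<alpha>"
  have nh: "nor (h r) \<alpha> = (\<Sum>i\<in>I. e r i * (\<Sum>j\<in>I. e r j * ?Q i j))" for r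
  proof -
    have "nor (h r) \<alpha> = nor (\<lambda>\<alpha>. \<Sum>i\<in>I. e r i * (\<Sum>j\<in>I. e r j * covariant_hessian M N f p i j \<alpha>)) \<alpha>"
      using hess_bilinear by (intro perp_cong \<alpha>) auto
    then show ?thesis unfolding perp_sum .
  qed
  have "(\<Sum>i\<in>I. \<Sum>j\<in>I. inverse_matrix I (gram_at M p) i j * second_fundamental_form M N f p i j \<alpha>)
      = (\<Sum>i\<in>I. \<Sum>j\<in>I. \<Sum>r\<in>I. e r i * (e r j * ?Q i j))"
    by (intro sum.cong refl) (simp only: inv II sum_distrib_right mult.assoc)
  also have "\<dots> = (\<Sum>i\<in>I. \<Sum>r\<in>I. \<Sum>j\<in>I. e r i * (e r j * ?Q i j))"
    by (intro sum.cong refl sum.swap)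
  also have "\<dots> = (\<Sum>r\<in>I. \<Sum>i\<in>I. \<Sum>j\<in>I. e r i * (e r j * ?Q i j))"
    by (rule sum.swap)
  also have "\<dots> = (\<Sum>r\<in>I. nor (h r) \<alpha>)" unfolding nh by (simp add: sum_distrib_left)
  finally show ?thesis unfolding mean_curvature_vector_def mdim_def M_simps(2) by simp
qed

text \<open>With S1 and S2 the normal traces over the two groups of frame vectors, n H = S1 + S2,
  and 4 <S1, S2> \<le> |S1 + S2|^2 because |S1 - S2|^2 \<ge> 0.\<close>

lemma squared_mean_curvature_bound:
  "4 * (\<Sum>r\<in>B1. \<Sum>q\<in>B2. cm.ip (\<Phi> x) (nor (h r)) (nor (h q)))
    \<le> (real (card I))\<^sup>2 * squared_mean_curvature M N f p"
proof (cases "card I = 0")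
  case True
  then have "I = {}" using finite_I by simp
  then have "B1 = {}" using blocks by auto
  then show ?thesis using True by simp
next
  case False
  define S1 where "S1 \<alpha> = (\<Sum>r\<in>B1. nor (h r) \<alpha>)" for \<alpha>
  define S2 where "S2 \<alpha> = (\<Sum>q\<in>B2. nor (h q) \<alpha>)" for \<alpha>
  let ?n = "real (card I)"
  have comm: "cm.ip (\<Phi> x) v w = cm.ip (\<Phi> x) w v" for v w by (rule cm.ip_commute[OF cm.\<Phi>_V[OF x_U]])
  have "mean_curvature_vector M N f p \<alpha> = (S1 \<alpha> + S2 \<alpha>) / ?n" if "\<alpha> \<in> cindex N" for \<alpha>
    unfolding mean_curvature_frame[OF that] S1_def S2_def sum_blocks ..
  then have "squared_mean_curvature M N f p = cm.ip (\<Phi> x) (\<lambda>\<alpha>. (S1 \<alpha> + S2 \<alpha>) / ?n) (\<lambda>\<alpha>. (S1 \<alpha> + S2 \<alpha>) / ?n)"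
    unfolding squared_mean_curvature_def inner_at_N by (intro inner_of_cong) auto
  then have 1: "?n\<^sup>2 * squared_mean_curvature M N f p
      = cm.ip (\<Phi> x) S1 S1 + 2 * cm.ip (\<Phi> x) S1 S2 + cm.ip (\<Phi> x) S2 S2"
    using False comm[of S2 S1]
    by (simp add: inner_of_divide_left inner_of_divide_right inner_of_add_left inner_of_add_right power2_eq_square)
  have "0 \<le> cm.ip (\<Phi> x) (\<lambda>\<alpha>. S1 \<alpha> - S2 \<alpha>) (\<lambda>\<alpha>. S1 \<alpha> - S2 \<alpha>)"
    by (rule positive_matrix_nonneg[OF pos_G])
  then have 2: "2 * cm.ip (\<Phi> x) S1 S2 \<le> cm.ip (\<Phi> x) S1 S1 + cm.ip (\<Phi> x) S2 S2"
    using comm[of S2 S1] by (simp add: inner_of_diff_left inner_of_diff_right)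
  have "cm.ip (\<Phi> x) S1 S2 = (\<Sum>r\<in>B1. \<Sum>q\<in>B2. cm.ip (\<Phi> x) (nor (h r)) (nor (h q)))"
    unfolding S1_def[abs_def] S2_def[abs_def] inner_of_sum_left inner_of_sum_right ..
  then show ?thesis using 1 2 by simp
qed

lemma mixed_curvature_inequality:
  assumes max: "\<And>q. q \<in> points M \<Longrightarrow> potential q \<le> potential p"
    and crit: "\<And>i b. i \<in> {2..k} \<Longrightarrow> dwarp c i b (slice 1 x) = 0"
  shows "0 \<le> (\<Sum>r\<in>B1. \<Sum>q\<in>B2. sectional_curvature N (f p) (E r) (E q))
    + (real (card I))\<^sup>2 / 4 * squared_mean_curvature M N f p"
proof -
  let ?K = "\<lambda>r q. sectional_curvature N (f p) (E r) (E q)"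
  have xW: "x \<in> cmap M c ` cdom M c" by (rule U_W[OF x_U])
  have perp: "cm.ip (\<Phi> y) (cm.d1 (e r) y) (cm.d1 (e q) y) = 0" "cm.ip (\<Phi> y) (cm.d1 (e q) y) (cm.d1 (e r) y) = 0"
    if "r \<in> B1" "q \<in> B2" "y \<in> U" for r q y
    unfolding isometry[OF that(3)]
    using inner_different_blocks[of 1 "e r" "fst q" "e q" c "cinv M c y"]
      inner_different_blocks[of "fst q" "e q" 1 "e r" c "cinv M c y"] e_B1[OF that(1)] e_B2[OF that(2)] by auto
  have const: "((\<lambda>s. cm.ip (\<Phi> (affine_line I y (e q) s)) (cm.d1 (e r) (affine_line I y (e q) s)) (cm.d1 (e r) (affine_line I y (e q) s)))
      has_real_derivative 0) (at 0)" if "r \<in> B1" "q \<in> B2" "y \<in> U" for r q y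
    using e_B1[OF that(1)] e_B2[OF that(2)]
    by (intro DERIV_isometry[OF that(3)] norm2_first_constant[OF chart_c(1) U_W[OF that(3)], where i = "fst q"]) auto
  have warped: "((\<lambda>s. cm.ip (\<Phi> (affine_line I y (e r) s)) (cm.d1 (e q) (affine_line I y (e r) s)) (cm.d1 (e q) (affine_line I y (e r) s)))
      has_real_derivative 2 * warp c (fst q) (slice 1 y) * dwarp c (fst q) (part 1 (e r)) (slice 1 y) *
        inner_of (cindex (F (fst q))) (lgram (F (fst q)) (c (fst q)) (slice (fst q) y)) (part (fst q) (e q)) (part (fst q) (e q))) (at 0)"
    if "r \<in> B1" "q \<in> B2" "y \<in> U" for r q y
    using e_B1[OF that(1)] e_B2[OF that(2)]
    by (intro DERIV_isometry[OF that(3)] DERIV_norm2_warped[OF chart_c(1) U_W[OF that(3)]]) auto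
  have mixed: "- (ddwarp c (fst q) (part 1 (e r)) (slice 1 x) / warp c (fst q) (slice 1 x))
      \<le> ?K r q + cm.ip (\<Phi> x) (nor (h r)) (nor (h q))" if r: "r \<in> B1" and q: "q \<in> B2" for r q
  proof -
    note er = e_B1[OF r] and eq = e_B2[OF q]
    have unit: "norm2 c (e q) x = 1"
      using frame[unfolded orthonormal_frame_def, THEN conjunct1, rule_format, of q q] eq unfolding cinv_x by simp
    have "((\<lambda>s. 2 * warp c (fst q) (slice 1 (affine_line I x (e r) s)) * dwarp c (fst q) (part 1 (e r)) (slice 1 (affine_line I x (e r) s)) *
        inner_of (cindex (F (fst q))) (lgram (F (fst q)) (c (fst q)) (slice (fst q) (affine_line I x (e r) s))) (part (fst q) (e q)) (part (fst q) (e q)))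
      has_real_derivative 2 * (ddwarp c (fst q) (part 1 (e r)) (slice 1 x) / warp c (fst q) (slice 1 x)) * norm2 c (e q) x) (at 0)"
      using er eq by (intro DERIV2_norm2_warped[OF chart_c(1) xW] crit) auto
    from cm.gauss_mixed[OF x_U perp(1)[OF r q] const[OF r q] warped[OF r q] this]
    have "ddwarp c (fst q) (part 1 (e r)) (slice 1 x) / warp c (fst q) (slice 1 x)
        = - cm.ip (\<Phi> x) (curv N d (\<Phi> x) (E r) (E q) (E q)) (E r)
          + cm.ip (\<Phi> x) (cm.hess (e q) (e r) x) (cm.hess (e q) (e r) x) - cm.ip (\<Phi> x) (h r) (h q)"
      unfolding unit E_def by simp
    moreover have "?K r q = cm.ip (\<Phi> x) (curv N d (\<Phi> x) (E r) (E q) (E q)) (E r)"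
    proof -
      have "r \<noteq> q" using r q blocks(2) by blast
      then show ?thesis
        using cm.sectional_curvature_orthonormal[OF d_def chart_d(2), of "E r" "E q"] orthonormal_E er eq
        unfolding inner_at_N \<Phi>_x[symmetric] by simp
    qed
    \<comment> \<open>Discarding the squared length of the mixed Hessian turns the Gauss equation
      into an inequality.\<close>
    moreover have "0 \<le> cm.ip (\<Phi> x) (cm.hess (e q) (e r) x) (cm.hess (e q) (e r) x)"
      by (rule positive_matrix_nonneg[OF pos_G])
    \<comment> \<open>The tangential parts do not interact: \<open>h r\<close> has no component
      along the later factors, since the length of \<open>e r\<close> is constant along them, and
      \<open>h q\<close> has none along the first factor, since \<open>crit\<close> makes the length
      of \<open>e q\<close> stationary there.\<close>
    moreover have "cm.ip (\<Phi> x) (nor (h r)) (nor (h q)) = cm.ip (\<Phi> x) (h r) (h q)"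
    proof -
      have "cm.ip (\<Phi> x) (h r) (E s) * cm.ip (\<Phi> x) (h q) (E s) = 0" if s: "s \<in> I" for s
      proof (cases "s \<in> B2")
        case True
        have "cm.ip (\<Phi> x) (h r) (E s) = 0"
          unfolding E_def by (rule cm.hess_orthogonal[OF x_U perp(1)[OF r True] const[OF r True x_U]])
        then show ?thesis by simp
      next
        case False
        then have s: "s \<in> B1" using s blocks(1) by blast
        have "dwarp c (fst q) (part 1 (e s)) (slice 1 x) = 0" using crit eq by blast
        then have D: "((\<lambda>t. cm.ip (\<Phi> (affine_line I x (e s) t)) (cm.d1 (e q) (affine_line I x (e s) t)) (cm.d1 (e q) (affine_line I x (e s) t)))
          has_real_derivative 0) (at 0)"
          using warped[OF s q x_U] by simp
        have "cm.ip (\<Phi> x) (h q) (E s) = 0"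
          unfolding E_def by (rule cm.hess_orthogonal[OF x_U perp(2)[OF s q] D])
        then show ?thesis by simp
      qed
      then have "(\<Sum>s\<in>I. cm.ip (\<Phi> x) (h r) (E s) * cm.ip (\<Phi> x) (h q) (E s)) = 0"
        by (intro sum.neutral ballI)
      moreover have "cm.ip (\<Phi> x) (nor (h r)) (nor (h q)) = cm.ip (\<Phi> x) (h r) (h q)
          - (\<Sum>s\<in>I. cm.ip (\<Phi> x) (h r) (E s) * cm.ip (\<Phi> x) (h q) (E s))"
        by (rule inner_perp_perp[OF finite_I _ sym_G]) (rule orthonormal_E)
      ultimately show ?thesis by (simp only: diff_zero)
    qed
    ultimately show ?thesis by simp
  qed
  \<comment> \<open>The summand depends on \<open>q\<close> only through its factor, so each factor
    is counted n_i times; these are exactly the weights in the potential.\<close>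
  have "(\<Sum>q\<in>B2. ddwarp c (fst q) (part 1 (e r)) (slice 1 x) / warp c (fst q) (slice 1 x)) \<le> 0" if r: "r \<in> B1" for r
  proof -
    have "(\<Sum>q\<in>B2. ddwarp c (fst q) (part 1 (e r)) (slice 1 x) / warp c (fst q) (slice 1 x))
        = (\<Sum>i\<in>{2..k}. \<Sum>a\<in>cindex (F i). ddwarp c i (part 1 (e r)) (slice 1 x) / warp c i (slice 1 x))"
      unfolding B2_def using riem
      by (subst sum.Sigma) (auto simp: riemannian_manifold_def topological_manifold_def intro!: sum.cong)
    also have "\<dots> = (\<Sum>i\<in>{2..k}. real (mdim (F i)) * (ddwarp c i (part 1 (e r)) (slice 1 x) / warp c i (slice 1 x)))"
      by (simp add: mdim_def)
    also have "\<dots> \<le> 0"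
      using max e_B1[OF r] crit by (intro potential_critical(2)[OF chart_c(1) xW]) (auto simp: cinv_x)
    finally show ?thesis .
  qed
  then have "0 \<le> (\<Sum>r\<in>B1. - (\<Sum>q\<in>B2. ddwarp c (fst q) (part 1 (e r)) (slice 1 x) / warp c (fst q) (slice 1 x)))"
    by (intro sum_nonneg) simp
  also have "\<dots> \<le> (\<Sum>r\<in>B1. \<Sum>q\<in>B2. ?K r q + cm.ip (\<Phi> x) (nor (h r)) (nor (h q)))"
    unfolding sum_negf[symmetric] using mixed by (intro sum_mono) auto
  also have "\<dots> = (\<Sum>r\<in>B1. \<Sum>q\<in>B2. ?K r q) + (\<Sum>r\<in>B1. \<Sum>q\<in>B2. cm.ip (\<Phi> x) (nor (h r)) (nor (h q)))"
    by (simp add: sum.distrib)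
  finally show ?thesis using squared_mean_curvature_bound by simp
qed

end

text \<open>Collects what both nonexistence claims need, in terms free of the chosen charts: a
  point, an orthonormal frame of the image of the tangent space, and the inequality.\<close>

lemma (in warped_product) curvature_inequality_at_max:
  assumes closed: "closed_manifold M" and dim: "\<And>i. i \<in> {1..k} \<Longrightarrow> mdim (F i) \<ge> 1"
    and orth: "\<And>i j p. i \<in> {1..k} \<Longrightarrow> j \<in> {1..k} \<Longrightarrow> i \<noteq> j \<Longrightarrow> p \<in> points M \<Longrightarrow>
      inner_at M p (factor_mean_curvature k F u i p) (factor_mean_curvature k F u j p) = 0"
    and N: "riemannian_manifold N" and f: "isometric_immersion M N f"
  obtains p E where "p \<in> points M" "f p \<in> points N"
    "\<And>r s. r \<in> I \<Longrightarrow> s \<in> I \<Longrightarrow> inner_at N (f p) (E r) (E s) = (if r = s then 1 else 0)"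
    "range (differential M N f p) = range (\<lambda>w \<alpha>. \<Sum>r\<in>I. w r * E r \<alpha>)"
    "0 \<le> (\<Sum>r\<in>{1} \<times> cindex (F 1). \<Sum>q\<in>Sigma {2..k} (\<lambda>i. cindex (F i)). sectional_curvature N (f p) (E r) (E q))
      + (real (card I))\<^sup>2 / 4 * squared_mean_curvature M N f p"
proof -
  obtain p where p: "p \<in> points M" and max: "\<And>q. q \<in> points M \<Longrightarrow> potential q \<le> potential p"
    using potential_attains_max[OF closed] by blast
  interpret immersed_product k F u N f p
    using N f p by unfold_locales
  \<comment> \<open>Taking \<open>fst\<close> as block map keeps every frame vector tangent to one
    factor.\<close>
  have "\<exists>e. orthonormal_frame I (gram M c p) e \<and> (\<forall>s\<in>I. \<forall>i. i \<notin> I \<or> fst s \<noteq> fst i \<longrightarrow> e s i = 0)"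
    by (rule orthonormal_frame_exists[OF finite_I gram_M_symmetric[OF chart_c] gram_M_positive[OF chart_c]])
      (auto simp: gram_M)
  then obtain e where e: "orthonormal_frame I (gram M c p) e"
    and supp: "\<And>s i. s \<in> I \<Longrightarrow> fst s \<noteq> fst i \<Longrightarrow> e s i = 0" by blast
  interpret framed_immersed_product k F u N f p e
    using e supp by unfold_locales (auto simp: in_block_def)
  have crit: "dwarp c i b (slice 1 x) = 0" if "i \<in> {2..k}" for i b
    unfolding x_def using max orth[OF _ _ _ p] that
    by (intro dwarp_zero_at_max[OF c_def chart_c dim]) auto
  show thesis
    using that[OF p fp _ range_differential mixed_curvature_inequality[OF max crit, unfolded B1_def B2_def]]
      orthonormal_E unfolding inner_at_N by blast
qed

section \<open>From the inequality at the maximum to the nonexistence of immersions\<close>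

theorem theorem6:
  fixes k :: nat
    and F :: "nat \<Rightarrow> ('a, 'c, 'i) riem_manifold"
    and u :: "nat \<Rightarrow> 'a \<Rightarrow> real"
    and M :: "(nat \<Rightarrow> 'a, nat \<Rightarrow> 'c, nat \<times> 'i) riem_manifold"
    and N :: "('b, 'd, 'j) riem_manifold"
    and n1 n :: nat
  assumes "k > 2"
    and "\<forall>i\<in>{1..k}. riemannian_manifold (F i) \<and> mdim (F i) \<ge> 1"
    and "\<forall>i\<in>{2..k}. smooth_function (F 1) (u i) \<and> (\<forall>q\<in>points (F 1). u i q > 0)"
    and "M = multiply_warped_product k F u"
    and "closed_manifold M"
    and "n1 = mdim (F 1)" and "n = (\<Sum>j=1..k. mdim (F j))"
    and "\<forall>i\<in>{1..k}. \<forall>j\<in>{1..k}. i \<noteq> j \<longrightarrow>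
           (\<forall>p\<in>points M.
              inner_at M p (factor_mean_curvature k F u i p) (factor_mean_curvature k F u j p) = 0)"
    and "riemannian_manifold N"
  shows "(\<nexists>f. isometric_immersion M N f \<and>
              (\<forall>p\<in>points M.
                 real n ^ 2 * (real k - 1) / (2 * real k) * squared_mean_curvature M N f p
                   < - real n1 * (real n - real n1) * max_sectional_curvature M N f p)) \<and>
         (negative_sectional_curvature N \<longrightarrow>
            (\<nexists>f. isometric_immersion M N f \<and> minimal_immersion M N f))"
proof -
  interpret wp: warped_product k F u
    using assms(1-3) by unfold_locales auto
  let ?I = "Sigma {1..k} (\<lambda>i. cindex (F i))"
  let ?B1 = "{1 :: nat} \<times> cindex (F 1)" and ?B2 = "Sigma {2..k} (\<lambda>i. cindex (F i))"
  note M = assms(4)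
  have fin: "finite (cindex (F i))" if "i \<in> {1..k}" for i
    using assms(2) that by (auto simp: riemannian_manifold_def topological_manifold_def)
  have cardI: "card ?I = n"
    using fin by (subst card_SigmaI) (auto simp: assms(7) mdim_def)
  have split: "{1..k} = insert 1 {2..k}" using assms(1) by auto
  have cardB1: "card ?B1 = n1" by (simp add: assms(6) mdim_def card_cartesian_product)
  have cardB2: "real (card ?B2) = real n - real n1"
  proof -
    have "card ?B2 = (\<Sum>j\<in>{2..k}. mdim (F j))"
      using fin by (subst card_SigmaI) (auto simp: mdim_def)
    moreover have "n = n1 + (\<Sum>j\<in>{2..k}. mdim (F j))"
      unfolding assms(6,7) split by (subst sum.insert) auto
    ultimately show ?thesis by simp
  qed
  have sub: "?B1 \<subseteq> ?I" "?B2 \<subseteq> ?I" "?B1 \<inter> ?B2 = {}" using assms(1) by auto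
  have pos1: "n1 > 0" using assms(1,2,6) by (auto dest: bspec[of _ _ 1])
  have pos2: "card ?B2 > 0"
  proof -
    have "card (cindex (F 2)) \<ge> 1" using assms(1,2) by (auto simp: mdim_def dest: bspec[of _ _ 2])
    then obtain a where "a \<in> cindex (F 2)" by (metis card.empty equals0I not_one_le_zero)
    then have "(2, a) \<in> ?B2" using assms(1) by auto
    moreover have "finite ?B2" using finite_subset[OF sub(2) wp.finite_I] .
    ultimately show ?thesis using card_gt_0_iff by blast
  qed
  have key: "\<exists>p\<in>points M. f p \<in> points N \<and> (\<exists>E.
      (\<forall>r\<in>?I. \<forall>s\<in>?I. inner_at N (f p) (E r) (E s) = (if r = s then 1 else 0)) \<and>
      range (differential M N f p) = range (\<lambda>w \<alpha>. \<Sum>r\<in>?I. w r * E r \<alpha>) \<and>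
      0 \<le> (\<Sum>r\<in>?B1. \<Sum>q\<in>?B2. sectional_curvature N (f p) (E r) (E q))
        + (real n)\<^sup>2 / 4 * squared_mean_curvature M N f p)"
    if f: "isometric_immersion M N f" for f
  proof -
    have closed: "closed_manifold wp.M" using assms(4,5) by simp
    have dim: "mdim (F i) \<ge> 1" if "i \<in> {1..k}" for i using assms(2) that by blast
    have orth: "inner_at wp.M p (factor_mean_curvature k F u i p) (factor_mean_curvature k F u j p) = 0"
      if "i \<in> {1..k}" "j \<in> {1..k}" "i \<noteq> j" "p \<in> points wp.M" for i j p
      using assms(8) that unfolding M by blast
    show ?thesis
    proof (rule wp.curvature_inequality_at_max[OF closed dim orth assms(9) f[unfolded M]])
      fix p and E :: "nat \<times> 'i \<Rightarrow> 'j \<Rightarrow> real"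
      assume *: "p \<in> points wp.M" "f p \<in> points N"
        "\<And>r s. r \<in> ?I \<Longrightarrow> s \<in> ?I \<Longrightarrow> inner_at N (f p) (E r) (E s) = (if r = s then 1 else 0)"
        "range (differential wp.M N f p) = range (\<lambda>w \<alpha>. \<Sum>r\<in>?I. w r * E r \<alpha>)"
        "0 \<le> (\<Sum>r\<in>?B1. \<Sum>q\<in>?B2. sectional_curvature N (f p) (E r) (E q))
          + (real (card ?I))\<^sup>2 / 4 * squared_mean_curvature wp.M N f p"
      show ?thesis
        unfolding M cardI[symmetric]
        by (rule bexI[OF _ *(1)], rule conjI[OF *(2)], rule exI[of _ E]) (intro conjI ballI *)
    qed
  qed
  show ?thesis
  proof (intro conjI notI impI)
    assume "\<exists>f. isometric_immersion M N f \<and>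
              (\<forall>p\<in>points M.
                 real n ^ 2 * (real k - 1) / (2 * real k) * squared_mean_curvature M N f p
                   < - real n1 * (real n - real n1) * max_sectional_curvature M N f p)"
    then obtain f where f: "isometric_immersion M N f"
      and ineq: "\<And>p. p \<in> points M \<Longrightarrow> real n ^ 2 * (real k - 1) / (2 * real k) * squared_mean_curvature M N f p
                   < - real n1 * (real n - real n1) * max_sectional_curvature M N f p" by blast
    obtain p E where p: "p \<in> points M" "f p \<in> points N"
      and on: "\<And>r s. r \<in> ?I \<Longrightarrow> s \<in> ?I \<Longrightarrow> inner_at N (f p) (E r) (E s) = (if r = s then 1 else 0)"
      and T: "range (differential M N f p) = range (\<lambda>w \<alpha>. \<Sum>r\<in>?I. w r * E r \<alpha>)"
      and main: "0 \<le> (\<Sum>r\<in>?B1. \<Sum>q\<in>?B2. sectional_curvature N (f p) (E r) (E q))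
        + (real n)\<^sup>2 / 4 * squared_mean_curvature M N f p"
      using key[OF f] by blast
    have "sectional_curvature N (f p) (E r) (E q) \<le> max_sectional_curvature M N f p"
      if "r \<in> ?B1" "q \<in> ?B2" for r q
      unfolding max_sectional_curvature_def
      using that sub by (intro sectional_curvature_le_Greatest[OF assms(9) p(2) wp.finite_I on T]) blast+
    then have "(\<Sum>r\<in>?B1. \<Sum>q\<in>?B2. sectional_curvature N (f p) (E r) (E q))
        \<le> (\<Sum>r\<in>?B1. \<Sum>q\<in>?B2. max_sectional_curvature M N f p)"
      by (intro sum_mono) auto
    \<comment> \<open>The factor n_1 (n - n_1) counts the pairs of frame vectors, one from the first
      factor and one from the others.\<close>
    also have "\<dots> = real n1 * (real n - real n1) * max_sectional_curvature M N f p"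
      using cardB1 cardB2 by simp
    finally have 1: "0 \<le> real n1 * (real n - real n1) * max_sectional_curvature M N f p
        + (real n)\<^sup>2 / 4 * squared_mean_curvature M N f p" using main by simp
    \<comment> \<open>Replacing the coefficient 1/4 by the larger one is legitimate because the
      squared mean curvature is nonnegative.\<close>
    have H: "0 \<le> squared_mean_curvature M N f p"
    proof -
      have "(\<Union>c\<in>charts N. cdom N c) = points N"
        using assms(9) by (simp add: riemannian_manifold_def topological_manifold_def)
      note ch = chart_at[OF this p(2)]
      have "positive_matrix (cindex N) (gram N (chart_at N (f p)) (f p))"
        using assms(9) ch unfolding riemannian_manifold_def riemannian_metric_def positive_matrix_def by blast
      then show ?thesis
        unfolding squared_mean_curvature_def inner_at_def gram_at_def by (rule positive_matrix_nonneg)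
    qed
    have "(1::real) / 4 \<le> (real k - 1) / (2 * real k)"
      using assms(1) by (simp add: field_simps)
    then have "(real n)\<^sup>2 * squared_mean_curvature M N f p * (1 / 4)
        \<le> (real n)\<^sup>2 * squared_mean_curvature M N f p * ((real k - 1) / (2 * real k))"
      using H by (intro mult_left_mono) auto
    moreover have "real n ^ 2 * (real k - 1) / (2 * real k) * squared_mean_curvature M N f p
        = (real n)\<^sup>2 * squared_mean_curvature M N f p * ((real k - 1) / (2 * real k))"
      by (simp add: mult_ac)
    ultimately show False using 1 ineq[OF p(1)] by linarith
  next
    assume neg: "negative_sectional_curvature N"
    assume "\<exists>f. isometric_immersion M N f \<and> minimal_immersion M N f"
    then obtain f where f: "isometric_immersion M N f" and min: "minimal_immersion M N f" by blast
    obtain p E where p: "p \<in> points M" "f p \<in> points N"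
      and on: "\<And>r s. r \<in> ?I \<Longrightarrow> s \<in> ?I \<Longrightarrow> inner_at N (f p) (E r) (E s) = (if r = s then 1 else 0)"
      and main: "0 \<le> (\<Sum>r\<in>?B1. \<Sum>q\<in>?B2. sectional_curvature N (f p) (E r) (E q))
        + (real n)\<^sup>2 / 4 * squared_mean_curvature M N f p"
      using key[OF f] by blast
    have "squared_mean_curvature M N f p = 0"
      unfolding squared_mean_curvature_def inner_at_def inner_of_def
      using min p(1) by (simp add: minimal_immersion_def)
    with main have nonneg: "0 \<le> (\<Sum>r\<in>?B1. \<Sum>q\<in>?B2. sectional_curvature N (f p) (E r) (E q))" by simp
    \<comment> \<open>Orthonormal vectors are independent, so negativity applies to each mixed
      plane.\<close>
    have K: "sectional_curvature N (f p) (E r) (E q) < 0" if "r \<in> ?B1" "q \<in> ?B2" for r q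
    proof -
      have rq: "r \<in> ?I" "q \<in> ?I" "r \<noteq> q" using that sub by blast+
      have "independent_pair (cindex N) (E r) (E q)"
        unfolding independent_pair_def
      proof (intro allI impI)
        fix a b assume "\<forall>i\<in>cindex N. a * E r i + b * E q i = 0"
        then have *: "inner_at N (f p) (\<lambda>i. a * E r i + b * E q i) w = 0" for w
          by (simp add: inner_at_def inner_of_def)
        show "a = 0 \<and> b = 0"
          using *[of "E r"] *[of "E q"] on rq unfolding inner_at_def inner_of_linear by auto
      qed
      then show ?thesis using neg p(2) unfolding negative_sectional_curvature_def by blast
    qed
    \<comment> \<open>Both index sets are nonempty since every factor has positive dimension;
      otherwise the empty sum would be compatible with the inequality.\<close>
    have B: "finite ?B1" "finite ?B2" "?B1 \<noteq> {}" "?B2 \<noteq> {}"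
      using pos1 pos2 cardB1 card_gt_0_iff by blast+
    have "(\<Sum>q\<in>?B2. sectional_curvature N (f p) (E r) (E q)) < (\<Sum>q\<in>?B2. 0)" if "r \<in> ?B1" for r
      by (rule sum_strict_mono[OF B(2,4)]) (rule K[OF that])
    then have "(\<Sum>r\<in>?B1. \<Sum>q\<in>?B2. sectional_curvature N (f p) (E r) (E q)) < (\<Sum>r\<in>?B1. \<Sum>q\<in>?B2. 0)"
      by (rule sum_strict_mono[OF B(1,3)])
    then show False using nonneg by simp
  qed
qed

end
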